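(* Let $C\subset\mathbb{P}^2$ be a rational plane algebraic curve over $\mathbb{C}$ of degree $d\ge3$ with parametrization $\varphi(s,t)=(\varphi_0(s,t):\varphi_1(s,t):\varphi_2(s,t))$, $(s:t)\in\mathbb{P}^1$, and let $\xi(s,t)$ denote the Wronski determinant $$\xi(s,t)=\det\left(\frac{\partial^5 q_j}{\partial s^{5-i}\,\partial t^{i}}\right)_{0\le i\le5,\ 0\le j\le5},\qquad (q_0,q_1,q_2,q_3,q_4,q_5)=(\varphi_0^2,\varphi_1^2,\varphi_2^2,\varphi_1\varphi_2,\varphi_0\varphi_2,\varphi_0\varphi_1),$$ where $i$ is the row index and $j$ the column index. Moreover, let $(s_i:t_i)$ denote the distinct zeros of $\xi(s,t)$, with $i\le 6(2d-5)$. Then the points $p_i=\varphi(s_i,t_i)$ are $2$-Weierstrass points on $C$, and the $2$-Weierstrass weight $w_{p_i}(2)$ is equal to the order of the zero of $\xi(s,t)$ corresponding to $(s_i:t_i)$.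
   Context: A rational plane curve is an irreducible plane curve of geometric genus $0$; the parametrization $\varphi$ is birational onto $C$ and given by homogeneous polynomials $\varphi_0,\varphi_1,\varphi_2\in\mathbb{C}[s,t]$ of degree $d$ without common factor. $C$ is not assumed cuspidal. A smooth point $p\in C$ is a $2$-Weierstrass point if there is a curve of degree $2$ (not necessarily irreducible or reduced) whose intersection multiplicity with $C$ at $p$ is strictly larger than $5$; equivalently, $p$ is an inflection point (tangent line meets $C$ at $p$ with multiplicity $>2$) or a sextactic point (a smooth non-inflection point whose osculating conic meets $C$ at $p$ with multiplicity $\ge6$). For singular curves, all singular points are also counted as $2$-Weierstrass points. The $2$-Weierstrass weight $w_p(2)$ of a point $p$ at which $C$ is unibranched (smooth point or unibranched singular point) is $w_p(2)=\sum_{i=0}^5(h_i-i)$, where $h_0,\dots,h_5$ are the six distinct intersection multiplicities $h_i=(C\cdot C_i)_p$ attained at $p$ by curves $C_0,\dots,C_5$ of degree $2$. At a point with several branches the weight is calculated for each branch separately in the same way (using intersection multiplicities of degree $2$ curves with the branch), and $w_p(2)$ is obtained by summing over the branches.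
   Formalization: Where several zeros of ξ map to the same point p, the literal equality fails (e.g. the lemniscate's node); instead the weight of each branch equals the order of its zero, and w_p(2) is the sum of the orders of all zeros mapping to p (equal to the single order if C is unibranched at p). *)

theory Defs
  imports
    "HOL-Computational_Algebra.Computational_Algebra"
    "HOL-Computational_Algebra.Field_as_Ring"
    "Jordan_Normal_Form.Determinant"
    "HOL-Library.Extended_Nat"
begin

(* C[s,t] is modelled as complex poly poly, i.e. C[s][t]: the inner variable is s, the outer t.
   C[x,y,z] is modelled as complex poly poly poly, i.e. C[x][y][z]: innermost x, outermost z. *)

type_synonym form2 = "complex poly poly"
type_synonym form3 = "complex poly poly poly"
type_synonym 'a triple = "'a \<times> 'a \<times> 'a"

definition homogeneous2 :: "nat \<Rightarrow> form2 \<Rightarrow> bool" where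
  "homogeneous2 n P \<longleftrightarrow> (\<forall>i j. coeff (coeff P j) i \<noteq> 0 \<longrightarrow> i + j = n)"

definition homogeneous3 :: "nat \<Rightarrow> form3 \<Rightarrow> bool" where
  "homogeneous3 n P \<longleftrightarrow>
     (\<forall>i j k. coeff (coeff (coeff P k) j) i \<noteq> 0 \<longrightarrow> i + j + k = n)"

(* Substitution of elements of a commutative complex algebra; h is the structure map of the
   algebra: id for complex, fps_const for complex fps, and the constant embedding for form2. *)

fun eval2 :: "(complex \<Rightarrow> 'a::comm_ring_1) \<Rightarrow> form2 \<Rightarrow> 'a \<times> 'a \<Rightarrow> 'a" where
  "eval2 h P (s, t) = poly (map_poly (\<lambda>p. poly (map_poly h p) s) P) t"

fun eval3 :: "(complex \<Rightarrow> 'a::comm_ring_1) \<Rightarrow> form3 \<Rightarrow> 'a triple \<Rightarrow> 'a" where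
  "eval3 h P (x, y, z) =
     poly (map_poly (\<lambda>q. poly (map_poly (\<lambda>p. poly (map_poly h p) x) q) y) P) z"

definition const2 :: "complex \<Rightarrow> form2" where
  "const2 c = [:[:c:]:]"

definition var_s :: form2 where
  "var_s = [:[:0, 1:]:]"

definition var_t :: form2 where
  "var_t = [:0, 1:]"

definition deriv_s :: "form2 \<Rightarrow> form2" where
  "deriv_s P = map_poly pderiv P"

definition deriv_t :: "form2 \<Rightarrow> form2" where
  "deriv_t P = pderiv P"

fun eval_triple :: "(complex \<Rightarrow> 'a::comm_ring_1) \<Rightarrow> form2 triple \<Rightarrow> 'a \<times> 'a \<Rightarrow> 'a triple" where
  "eval_triple h (f0, f1, f2) v = (eval2 h f0 v, eval2 h f1 v, eval2 h f2 v)"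


section \<open>Projective points\<close>

(* A point of the projective line or plane is the set of all its homogeneous coordinate vectors. *)

fun point1 :: "complex \<times> complex \<Rightarrow> (complex \<times> complex) set" where
  "point1 (s, t) = {(c * s, c * t) | c. c \<noteq> 0}"

fun point2 :: "complex triple \<Rightarrow> complex triple set" where
  "point2 (x, y, z) = {(c * x, c * y, c * z) | c. c \<noteq> 0}"

definition coords :: "'a set \<Rightarrow> 'a" where
  "coords p = (SOME v. v \<in> p)"

definition form_zeros :: "form2 \<Rightarrow> (complex \<times> complex) set set" where
  "form_zeros P = {point1 v | v. v \<noteq> (0, 0) \<and> eval2 id P v = 0}"

(* The order of the zero (a : b) is the exponent of the linear factor b s - a t. *)

definition zero_order :: "form2 \<Rightarrow> (complex \<times> complex) set \<Rightarrow> nat" where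
  "zero_order P L =
     (case coords L of (a, b) \<Rightarrow> multiplicity (const2 b * var_s - const2 a * var_t) P)"


section \<open>Plane curves and rational parametrizations\<close>

(* The curve with equation F = 0; irreducible means reduced and irreducible. *)

definition irreducible_plane_curve :: "nat \<Rightarrow> form3 \<Rightarrow> bool" where
  "irreducible_plane_curve d F \<longleftrightarrow> homogeneous3 d F \<and> Factorial_Ring.irreducible F"

definition on_curve :: "form3 \<Rightarrow> complex triple set \<Rightarrow> bool" where
  "on_curve F p \<longleftrightarrow> eval3 id F (coords p) = 0"

definition singular_point :: "form3 \<Rightarrow> complex triple set \<Rightarrow> bool" where
  "singular_point F p \<longleftrightarrow>
     on_curve F p \<and>
     eval3 id (map_poly (map_poly pderiv) F) (coords p) = 0 \<and>
     eval3 id (map_poly pderiv F) (coords p) = 0 \<and>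
     eval3 id (pderiv F) (coords p) = 0"

(* The last conjunct is birationality onto the curve: there is a rational map (A : B) from the
   curve to the projective line with (A(f) : B(f)) = (s : t) identically. *)

fun rational_parametrization :: "nat \<Rightarrow> form3 \<Rightarrow> form2 triple \<Rightarrow> bool" where
  "rational_parametrization d F (f0, f1, f2) \<longleftrightarrow>
     homogeneous2 d f0 \<and> homogeneous2 d f1 \<and> homogeneous2 d f2 \<and>
     (\<forall>g. g dvd f0 \<and> g dvd f1 \<and> g dvd f2 \<longrightarrow> is_unit g) \<and>
     eval3 const2 F (f0, f1, f2) = 0 \<and>
     (\<exists>n A B. homogeneous3 n A \<and> homogeneous3 n B \<and>
        (eval3 const2 A (f0, f1, f2) \<noteq> 0 \<or> eval3 const2 B (f0, f1, f2) \<noteq> 0) \<and>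
        var_t * eval3 const2 A (f0, f1, f2) = var_s * eval3 const2 B (f0, f1, f2))"

definition image_point :: "form2 triple \<Rightarrow> (complex \<times> complex) set \<Rightarrow> complex triple set" where
  "image_point f L = point2 (eval_triple id f (coords L))"


section \<open>Branches\<close>

(* A branch of a curve at p is an equivalence class of irreducible formal parametrizations
   centred at p (a place in the sense of Walker).  A formal parametrization is a vector of
   homogeneous coordinates in C[[z]], not all vanishing at z = 0.  It may be multiplied by a unit
   u and reparametrized by a power series sigma without constant term; it is irreducible if it is
   not obtained from another one through a sigma of order greater than 1.  The case sigma = 0 also
   excludes constant parametrizations. *)

fun reparametrize :: "complex fps \<Rightarrow> complex fps \<Rightarrow> complex fps triple \<Rightarrow> complex fps triple" where
  "reparametrize u \<sigma> (x, y, z) =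
     (u * fps_compose x \<sigma>, u * fps_compose y \<sigma>, u * fps_compose z \<sigma>)"

fun initial_vector :: "complex fps triple \<Rightarrow> complex triple" where
  "initial_vector (x, y, z) = (fps_nth x 0, fps_nth y 0, fps_nth z 0)"

definition irreducible_parametrization :: "complex fps triple \<Rightarrow> bool" where
  "irreducible_parametrization \<gamma> \<longleftrightarrow>
     (\<forall>u \<sigma> \<delta>. fps_nth \<sigma> 0 = 0 \<and> \<gamma> = reparametrize u \<sigma> \<delta> \<longrightarrow> fps_nth \<sigma> 1 \<noteq> 0)"

definition branch_of :: "complex fps triple \<Rightarrow> complex fps triple set" where
  "branch_of \<gamma> =
     {reparametrize u \<sigma> \<gamma> | u \<sigma>. fps_nth u 0 \<noteq> 0 \<and> fps_nth \<sigma> 0 = 0 \<and> fps_nth \<sigma> 1 \<noteq> 0}"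

definition branches :: "form3 \<Rightarrow> complex triple set \<Rightarrow> complex fps triple set set" where
  "branches F p =
     {branch_of \<gamma> | \<gamma>. initial_vector \<gamma> \<noteq> (0, 0, 0) \<and> point2 (initial_vector \<gamma>) = p \<and>
        eval3 fps_const F \<gamma> = 0 \<and> irreducible_parametrization \<gamma>}"

definition unibranched :: "form3 \<Rightarrow> complex triple set \<Rightarrow> bool" where
  "unibranched F p \<longleftrightarrow> card (branches F p) = 1"

(* The branch traced by f at the parameter L = (s : t), using an affine coordinate z of the
   projective line centred at L: (s : t + z) if s is nonzero, and (z : t) otherwise. *)

definition branch_at :: "form2 triple \<Rightarrow> (complex \<times> complex) set \<Rightarrow> complex fps triple set" where
  "branch_at f L =
     (case coords L of (s, t) \<Rightarrow>
        branch_of (eval_triple fps_const f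
          (if s = 0 then (fps_X, fps_const t) else (fps_const s, fps_const t + fps_X))))"


section \<open>Intersection multiplicities and 2-Weierstrass points\<close>

definition branch_mult :: "complex fps triple set \<Rightarrow> form3 \<Rightarrow> enat" where
  "branch_mult b Q =
     (let q = eval3 fps_const Q (coords b) in if q = 0 then \<infinity> else enat (subdegree q))"

(* The intersection multiplicity of the curves F = 0 and Q = 0 at p. *)

definition curve_mult :: "form3 \<Rightarrow> form3 \<Rightarrow> complex triple set \<Rightarrow> enat" where
  "curve_mult F Q p = (\<Sum>b\<in>branches F p. branch_mult b Q)"

definition conic :: "form3 \<Rightarrow> bool" where
  "conic Q \<longleftrightarrow> homogeneous3 2 Q \<and> Q \<noteq> 0"

definition weierstrass2_point :: "form3 \<Rightarrow> complex triple set \<Rightarrow> bool" where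
  "weierstrass2_point F p \<longleftrightarrow>
     on_curve F p \<and> (singular_point F p \<or> (\<exists>Q. conic Q \<and> curve_mult F Q p > 5))"

definition branch_mults :: "complex fps triple set \<Rightarrow> nat set" where
  "branch_mults b = {h. \<exists>Q. conic Q \<and> branch_mult b Q = enat h}"

(* h_0 < ... < h_5 are the elements of branch_mults b. *)

definition branch_weight :: "complex fps triple set \<Rightarrow> int" where
  "branch_weight b = (\<Sum>i<6. int (sorted_list_of_set (branch_mults b) ! i) - int i)"

definition weight2 :: "form3 \<Rightarrow> complex triple set \<Rightarrow> int" where
  "weight2 F p = (\<Sum>b\<in>branches F p. branch_weight b)"


section \<open>The Wronski determinant\<close>

fun conic_monomials :: "form2 triple \<Rightarrow> form2 list" where
  "conic_monomials (f0, f1, f2) = [f0\<^sup>2, f1\<^sup>2, f2\<^sup>2, f1 * f2, f0 * f2, f0 * f1]"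

definition wronski :: "form2 triple \<Rightarrow> form2" where
  "wronski f =
     Determinant.det (Matrix.mat 6 6
       (\<lambda>(i, j). (deriv_s ^^ (5 - i)) ((deriv_t ^^ i) (conic_monomials f ! j))))"

end

theory Submission
  imports Defs "Jordan_Normal_Form.Char_Poly"
begin

text \<open>Two curves without common component share no non-constant point over a domain containing the
  complex numbers. Hence every form vanishing on the parametrization f is a multiple of F, and the
  rational inverse of f turns every irreducible formal parametrization of the curve into a
  reparametrization of f at a unique parameter: the branches at a point correspond to its preimages
  on the projective line. Since d is at least 3, the six conic monomials in f are linearly
  independent along each branch. The orders of the series in their span are the intersection
  multiplicities with conics; there are exactly six of them, and a basis adapted to these orders
  shows that the Wronskian in a local parameter has order \<open>h\<^sub>0 + \<dots> + h\<^sub>5 - 15\<close>, the initial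
  coefficient being a Vandermonde-type determinant. By Euler's relation this Wronskian is,
  up to a nonzero constant, the form \<open>\<xi>\<close> evaluated at the local parameter.\<close>

text \<open>Branches are defined as classes of all irreducible formal parametrizations, so nothing
  ties them to \<open>f\<close> at the outset; this shapes the proof. The elimination lemma is used
  over two domains. Over C[s,t], at the point \<open>f\<close>, it determines the equations of the
  curve. Over C[[z]] it shows that the inverse (A : B) is not (0 : 0) along an irreducible
  parametrization, which would otherwise be constant. The inverse serves three times: no branch
  traced by \<open>f\<close> is a reparametrization of higher order, distinct parameters give
  distinct branches, and there are no further branches. The monomials are independent for d >= 3
  because the degree of \<open>F\<close> is too large for \<open>F\<close> to divide a conic. The
  degree 6 (2 d - 5) of the Wronskian is six times the degree of a fifth derivative of a form of
  degree 2 d, and 15 is 0 + 1 + ... + 5. The local parameter is z in (s : t + z), except at s = 0,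
  where it is z in (z : t); there the two partial derivatives change roles.\<close>

declare eval2.simps [simp del] eval3.simps [simp del]

section \<open>Ring homomorphisms and substitution into polynomials\<close>

lemma comm_ring_homD:
  assumes "comm_ring_hom \<phi>"
  shows "\<phi> 0 = 0" "\<phi> 1 = 1" "\<phi> (x + y) = \<phi> x + \<phi> y" "\<phi> (x * y) = \<phi> x * \<phi> y"
    "\<phi> (- x) = - \<phi> x" "\<phi> (x - y) = \<phi> x - \<phi> y" "\<phi> (x ^ n) = \<phi> x ^ n"
    "\<phi> (sum u I) = (\<Sum>i\<in>I. \<phi> (u i))" "\<phi> (prod v J) = (\<Prod>j\<in>J. \<phi> (v j))"
    "\<phi> (of_nat n) = of_nat n"
proof -
  interpret comm_ring_hom \<phi> by fact
  show "\<phi> 0 = 0" "\<phi> 1 = 1" "\<phi> (x + y) = \<phi> x + \<phi> y" "\<phi> (x * y) = \<phi> x * \<phi> y"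
    "\<phi> (- x) = - \<phi> x" "\<phi> (x - y) = \<phi> x - \<phi> y" "\<phi> (x ^ n) = \<phi> x ^ n"
    "\<phi> (sum u I) = (\<Sum>i\<in>I. \<phi> (u i))" "\<phi> (prod v J) = (\<Prod>j\<in>J. \<phi> (v j))"
    "\<phi> (of_nat n) = of_nat n"
    by (simp_all add: hom_distribs)
qed

lemma comm_ring_hom_map_poly:
  assumes "comm_ring_hom h"
  shows "comm_ring_hom (map_poly h)"
proof -
  interpret h: comm_ring_hom h by fact
  interpret m: map_poly_comm_ring_hom h ..
  show ?thesis by unfold_locales
qed

lemma poly_eq_sum_atMost:
  assumes "degree p \<le> n"
  shows "poly p (x :: 'a :: comm_semiring_1) = (\<Sum>i\<le>n. coeff p i * x ^ i)"
  unfolding poly_altdef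
  by (rule sum.mono_neutral_left) (use assms in \<open>auto simp: coeff_eq_0\<close>)

lemma comm_ring_hom_poly_map_poly:
  assumes "comm_ring_hom h"
  shows "comm_ring_hom (\<lambda>p. poly (map_poly h p) x)"
proof -
  interpret h: comm_ring_hom h by fact
  interpret m: map_poly_comm_ring_hom h ..
  show ?thesis by unfold_locales (auto simp: hom_distribs)
qed

lemma comm_ring_hom_eval2:
  assumes "comm_ring_hom h"
  shows "comm_ring_hom (\<lambda>P. eval2 h P v)"
  using comm_ring_hom_poly_map_poly[OF comm_ring_hom_poly_map_poly[OF assms]]
  by (cases v) (simp add: eval2.simps)

lemma comm_ring_hom_eval3:
  assumes "comm_ring_hom h"
  shows "comm_ring_hom (\<lambda>P. eval3 h P x)"
  using comm_ring_hom_poly_map_poly[OF comm_ring_hom_poly_map_poly[OF comm_ring_hom_poly_map_poly[OF assms]]]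
  by (cases x) (simp add: eval3.simps)

lemma comm_ring_hom_id_complex: "comm_ring_hom (id :: complex \<Rightarrow> complex)"
  by unfold_locales auto

lemma comm_ring_hom_fps_const: "comm_ring_hom (fps_const :: complex \<Rightarrow> complex fps)"
  by unfold_locales auto

lemma comm_ring_hom_const2: "comm_ring_hom const2"
  by unfold_locales (auto simp: const2_def pCons_one)

text \<open>The structure map of C[x,y,z], needed to substitute the ternary forms \<open>A\<close>
  and \<open>B\<close> into the components of \<open>f\<close>.\<close>

definition const3 :: "complex \<Rightarrow> form3" where
  "const3 c = [:[:[:c:]:]:]"

lemma comm_ring_hom_const3: "comm_ring_hom const3"
  by unfold_locales (auto simp: const3_def pCons_one)

lemma comm_ring_hom_pCons:
  assumes "comm_ring_hom h"
  shows "comm_ring_hom (\<lambda>c. [:h c:])"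
proof -
  interpret h: comm_ring_hom h by fact
  show ?thesis by unfold_locales (auto simp: hom_distribs pCons_one)
qed

lemma comm_ring_hom_eq_0_iff:
  fixes h :: "complex \<Rightarrow> 'a::idom"
  assumes "comm_ring_hom h"
  shows "h c = 0 \<longleftrightarrow> c = 0"
proof -
  interpret h: comm_ring_hom h by fact
  have "h c * h (inverse c) = 1" if "c \<noteq> 0"
    using that by (simp flip: h.hom_mult)
  then show ?thesis by (metis h.hom_zero mult_zero_left zero_neq_one)
qed

lemma hom_poly_map_poly:
  assumes "comm_ring_hom \<phi>" "comm_ring_hom h"
  shows "\<phi> (poly (map_poly h p) x) = poly (map_poly (\<lambda>c. \<phi> (h c)) p) (\<phi> x)"
proof -
  interpret \<phi>: comm_ring_hom \<phi> by fact
  interpret h: comm_ring_hom h by fact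
  show ?thesis by (induction p) (auto simp: hom_distribs Polynomial.map_poly_pCons)
qed

text \<open>Naturality of substitution. It moves identities between complex numbers, forms and power
  series; the maps used include evaluation of forms, composition with a series, and the constant
  term.\<close>

lemma hom_eval2:
  assumes "comm_ring_hom \<phi>" "comm_ring_hom h"
  shows "\<phi> (eval2 h P (x, y)) = eval2 (\<lambda>c. \<phi> (h c)) P (\<phi> x, \<phi> y)"
  using assms
  by (simp add: eval2.simps hom_poly_map_poly[OF assms(1) comm_ring_hom_poly_map_poly[OF assms(2)]] hom_poly_map_poly[OF assms])

lemma hom_eval3:
  assumes "comm_ring_hom \<phi>" "comm_ring_hom h"
  shows "\<phi> (eval3 h P (x, y, z)) = eval3 (\<lambda>c. \<phi> (h c)) P (\<phi> x, \<phi> y, \<phi> z)"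
  using assms
  by (simp add: eval3.simps hom_poly_map_poly[OF assms(1) comm_ring_hom_poly_map_poly[OF comm_ring_hom_poly_map_poly[OF assms(2)]]]
      hom_poly_map_poly[OF assms(1) comm_ring_hom_poly_map_poly[OF assms(2)]] hom_poly_map_poly[OF assms])

section \<open>Binary forms\<close>

text \<open>Setting s = 1 identifies binary forms of degree n with polynomials of degree at most n.
  The degree n cannot be read off the polynomial: a drop in its degree records a zero at (0 :
  1).\<close>

definition homog :: "nat \<Rightarrow> complex poly \<Rightarrow> form2" where
  "homog n p = (\<Sum>j\<le>n. monom (monom (coeff p j) (n - j)) j)"

definition dehom :: "form2 \<Rightarrow> complex poly" where
  "dehom P = map_poly (\<lambda>p. poly p 1) P"

lemma coeff_homog: "coeff (homog n p) j = (if j \<le> n then monom (coeff p j) (n - j) else 0)"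
  unfolding homog_def coeff_sum by (simp add: coeff_monom if_distrib sum.delta cong: if_cong)

lemma homogeneous2_homog: "homogeneous2 n (homog n p)"
  by (auto simp: homogeneous2_def coeff_homog coeff_monom split: if_splits)

lemma homogeneous2_coeff:
  assumes "homogeneous2 n P"
  shows "coeff P j = (if j \<le> n then monom (coeff (coeff P j) (n - j)) (n - j) else 0)"
proof (rule poly_eqI)
  fix i
  show "coeff (coeff P j) i = coeff (if j \<le> n then monom (coeff (coeff P j) (n - j)) (n - j) else 0) i"
    using assms unfolding homogeneous2_def
    by (cases "i + j = n") (auto simp: coeff_monom)
qed

lemma coeff_dehom:
  assumes "homogeneous2 n P"
  shows "coeff (dehom P) j = (if j \<le> n then coeff (coeff P j) (n - j) else 0)"
proof -
  have "poly (coeff P j) 1 = (if j \<le> n then coeff (coeff P j) (n - j) else 0)"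
    by (subst homogeneous2_coeff[OF assms]) (simp add: poly_monom)
  then show ?thesis by (simp add: dehom_def coeff_map_poly)
qed

lemma homog_dehom:
  assumes "homogeneous2 n P"
  shows "homog n (dehom P) = P"
proof (rule poly_eqI)
  fix j
  show "coeff (homog n (dehom P)) j = coeff P j"
    using homogeneous2_coeff[OF assms, of j] by (auto simp: coeff_homog coeff_dehom[OF assms] split: if_splits)
qed

lemma dehom_homog: "degree p \<le> n \<Longrightarrow> dehom (homog n p) = p"
  by (rule poly_eqI) (auto simp: coeff_dehom[OF homogeneous2_homog] coeff_homog coeff_eq_0)

lemma degree_dehom_le: "homogeneous2 n P \<Longrightarrow> degree (dehom P) \<le> n"
  by (rule degree_le) (simp add: coeff_dehom)

lemma comm_ring_hom_dehom: "comm_ring_hom dehom"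
  unfolding dehom_def by (intro comm_ring_hom_map_poly) (unfold_locales, auto)

lemma homogeneous2_add: "homogeneous2 n P \<Longrightarrow> homogeneous2 n Q \<Longrightarrow> homogeneous2 n (P + Q)"
  unfolding homogeneous2_def by (metis add.right_neutral coeff_add)

lemma homogeneous2_0 [simp]: "homogeneous2 n 0"
  by (simp add: homogeneous2_def)

lemma homogeneous2_sum: "(\<And>i. i \<in> I \<Longrightarrow> homogeneous2 n (P i)) \<Longrightarrow> homogeneous2 n (sum P I)"
  by (induction I rule: infinite_finite_induct) (auto intro: homogeneous2_add)

lemma homogeneous2_mult:
  assumes "homogeneous2 m P" "homogeneous2 n Q"
  shows "homogeneous2 (m + n) (P * Q)"
  unfolding homogeneous2_def
proof (intro allI impI)
  fix i j
  assume "coeff (coeff (P * Q) j) i \<noteq> 0"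
  then have "(\<Sum>k\<le>j. \<Sum>l\<le>i. coeff (coeff P k) l * coeff (coeff Q (j - k)) (i - l)) \<noteq> 0"
    by (simp add: coeff_mult coeff_sum)
  then obtain k where k: "k \<le> j" "(\<Sum>l\<le>i. coeff (coeff P k) l * coeff (coeff Q (j - k)) (i - l)) \<noteq> 0"
    by (metis (no_types, lifting) atMost_iff sum.not_neutral_contains_not_neutral)
  then obtain l where l: "l \<le> i" "coeff (coeff P k) l * coeff (coeff Q (j - k)) (i - l) \<noteq> 0"
    by (metis (no_types, lifting) atMost_iff sum.not_neutral_contains_not_neutral)
  then have "l + k = m" "(i - l) + (j - k) = n"
    using assms by (auto simp: homogeneous2_def)
  then show "i + j = m + n" using k(1) l(1) by linarith
qed

lemma homogeneous2_const2: "homogeneous2 0 (const2 c)"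
  by (auto simp: homogeneous2_def const2_def coeff_pCons split: nat.splits)

lemma homogeneous2_cmult: "homogeneous2 n P \<Longrightarrow> homogeneous2 n (const2 c * P)"
  using homogeneous2_mult[OF homogeneous2_const2] by simp

lemma homogeneous2_1: "homogeneous2 0 1"
  using homogeneous2_const2[of 1] by (simp add: const2_def pCons_one)

lemma homogeneous2_uminus: "homogeneous2 n P \<Longrightarrow> homogeneous2 n (- P)"
  by (simp add: homogeneous2_def)

lemma homogeneous2_prod:
  "finite I \<Longrightarrow> (\<And>i. i \<in> I \<Longrightarrow> homogeneous2 (n i) (P i)) \<Longrightarrow> homogeneous2 (sum n I) (prod P I)"
  by (induction I rule: finite_induct) (auto intro: homogeneous2_mult homogeneous2_1)

lemma homogeneous2_power: "homogeneous2 n P \<Longrightarrow> homogeneous2 (k * n) (P ^ k)"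
  by (induction k) (auto intro: homogeneous2_mult homogeneous2_1)

lemma homogeneous2_eqI:
  assumes "homogeneous2 n P" "homogeneous2 n Q" "dehom P = dehom Q"
  shows "P = Q"
  using assms homog_dehom by metis

lemma eval2_homogeneous2:
  assumes "comm_ring_hom h" "homogeneous2 n P"
  shows "eval2 h P (x, y) = (\<Sum>j\<le>n. h (coeff (dehom P) j) * x ^ (n - j) * y ^ j)"
proof -
  interpret h: comm_ring_hom h by fact
  have "degree (map_poly (\<lambda>p. poly (map_poly h p) x) P) \<le> n"
    by (intro degree_le) (auto simp: coeff_map_poly homogeneous2_coeff[OF assms(2)])
  then have "eval2 h P (x, y) = (\<Sum>j\<le>n. poly (map_poly h (coeff P j)) x * y ^ j)"
    by (simp add: eval2.simps poly_eq_sum_atMost[where n = n] coeff_map_poly comm_ring_homD[OF assms(1)])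
  also have "\<dots> = (\<Sum>j\<le>n. h (coeff (dehom P) j) * x ^ (n - j) * y ^ j)"
    by (intro sum.cong refl, subst homogeneous2_coeff[OF assms(2)])
      (simp add: coeff_dehom[OF assms(2)] map_poly_monom poly_monom)
  finally show ?thesis .
qed

lemma eval2_scale:
  assumes "comm_ring_hom h" "homogeneous2 n P"
  shows "eval2 h P (c * x, c * y) = c ^ n * eval2 h P (x, y)"
  unfolding eval2_homogeneous2[OF assms] sum_distrib_left
proof (intro sum.cong refl)
  fix j assume "j \<in> {..n}"
  then have "c ^ n = c ^ (n - j) * c ^ j" by (simp flip: power_add)
  then show "h (coeff (dehom P) j) * (c * x) ^ (n - j) * (c * y) ^ j =
      c ^ n * (h (coeff (dehom P) j) * x ^ (n - j) * y ^ j)"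
    by (simp add: power_mult_distrib algebra_simps)
qed

text \<open>The linear factor in \<open>zero_order\<close>, whose only projective zero is (a :
  b).\<close>

definition lin2 :: "complex \<Rightarrow> complex \<Rightarrow> form2" where
  "lin2 a b = const2 b * var_s - const2 a * var_t"

lemma lin2_altdef: "lin2 a b = [:[:0, b:], [:- a:]:]"
  by (simp add: lin2_def const2_def var_s_def var_t_def)

lemma homogeneous2_lin2: "homogeneous2 1 (lin2 a b)"
  by (auto simp: lin2_altdef homogeneous2_def coeff_pCons split: nat.splits)

lemma dehom_lin2: "dehom (lin2 a b) = [:b, - a:]"
  by (simp add: lin2_altdef dehom_def Polynomial.map_poly_pCons)

lemma eval2_lin2:
  assumes "comm_ring_hom h"
  shows "eval2 h (lin2 a b) (x, y) = h b * x - h a * y"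
proof -
  interpret h: comm_ring_hom h by fact
  show ?thesis by (simp add: eval2.simps lin2_altdef Polynomial.map_poly_pCons hom_distribs)
qed

lemma homogeneous2_zero_imp_factor:
  assumes P: "homogeneous2 n P" "P \<noteq> 0" and ab: "(a, b) \<noteq> (0, 0)" and z: "eval2 id P (a, b) = 0"
  obtains m Q where "n = Suc m" "homogeneous2 m Q" "P = lin2 a b * Q"
proof -
  let ?p = "dehom P"
  have p0: "?p \<noteq> 0" using homog_dehom[OF P(1)] P(2) by (auto simp: homog_def)
  have z: "(\<Sum>j\<le>n. coeff ?p j * a ^ (n - j) * b ^ j) = 0"
    using z by (simp add: eval2_homogeneous2[OF comm_ring_hom_id_complex P(1)])
  \<comment> \<open>For nonzero a this is division by the root b / a. For a = 0 the factor is the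
    constant b, and the content is the degree bound: a zero at (0 : 1) means that the coefficient of
    t^n vanishes.\<close>
  have "\<exists>q. n \<noteq> 0 \<and> degree q \<le> n - 1 \<and> [:b, - a:] * q = ?p"
  proof (cases "a = 0")
    case False
    have "a ^ n * poly ?p (b / a) = (\<Sum>j\<le>n. coeff ?p j * a ^ (n - j) * b ^ j)"
      unfolding poly_eq_sum_atMost[OF degree_dehom_le[OF P(1)]] sum_distrib_left
      by (intro sum.cong refl) (use False in \<open>simp add: power_diff field_simps\<close>)
    then have "poly ?p (b / a) = 0" using z False by simp
    then obtain q where q: "?p = [:- (b / a), 1:] * q" by (auto simp: poly_eq_0_iff_dvd)
    then have "q \<noteq> 0" using p0 by auto
    then have "degree ?p = Suc (degree q)" unfolding q by (subst degree_mult_eq) auto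
    then have "n \<noteq> 0" "degree q \<le> n - 1" using degree_dehom_le[OF P(1)] by auto
    moreover have "[:b, - a:] * Polynomial.smult (- 1 / a) q = Polynomial.smult (- 1 / a) [:b, - a:] * q"
      by (simp only: mult_smult_left mult_smult_right)
    moreover have "Polynomial.smult (- 1 / a) [:b, - a:] * q = ?p"
      unfolding q using False by (intro arg_cong[where f = "\<lambda>r. r * q"]) simp
    moreover have "degree (Polynomial.smult (- 1 / a) q) = degree q" using False by simp
    ultimately show ?thesis by metis
  next
    case True
    then have b: "b \<noteq> 0" using ab by auto
    have "(\<Sum>j\<le>n. coeff ?p j * a ^ (n - j) * b ^ j) = coeff ?p n * b ^ n"
      using True by (subst sum.remove[of _ n]) (auto intro!: sum.neutral simp: power_0_left)
    then have c: "coeff ?p n = 0" using z b by simp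
    have "n \<noteq> 0"
    proof
      assume "n = 0"
      then have "degree ?p = 0" using degree_dehom_le[OF P(1)] by simp
      then have "?p = [:coeff ?p n:]" using \<open>n = 0\<close> degree_0_id by metis
      then show False using c p0 by simp
    qed
    moreover have "degree ?p \<le> n - 1"
    proof (rule degree_le, intro allI impI)
      fix i assume "n - 1 < i"
      then have "i = n \<or> degree ?p < i" using degree_dehom_le[OF P(1)] by auto
      then show "coeff ?p i = 0" using c coeff_eq_0 by blast
    qed
    moreover have "[:b, - a:] * Polynomial.smult (1 / b) ?p = ?p" using True b by simp
    moreover have "degree (Polynomial.smult (1 / b) ?p) = degree ?p" using b by simp
    ultimately show ?thesis by metis
  qed
  then obtain q where q: "n \<noteq> 0" "degree q \<le> n - 1" "[:b, - a:] * q = ?p" by blast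
  have "P = lin2 a b * homog (n - 1) q"
  proof (rule homogeneous2_eqI[OF P(1)])
    show "homogeneous2 n (lin2 a b * homog (n - 1) q)"
      using homogeneous2_mult[OF homogeneous2_lin2 homogeneous2_homog, of "n - 1"] q(1) by simp
    show "dehom P = dehom (lin2 a b * homog (n - 1) q)"
      by (simp add: comm_ring_homD(4)[OF comm_ring_hom_dehom] dehom_lin2 dehom_homog[OF q(2)] q(3) del: mult_pCons_left One_nat_def)
  qed
  with q(1) homogeneous2_homog[of "n - 1" q] show ?thesis
    by (intro that[of "n - 1"]) auto
qed

text \<open>Either the dehomogenization has full degree and a complex root, or its top coefficient
  vanishes and (0 : 1) is a zero.\<close>

lemma homogeneous2_has_zero:
  assumes "homogeneous2 (Suc n) P"
  obtains a b where "(a, b) \<noteq> (0, 0)" "eval2 id P (a, b) = 0"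
proof (cases "degree (dehom P) = Suc n")
  case True
  then obtain r where "poly (dehom P) r = 0"
    using fundamental_theorem_of_algebra[of "dehom P"] by (auto simp: constant_degree)
  then have "eval2 id P (1, r) = 0"
    using poly_eq_sum_atMost[OF degree_dehom_le[OF assms], of r]
    by (simp add: eval2_homogeneous2[OF comm_ring_hom_id_complex assms])
  then show ?thesis by (intro that[of 1 r]) auto
next
  case False
  then have "coeff (dehom P) (Suc n) = 0"
    using degree_dehom_le[OF assms] by (intro coeff_eq_0) auto
  then have "eval2 id P (0, 1) = 0"
    by (simp add: eval2_homogeneous2[OF comm_ring_hom_id_complex assms] power_0_left)
  then show ?thesis by (intro that[of 0 1]) auto
qed

text \<open>Over the complex numbers a binary form splits into linear factors, and in a domain one
  of them must vanish at (x, y). The resulting relation is solved by dividing by whichever of a, b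
  is nonzero, which is a unit in any algebra over the complex numbers.\<close>

lemma homogeneous2_zero_in_domain:
  fixes h :: "complex \<Rightarrow> 'a::idom"
  assumes h: "comm_ring_hom h" and "homogeneous2 n P" "P \<noteq> 0" "eval2 h P (x, y) = 0"
  shows "\<exists>a b w. (a, b) \<noteq> (0, 0) \<and> x = h a * w \<and> y = h b * w"
proof -
  interpret h: comm_ring_hom h by fact
  have "\<exists>a b. (a, b) \<noteq> (0, 0) \<and> h b * x = h a * y"
    using assms(2-)
  proof (induction n arbitrary: P)
    case 0
    then have "coeff (dehom P) 0 \<noteq> 0"
      using homog_dehom[OF 0(1)] by (auto simp: homog_def)
    then show ?case using 0 comm_ring_hom_eq_0_iff[OF h]
      by (simp add: eval2_homogeneous2[OF h 0(1)])
  next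
    case (Suc n)
    obtain a b where ab: "(a, b) \<noteq> (0, 0)" "eval2 id P (a, b) = 0"
      using homogeneous2_has_zero[OF Suc.prems(1)] .
    obtain m Q where Q: "Suc n = Suc m" "homogeneous2 m Q" "P = lin2 a b * Q"
      using homogeneous2_zero_imp_factor[OF Suc.prems(1,2) ab] .
    have "eval2 h (lin2 a b) (x, y) = 0 \<or> eval2 h Q (x, y) = 0"
      using Suc.prems(3) unfolding Q(3) comm_ring_homD(4)[OF comm_ring_hom_eval2[OF h]] by simp
    then show ?case
    proof
      assume "eval2 h (lin2 a b) (x, y) = 0"
      then show ?thesis using ab(1) by (auto simp: eval2_lin2[OF h])
    next
      assume "eval2 h Q (x, y) = 0"
      moreover have "Q \<noteq> 0" using Q(3) Suc.prems(2) by auto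
      ultimately show ?thesis using Suc.IH[of Q] Q by auto
    qed
  qed
  then obtain a b where ab: "(a, b) \<noteq> (0, 0)" "h b * x = h a * y" by blast
  show ?thesis
  proof (cases "a = 0")
    case False
    then have u: "h a * h (1 / a) = 1" by (simp flip: h.hom_mult)
    have "h b * (h (1 / a) * x) = h (1 / a) * (h b * x)" by (simp add: mult.left_commute)
    also have "\<dots> = y" using u by (simp add: ab(2) mult.left_commute flip: mult.assoc)
    finally have "y = h b * (h (1 / a) * x)" ..
    moreover have "x = h a * (h (1 / a) * x)" using u by (simp flip: mult.assoc)
    ultimately show ?thesis using ab(1) by blast
  next
    case True
    then have "b \<noteq> 0" using ab by auto
    then have u: "h b * h (1 / b) = 1" by (simp flip: h.hom_mult)
    have "x = 0" using True ab comm_ring_hom_eq_0_iff[OF h] by auto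
    then have "x = h a * (h (1 / b) * y)" using True by simp
    moreover have "y = h b * (h (1 / b) * y)" using u by (simp flip: mult.assoc)
    ultimately show ?thesis using ab(1) by blast
  qed
qed

lemma lin2_neq_0: "(a, b) \<noteq> (0, 0) \<Longrightarrow> lin2 a b \<noteq> 0"
  by (auto simp: lin2_altdef)

text \<open>Linear factors are split off as long as (a, b) is a zero; this stops because the degree
  drops. A cofactor that does not vanish at (a, b) shows that the number of factors is the
  multiplicity.\<close>

lemma homogeneous2_order_factor:
  assumes "homogeneous2 n P" "P \<noteq> 0" "(a, b) \<noteq> (0, 0)"
  shows "\<exists>Q. P = lin2 a b ^ multiplicity (lin2 a b) P * Q \<and> eval2 id Q (a, b) \<noteq> 0"
proof -
  have "\<exists>m Q. P = lin2 a b ^ m * Q \<and> eval2 id Q (a, b) \<noteq> 0"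
    using assms(1,2)
  proof (induction n arbitrary: P)
    case (0 P)
    show ?case
    proof (cases "eval2 id P (a, b) = 0")
      case True
      obtain m Q where "0 = Suc m"
        using homogeneous2_zero_imp_factor[OF 0 assms(3) True] .
      then show ?thesis by simp
    next
      case False
      moreover have "P = lin2 a b ^ 0 * P" by simp
      ultimately show ?thesis by blast
    qed
  next
    case (Suc n P)
    show ?case
    proof (cases "eval2 id P (a, b) = 0")
      case True
      obtain m Q where "Suc n = Suc m" and Q: "homogeneous2 m Q" "P = lin2 a b * Q"
        using homogeneous2_zero_imp_factor[OF Suc.prems assms(3) True] .
      then have "homogeneous2 n Q" by simp
      have "Q \<noteq> 0" using Suc.prems Q(2) by auto
      from Suc.IH[OF \<open>homogeneous2 n Q\<close> \<open>Q \<noteq> 0\<close>] obtain m R where "Q = lin2 a b ^ m * R" "eval2 id R (a, b) \<noteq> 0" by blast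
      moreover from this have "P = lin2 a b ^ Suc m * R" using Q(2) by (simp add: mult.assoc)
      ultimately show ?thesis by blast
    next
      case False
      moreover have "P = lin2 a b ^ 0 * P" by simp
      ultimately show ?thesis by blast
    qed
  qed
  then obtain m Q where Q: "P = lin2 a b ^ m * Q" "eval2 id Q (a, b) \<noteq> 0" by blast
  have "\<not> lin2 a b ^ Suc m dvd P"
  proof
    assume "lin2 a b ^ Suc m dvd P"
    then have "lin2 a b dvd Q"
      unfolding Q(1) using lin2_neq_0[OF assms(3)] by (simp add: mult.commute[of "lin2 a b"])
    then have "eval2 id Q (a, b) = 0"
      using comm_ring_hom_id_complex
      by (auto simp: dvd_def comm_ring_homD(4)[OF comm_ring_hom_eval2] eval2_lin2)
    then show False using Q(2) by simp
  qed
  then have "multiplicity (lin2 a b) P = m"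
    by (intro multiplicity_eqI) (simp_all add: Q(1))
  then show ?thesis using Q by blast
qed

section \<open>Ternary forms\<close>

text \<open>Reduces ternary forms to binary ones, coefficient by coefficient in z. The case k > n
  stands apart because n - k would be truncated to 0.\<close>

lemma homogeneous3_iff:
  "homogeneous3 n P \<longleftrightarrow> (\<forall>k. if k \<le> n then homogeneous2 (n - k) (coeff P k) else coeff P k = 0)"
proof
  assume P: "homogeneous3 n P"
  show "\<forall>k. if k \<le> n then homogeneous2 (n - k) (coeff P k) else coeff P k = 0"
  proof
    fix k
    show "if k \<le> n then homogeneous2 (n - k) (coeff P k) else coeff P k = 0"
    proof (cases "k \<le> n")
      case True
      then show ?thesis using P by (fastforce simp: homogeneous3_def homogeneous2_def)
    next
      case False
      then have "coeff (coeff (coeff P k) j) i = 0" for i j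
        using P by (force simp: homogeneous3_def)
      then show ?thesis using False by (simp add: poly_eq_iff)
    qed
  qed
next
  assume *: "\<forall>k. if k \<le> n then homogeneous2 (n - k) (coeff P k) else coeff P k = 0"
  show "homogeneous3 n P"
    unfolding homogeneous3_def
  proof (intro allI impI)
    fix i j k
    assume c: "coeff (coeff (coeff P k) j) i \<noteq> 0"
    then have "k \<le> n" using * by (metis coeff_0)
    then have "homogeneous2 (n - k) (coeff P k)" using * by metis
    then have "i + j = n - k" using c by (auto simp: homogeneous2_def)
    then show "i + j + k = n" using \<open>k \<le> n\<close> by simp
  qed
qed

lemma homogeneous3_coeff:
  assumes "homogeneous3 n P"
  shows "k \<le> n \<Longrightarrow> homogeneous2 (n - k) (coeff P k)" "k > n \<Longrightarrow> coeff P k = 0"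
  using assms unfolding homogeneous3_iff by (metis, metis not_le)

lemma eval3_altdef: "eval3 h P (x, y, z) = poly (map_poly (\<lambda>q. eval2 h q (x, y)) P) z"
  by (simp add: eval3.simps eval2.simps)

lemma eval3_homogeneous3:
  assumes "comm_ring_hom h" "homogeneous3 n P"
  shows "eval3 h P (x, y, z) = (\<Sum>k\<le>n. eval2 h (coeff P k) (x, y) * z ^ k)"
proof -
  have 0: "eval2 h 0 (x, y) = 0" by (simp add: eval2.simps)
  have "degree (map_poly (\<lambda>q. eval2 h q (x, y)) P) \<le> n"
    by (intro degree_le) (simp add: coeff_map_poly 0 homogeneous3_coeff(2)[OF assms(2)])
  then show ?thesis
    unfolding eval3_altdef by (subst poly_eq_sum_atMost) (auto simp: coeff_map_poly 0)
qed

lemma eval3_scale: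
  assumes "comm_ring_hom h" "homogeneous3 n P"
  shows "eval3 h P (c * x, c * y, c * z) = c ^ n * eval3 h P (x, y, z)"
  unfolding eval3_homogeneous3[OF assms] sum_distrib_left
proof (intro sum.cong refl)
  fix k assume "k \<in> {..n}"
  then have k: "k \<le> n" and "c ^ n = c ^ (n - k) * c ^ k" by (auto simp flip: power_add)
  then show "eval2 h (coeff P k) (c * x, c * y) * (c * z) ^ k = c ^ n * (eval2 h (coeff P k) (x, y) * z ^ k)"
    by (simp add: eval2_scale[OF assms(1) homogeneous3_coeff(1)[OF assms(2) k]] power_mult_distrib algebra_simps)
qed

lemma homogeneous3_0 [simp]: "homogeneous3 n 0"
  by (simp add: homogeneous3_def)

lemma homogeneous3_add: "homogeneous3 n P \<Longrightarrow> homogeneous3 n Q \<Longrightarrow> homogeneous3 n (P + Q)"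
  unfolding homogeneous3_iff by (auto intro: homogeneous2_add)

lemma homogeneous3_uminus: "homogeneous3 n P \<Longrightarrow> homogeneous3 n (- P)"
  by (simp add: homogeneous3_def)

lemma homogeneous3_diff: "homogeneous3 n P \<Longrightarrow> homogeneous3 n Q \<Longrightarrow> homogeneous3 n (P - Q)"
  using homogeneous3_add[OF _ homogeneous3_uminus] by fastforce

lemma homogeneous3_sum: "(\<And>i. i \<in> I \<Longrightarrow> homogeneous3 n (P i)) \<Longrightarrow> homogeneous3 n (sum P I)"
  by (induction I rule: infinite_finite_induct) (auto intro: homogeneous3_add)

lemma homogeneous3_mult:
  assumes "homogeneous3 m P" "homogeneous3 n Q"
  shows "homogeneous3 (m + n) (P * Q)"
  unfolding homogeneous3_iff
proof
  fix k
  have zero: "coeff P i * coeff Q (k - i) = 0" if "\<not> (i \<le> m \<and> k - i \<le> n)" for i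
    using that assms homogeneous3_coeff(2) by (metis mult_zero_left mult_zero_right not_le)
  show "if k \<le> m + n then homogeneous2 (m + n - k) (coeff (P * Q) k) else coeff (P * Q) k = 0"
  proof (cases "k \<le> m + n")
    case True
    have "homogeneous2 (m + n - k) (coeff P i * coeff Q (k - i))" if "i \<le> k" for i
    proof (cases "i \<le> m \<and> k - i \<le> n")
      case True
      moreover have "(m - i) + (n - (k - i)) = m + n - k" using True that by arith
      ultimately show ?thesis
        using homogeneous2_mult[of "m - i" "coeff P i" "n - (k - i)"] homogeneous3_coeff(1) assms by metis
    next
      case False
      then have "coeff P i * coeff Q (k - i) = 0" by (rule zero)
      then show ?thesis by (simp only: homogeneous2_0)
    qed
    then show ?thesis using True by (auto simp: coeff_mult intro!: homogeneous2_sum)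
  next
    case False
    then have "coeff P i * coeff Q (k - i) = 0" if "i \<le> k" for i
      using that by (intro zero) auto
    then show ?thesis using False by (auto simp: coeff_mult intro!: sum.neutral)
  qed
qed

lemma homogeneous3_const3: "homogeneous3 0 (const3 c)"
  by (auto simp: homogeneous3_def const3_def coeff_pCons split: nat.splits)

lemma homogeneous3_cmult: "homogeneous3 n P \<Longrightarrow> homogeneous3 n (const3 c * P)"
  using homogeneous3_mult[OF homogeneous3_const3] by simp

lemma homogeneous3_power: "homogeneous3 n P \<Longrightarrow> homogeneous3 (k * n) (P ^ k)"
  using homogeneous3_const3[of 1] by (induction k) (auto simp: const3_def pCons_one intro: homogeneous3_mult)

definition var_x :: form3 where "var_x = [:[:[:0, 1:]:]:]"
definition var_y :: form3 where "var_y = [:[:0, 1:]:]"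
definition var_z :: form3 where "var_z = [:0, 1:]"

lemma homogeneous3_var: "homogeneous3 1 var_x" "homogeneous3 1 var_y" "homogeneous3 1 var_z"
  by (auto simp: homogeneous3_def var_x_def var_y_def var_z_def coeff_pCons split: nat.splits)

lemma eval3_var:
  assumes "comm_ring_hom h"
  shows "eval3 h var_x (x, y, z) = x" "eval3 h var_y (x, y, z) = y" "eval3 h var_z (x, y, z) = z"
  using comm_ring_homD(1,2)[OF assms]
  by (simp_all add: var_x_def var_y_def var_z_def eval3.simps Polynomial.map_poly_pCons)

lemma eval3_const3:
  assumes "comm_ring_hom h"
  shows "eval3 h (const3 c) (x, y, z) = h c"
  using comm_ring_homD(1,2)[OF assms]
  by (simp add: const3_def eval3.simps Polynomial.map_poly_pCons)

lemma eval2_const2: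
  assumes "comm_ring_hom h"
  shows "eval2 h (const2 c) (x, y) = h c"
  using comm_ring_homD(1,2)[OF assms]
  by (simp add: const2_def eval2.simps Polynomial.map_poly_pCons)

lemma eval2_var:
  assumes "comm_ring_hom h"
  shows "eval2 h var_s (x, y) = x" "eval2 h var_t (x, y) = y"
  using comm_ring_homD(1,2)[OF assms]
  by (simp_all add: var_s_def var_t_def eval2.simps Polynomial.map_poly_pCons)

lemma eval2_const2_var: 
  assumes "homogeneous2 n P"
  shows "eval2 const2 P (var_s, var_t) = P"
proof -
  have "const2 c * var_s ^ i * var_t ^ j = monom (monom c i) j" for c i j
  proof -
    have "var_s ^ i = monom (monom 1 i) 0" by (simp add: var_s_def monom_altdef poly_const_pow[symmetric] monom_0)
    moreover have "var_t ^ j = monom 1 j" by (simp add: var_t_def monom_altdef)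
    moreover have "const2 c = monom (monom c 0) 0" by (simp add: const2_def monom_0)
    ultimately show ?thesis by (simp add: mult_monom)
  qed
  then have "eval2 const2 P (var_s, var_t) = homog n (dehom P)"
    by (simp add: eval2_homogeneous2[OF comm_ring_hom_const2 assms] homog_def)
  then show ?thesis using homog_dehom[OF assms] by simp
qed

lemma homogeneous2_eval2:
  assumes "homogeneous2 n P" "homogeneous2 d f0" "homogeneous2 d f1"
  shows "homogeneous2 (n * d) (eval2 const2 P (f0, f1))"
  unfolding eval2_homogeneous2[OF comm_ring_hom_const2 assms(1)]
proof (rule homogeneous2_sum)
  fix j assume "j \<in> {..n}"
  then have "(n - j) * d + j * d = n * d" by (simp flip: add_mult_distrib)
  moreover have "homogeneous2 ((n - j) * d + j * d) ((const2 (coeff (dehom P) j) * f0 ^ (n - j)) * f1 ^ j)"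
    by (intro homogeneous2_mult homogeneous2_cmult homogeneous2_power assms)
  ultimately show "homogeneous2 (n * d) (const2 (coeff (dehom P) j) * f0 ^ (n - j) * f1 ^ j)" by simp
qed

lemma homogeneous2_eval3:
  assumes "homogeneous3 n P" "homogeneous2 d f0" "homogeneous2 d f1" "homogeneous2 d f2"
  shows "homogeneous2 (n * d) (eval3 const2 P (f0, f1, f2))"
  unfolding eval3_homogeneous3[OF comm_ring_hom_const2 assms(1)]
proof (rule homogeneous2_sum)
  fix k assume "k \<in> {..n}"
  then have k: "k \<le> n" by simp
  then have "(n - k) * d + k * d = n * d" by (simp flip: add_mult_distrib)
  moreover have "homogeneous2 ((n - k) * d + k * d) (eval2 const2 (coeff P k) (f0, f1) * f2 ^ k)"
    by (intro homogeneous2_mult homogeneous2_eval2 homogeneous2_power homogeneous3_coeff(1)[OF assms(1) k] assms)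
  ultimately show "homogeneous2 (n * d) (eval2 const2 (coeff P k) (f0, f1) * f2 ^ k)" by simp
qed

lemma homogeneous3_eval2:
  assumes "homogeneous2 n P" "homogeneous3 d A" "homogeneous3 d B"
  shows "homogeneous3 (n * d) (eval2 const3 P (A, B))"
  unfolding eval2_homogeneous2[OF comm_ring_hom_const3 assms(1)]
proof (rule homogeneous3_sum)
  fix j assume "j \<in> {..n}"
  then have "(n - j) * d + j * d = n * d" by (simp flip: add_mult_distrib)
  moreover have "homogeneous3 ((n - j) * d + j * d) ((const3 (coeff (dehom P) j) * A ^ (n - j)) * B ^ j)"
    by (intro homogeneous3_mult homogeneous3_cmult homogeneous3_power assms)
  ultimately show "homogeneous3 (n * d) (const3 (coeff (dehom P) j) * A ^ (n - j) * B ^ j)" by simp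
qed

section \<open>Elimination\<close>

text \<open>A nonzero element of least degree in the ideal generated by F and G divides constant
  multiples of both F and G by pseudo-division, so it is itself constant.\<close>

lemma prime_elem_elimination:
  fixes F G :: "'a::idom poly"
  assumes F: "prime_elem F" and G: "\<not> F dvd G"
  shows "\<exists>p q r. r \<noteq> 0 \<and> p * F + q * G = [:r:]"
proof -
  define I where "I = {p * F + q * G | p q. True}"
  have F0: "F \<noteq> 0" using F by (rule prime_elem_not_zeroI)
  have "F \<in> I" unfolding I_def by (rule CollectI, rule exI[of _ 1], rule exI[of _ 0]) simp
  have "G \<in> I" unfolding I_def by (rule CollectI, rule exI[of _ 0], rule exI[of _ 1]) simp
  have I_comb: "a * u - b * v \<in> I" if "u \<in> I" "v \<in> I" for a b u v
  proof -
    from that obtain p q p' q' where "u = p * F + q * G" "v = p' * F + q' * G" unfolding I_def by blast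
    then have "a * u - b * v = (a * p - b * p') * F + (a * q - b * q') * G" by (simp add: algebra_simps)
    then show ?thesis unfolding I_def by blast
  qed
  obtain g where g: "g \<in> I" "g \<noteq> 0" and least: "\<And>a. a \<in> I \<Longrightarrow> a \<noteq> 0 \<Longrightarrow> degree g \<le> degree a"
    using ex_has_least_nat[of "\<lambda>a. a \<in> I \<and> a \<noteq> 0" F degree] \<open>F \<in> I\<close> F0 by blast
  have dvd: "\<exists>c. c \<noteq> 0 \<and> g dvd [:c:] * a" if a: "a \<in> I" for a
  proof -
    obtain q r where qr: "pseudo_divmod a g = (q, r)" by fastforce
    let ?c = "coeff g (degree g) ^ (Suc (degree a) - degree g)"
    have *: "Polynomial.smult ?c a = g * q + r" "r = 0 \<or> degree r < degree g"
      using pseudo_divmod[OF g(2) qr] by auto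
    then have "r = [:?c:] * a - q * g" by (simp add: algebra_simps)
    then have "r \<in> I" using I_comb[OF a g(1)] by metis
    then have "r = 0" using *(2) least not_le by blast
    then have "[:?c:] * a = g * q" using *(1) by simp
    moreover have "?c \<noteq> 0" using g(2) by simp
    ultimately show ?thesis by (metis dvd_triv_left)
  qed
  have "degree g = 0"
  proof (rule ccontr)
    assume deg: "degree g \<noteq> 0"
    obtain c where c: "c \<noteq> 0" "g dvd [:c:] * F" using dvd[OF \<open>F \<in> I\<close>] by blast
    obtain c' where c': "c' \<noteq> 0" "g dvd [:c':] * G" using dvd[OF \<open>G \<in> I\<close>] by blast
    obtain k where k: "[:c:] * F = g * k" using c(2) by blast
    have "F dvd g * k" by (metis k dvd_triv_right)
    \<comment> \<open>If \<open>F\<close> divides \<open>g\<close>, it divides the constant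
      \<open>c'\<close>, so its degree is 0, and by minimality so is that of \<open>g\<close>. If
      \<open>F\<close> divides \<open>k\<close>, cancelling \<open>F\<close> makes \<open>g\<close>
      a divisor of the constant \<open>c\<close>.\<close>
    then consider "F dvd g" | "F dvd k" using prime_elem_dvd_multD[OF F] by blast
    then show False
    proof cases
      case 1
      then have "F dvd [:c':] * G" using c'(2) by (rule dvd_trans)
      then have "F dvd [:c':]" using prime_elem_dvd_multD[OF F] G by blast
      then have "degree F \<le> degree [:c':]" using c'(1) by (intro dvd_imp_degree_le) auto
      then show False using least[OF \<open>F \<in> I\<close> F0] deg by simp
    next
      case 2
      then obtain k' where "k = F * k'" by blast
      then have "F * [:c:] = F * (g * k')" using k by (simp only: mult_ac)
      then have "[:c:] = g * k'" using F0 mult_left_cancel by blast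
      then have "degree g \<le> degree [:c:]" using c(1) by (intro dvd_imp_degree_le) auto
      then show False using deg by simp
    qed
  qed
  then obtain r where "g = [:r:]" using degree_eq_zeroE by blast
  moreover obtain p q where "g = p * F + q * G" using g(1) unfolding I_def by blast
  ultimately show ?thesis using g(2) by (metis pCons_0_0)
qed

text \<open>The polynomial produced by \<open>prime_elem_elimination\<close> is not known to be
  homogeneous, even for homogeneous \<open>F\<close> and \<open>G\<close>, so it is split by total
  degree.\<close>

definition homogeneous_part :: "nat \<Rightarrow> form2 \<Rightarrow> form2" where
  "homogeneous_part n r = (\<Sum>j\<le>n. monom (monom (coeff (coeff r j) (n - j)) (n - j)) j)"

lemma coeff_homogeneous_part:
  "coeff (coeff (homogeneous_part n r) j) i = (if i + j = n then coeff (coeff r j) i else 0)"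
proof -
  have "coeff (homogeneous_part n r) j = (if j \<le> n then monom (coeff (coeff r j) (n - j)) (n - j) else 0)"
    unfolding homogeneous_part_def coeff_sum by (simp add: coeff_monom if_distrib sum.delta cong: if_cong)
  then show ?thesis by (auto simp: coeff_monom)
qed

lemma homogeneous2_homogeneous_part: "homogeneous2 n (homogeneous_part n r)"
  by (simp add: homogeneous2_def coeff_homogeneous_part)

lemma sum_homogeneous_parts:
  obtains N where "r = (\<Sum>n\<le>N. homogeneous_part n r)"
proof -
  define N where "N = degree r + (\<Sum>j\<le>degree r. degree (coeff r j))"
  have N: "i + j \<le> N" if "coeff (coeff r j) i \<noteq> 0" for i j
  proof -
    have "j \<le> degree r" using that le_degree by (metis coeff_0)
    moreover have "i \<le> degree (coeff r j)" using that le_degree by blast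
    moreover have "degree (coeff r j) \<le> (\<Sum>j\<le>degree r. degree (coeff r j))"
      using \<open>j \<le> degree r\<close> by (intro member_le_sum) auto
    ultimately show ?thesis by (simp add: N_def)
  qed
  have "coeff (coeff r j) i = coeff (coeff (\<Sum>n\<le>N. homogeneous_part n r) j) i" for i j
    using N[of j i] by (auto simp: coeff_sum coeff_homogeneous_part)
  then have "r = (\<Sum>n\<le>N. homogeneous_part n r)" by (simp add: poly_eq_iff)
  then show ?thesis by (rule that)
qed

text \<open>The argument of \<open>eval2\<close> in the hypothesis is the generic multiple of \<open>(x, y)\<close>.\<close>

lemma eval2_homogeneous_part_eq_0:
  assumes h: "comm_ring_hom h" and z: "eval2 (\<lambda>c. [:h c:]) r ([:0, x:], [:0, y:]) = 0"
  shows "eval2 h (homogeneous_part n r) (x, y) = 0"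
proof -
  have h': "comm_ring_hom (\<lambda>c. [:h c:])" using comm_ring_hom_pCons[OF h] .
  have C: "comm_ring_hom (\<lambda>c. [:c:])" by unfold_locales (auto simp: pCons_one)
  \<comment> \<open>By homogeneity the part of degree k contributes its value at (x, y) to the
    coefficient of degree k only, so the values of different parts cannot cancel.\<close>
  have part: "eval2 (\<lambda>c. [:h c:]) (homogeneous_part k r) ([:0, x:], [:0, y:]) =
      monom (eval2 h (homogeneous_part k r) (x, y)) k" for k
  proof -
    have "eval2 (\<lambda>c. [:h c:]) (homogeneous_part k r) ([:0, 1:] * [:x:], [:0, 1:] * [:y:]) =
        [:0, 1:] ^ k * [:eval2 h (homogeneous_part k r) (x, y):]"
      unfolding eval2_scale[OF h' homogeneous2_homogeneous_part] hom_eval2[OF C h] ..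
    then show ?thesis by (simp add: monom_altdef)
  qed
  obtain N where N: "r = (\<Sum>n\<le>N. homogeneous_part n r)" by (rule sum_homogeneous_parts)
  have "0 = (\<Sum>k\<le>N. monom (eval2 h (homogeneous_part k r) (x, y)) k)"
    using z by (subst (asm) N) (simp add: comm_ring_homD(8)[OF comm_ring_hom_eval2[OF h']] part)
  then have "coeff 0 n = coeff (\<Sum>k\<le>N. monom (eval2 h (homogeneous_part k r) (x, y)) k) n" by simp
  then have "0 = (if n \<le> N then eval2 h (homogeneous_part n r) (x, y) else 0)"
    by (simp add: coeff_sum coeff_monom)
  moreover have "homogeneous_part n r = 0" if "n > N"
  proof -
    have "coeff (coeff r j) i = 0" if "i + j = n" for i j
      using \<open>n > N\<close> that by (subst N) (simp add: coeff_sum coeff_homogeneous_part)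
    then have "coeff (coeff (homogeneous_part n r) j) i = 0" for i j
      by (simp add: coeff_homogeneous_part)
    then show ?thesis by (simp add: poly_eq_iff)
  qed
  ultimately show ?thesis using comm_ring_homD(1)[OF comm_ring_hom_eval2[OF h]] by (cases "n \<le> N") auto
qed

text \<open>The restriction of P to the line through (a : b : 0) and (0 : 0 : 1), as a binary form
  in w and z, where the points of the line are (a w : b w : z).\<close>

definition restrict_line :: "nat \<Rightarrow> complex \<times> complex \<Rightarrow> form3 \<Rightarrow> form2" where
  "restrict_line n v P = homog n (map_poly (\<lambda>q. eval2 id q v) P)"

lemma coeff_restrict_line_aux: "coeff (map_poly (\<lambda>q. eval2 id q v) P) j = eval2 id (coeff P j) v"
  by (rule coeff_map_poly) (rule comm_ring_homD(1)[OF comm_ring_hom_eval2[OF comm_ring_hom_id_complex]])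

lemma restrict_line_poly:
  assumes "homogeneous3 n P"
  shows "dehom (restrict_line n v P) = map_poly (\<lambda>q. eval2 id q v) P"
  unfolding restrict_line_def
  by (intro dehom_homog degree_le)
    (simp add: coeff_restrict_line_aux homogeneous3_coeff(2)[OF assms]
      comm_ring_homD(1)[OF comm_ring_hom_eval2[OF comm_ring_hom_id_complex]])

lemma eval2_restrict_line:
  assumes h: "comm_ring_hom h" and P: "homogeneous3 n P"
  shows "eval2 h (restrict_line n (a, b) P) (w, z) = eval3 h P (h a * w, h b * w, z)"
proof -
  have "eval2 h (restrict_line n (a, b) P) (w, z) = (\<Sum>k\<le>n. h (eval2 id (coeff P k) (a, b)) * w ^ (n - k) * z ^ k)"
    by (subst eval2_homogeneous2[OF h, of n])
      (simp_all add: restrict_line_poly[OF P] coeff_restrict_line_aux,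
       simp add: restrict_line_def homogeneous2_homog)
  also have "\<dots> = eval3 h P (h a * w, h b * w, z)"
    unfolding eval3_homogeneous3[OF h P]
  proof (intro sum.cong refl)
    fix k assume "k \<in> {..n}"
    then have "eval2 h (coeff P k) (h a * w, h b * w) = w ^ (n - k) * eval2 h (coeff P k) (h a, h b)"
      using eval2_scale[OF h homogeneous3_coeff(1)[OF P], of k w "h a" "h b"] by (simp add: mult.commute)
    moreover have "h (eval2 id (coeff P k) (a, b)) = eval2 h (coeff P k) (h a, h b)"
      by (subst hom_eval2[OF h comm_ring_hom_id_complex]) simp
    ultimately show "h (eval2 id (coeff P k) (a, b)) * w ^ (n - k) * z ^ k =
        eval2 h (coeff P k) (h a * w, h b * w) * z ^ k" by simp
  qed
  finally show ?thesis .
qed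

text \<open>If P vanishes on the line, then every coefficient of P with respect to z vanishes at (a,
  b) and contains the equation of the line as a factor.\<close>

lemma restrict_line_eq_0_imp_dvd:
  assumes P: "homogeneous3 n P" and ab: "(a, b) \<noteq> (0, 0)" and z: "restrict_line n (a, b) P = 0"
  shows "[:lin2 a b:] dvd P"
proof -
  have "lin2 a b dvd coeff P k" for k
  proof (cases "coeff P k = 0")
    case False
    then have k: "k \<le> n" using homogeneous3_coeff(2)[OF P] not_le by blast
    have "map_poly (\<lambda>q. eval2 id q (a, b)) P = 0"
      using restrict_line_poly[OF P, of "(a, b)"] z comm_ring_homD(1)[OF comm_ring_hom_dehom] by simp
    then have "eval2 id (coeff P k) (a, b) = 0"
      using coeff_restrict_line_aux[of "(a, b)" P k] by (metis coeff_0)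
    then show ?thesis
      using homogeneous2_zero_imp_factor[OF homogeneous3_coeff(1)[OF P k] False ab] by (metis dvd_triv_left)
  qed simp
  then show ?thesis by (simp add: const_poly_dvd_iff)
qed

text \<open>Eliminating \<open>z\<close> and passing to a homogeneous part gives a nonzero binary form vanishing at
  \<open>(x, y)\<close>, which is therefore a multiple of a constant vector \<open>(a, b)\<close>. At most one of F and G
  vanishes on the line through \<open>(a : b : 0)\<close> and \<open>(0 : 0 : 1)\<close>; the other one constrains \<open>z\<close>.\<close>

lemma common_zero_constant:
  fixes h :: "complex \<Rightarrow> 'a::idom"
  assumes h: "comm_ring_hom h" and F: "irreducible F" and hF: "homogeneous3 m F"
    and hG: "homogeneous3 n G" and FG: "\<not> F dvd G"
    and zF: "eval3 h F (x, y, z) = 0" and zG: "eval3 h G (x, y, z) = 0"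
  shows "\<exists>a b c w. x = h a * w \<and> y = h b * w \<and> z = h c * w"
proof -
  let ?h = "\<lambda>c. [:h c:]"
  let ?X = "([:0, x:], [:0, y:], [:0, z:])"
  have h': "comm_ring_hom ?h" using comm_ring_hom_pCons[OF h] .
  have C: "comm_ring_hom (\<lambda>c :: 'a. [:c:])" by unfold_locales (auto simp: pCons_one)
  \<comment> \<open>A homogeneous equation satisfied by (x, y, z) is satisfied by its generic
    multiple. The combination of \<open>F\<close> and \<open>G\<close> that equals \<open>r\<close>
    therefore vanishes there, which yields the vanishing of each homogeneous part of
    \<open>r\<close>.\<close>
  have lift: "eval3 ?h P ?X = 0" if "homogeneous3 k P" "eval3 h P (x, y, z) = 0" for k P
  proof -
    have "eval3 ?h P ([:0, 1:] * [:x:], [:0, 1:] * [:y:], [:0, 1:] * [:z:]) = [:0, 1:] ^ k * [:eval3 h P (x, y, z):]"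
      unfolding eval3_scale[OF h' that(1)] hom_eval3[OF C h] ..
    then show ?thesis using that(2) by simp
  qed
  have "prime_elem F" using F by (rule irreducible_imp_prime_elem)
  then obtain p q r where r: "r \<noteq> 0" "p * F + q * G = [:r:]"
    using prime_elem_elimination FG by blast
  have E: "comm_ring_hom (\<lambda>P. eval3 ?h P ?X)" using comm_ring_hom_eval3[OF h'] .
  have "eval3 ?h [:r:] ?X = 0"
    unfolding r(2)[symmetric] comm_ring_homD(3,4)[OF E] using lift hF hG zF zG by simp
  then have r0: "eval2 ?h r ([:0, x:], [:0, y:]) = 0"
    by (simp add: eval3_altdef Polynomial.map_poly_pCons comm_ring_homD(1)[OF comm_ring_hom_eval2[OF h']])
  obtain i j where ij: "coeff (coeff r j) i \<noteq> 0" using r(1) by (metis leading_coeff_0_iff)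
  then have "homogeneous_part (i + j) r \<noteq> 0"
    using coeff_homogeneous_part[of "i + j" r j i] by (metis coeff_0)
  with homogeneous2_zero_in_domain[OF h homogeneous2_homogeneous_part _ eval2_homogeneous_part_eq_0[OF h r0]]
  obtain a b w where ab: "(a, b) \<noteq> (0, 0)" and xy: "x = h a * w" "y = h b * w" by blast
  have "\<exists>c e w'. (c, e) \<noteq> (0, 0) \<and> w = h c * w' \<and> z = h e * w'"
  proof (cases "restrict_line m (a, b) F = 0 \<and> restrict_line n (a, b) G = 0")
    case True
    then have d: "[:lin2 a b:] dvd F" "[:lin2 a b:] dvd G"
      using restrict_line_eq_0_imp_dvd hF hG ab by blast+
    have "\<not> is_unit [:lin2 a b:]"
    proof
      assume "is_unit [:lin2 a b:]"
      then have "is_unit (lin2 a b)" by (simp add: const_poly_dvd_1)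
      then have "\<exists>c. is_unit c \<and> lin2 a b = [:c:]" by (metis is_unit_polyE is_unit_const_poly_iff)
      then obtain c where c: "is_unit c" "lin2 a b = [:c:]" by blast
      then have "a = 0" by (simp add: lin2_altdef)
      then have "is_unit [:0, b:]" using c by (simp add: lin2_altdef)
      then show False by (auto simp: is_unit_poly_iff)
    qed
    \<comment> \<open>The irreducible \<open>F\<close> would be the equation of the line up to a
      unit and would divide \<open>G\<close>.\<close>
    obtain u where u: "F = [:lin2 a b:] * u" using d(1) by blast
    then have "is_unit u" using F \<open>\<not> is_unit [:lin2 a b:]\<close> irreducibleD by blast
    then obtain v where "1 = u * v" by blast
    then have "[:lin2 a b:] = F * v" unfolding u by (metis mult.assoc mult.right_neutral)
    then have "F dvd [:lin2 a b:]" by (rule dvdI)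
    then show ?thesis using d(2) FG dvd_trans by blast
  next
    case False
    have "eval2 h (restrict_line m (a, b) F) (w, z) = 0" "eval2 h (restrict_line n (a, b) G) (w, z) = 0"
      using zF zG unfolding xy by (simp_all add: eval2_restrict_line[OF h hF] eval2_restrict_line[OF h hG])
    then show ?thesis
      using False homogeneous2_zero_in_domain[OF h] homogeneous2_homog unfolding restrict_line_def by metis
  qed
  then obtain c e w' where w: "w = h c * w'" "z = h e * w'" by blast
  have "x = h (a * c) * w'" "y = h (b * c) * w'"
    using xy w by (simp_all add: comm_ring_homD(4)[OF h])
  then show ?thesis using w(2) by blast
qed

section \<open>Projective points\<close>

definition line_points :: "(complex \<times> complex) set set" where
  "line_points = {point1 v | v. v \<noteq> (0, 0)}"

lemma point1_eq_iff:
  assumes "(s, t) \<noteq> (0, 0)" "(s', t') \<noteq> (0, 0)"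
  shows "point1 (s, t) = point1 (s', t') \<longleftrightarrow> s * t' = s' * t"
proof
  assume eq: "point1 (s, t) = point1 (s', t')"
  have "(s, t) \<in> point1 (s, t)" by (auto intro: exI[of _ 1])
  then obtain c where "s = c * s'" "t = c * t'" unfolding eq by auto
  then show "s * t' = s' * t" by simp
next
  assume eq: "s * t' = s' * t"
  have sub: "point1 (s, t) \<subseteq> point1 (s', t')"
    if eq: "s * t' = s' * t" and nz: "(s, t) \<noteq> (0, 0)" "(s', t') \<noteq> (0, 0)" for s t s' t' :: complex
  proof
    fix x assume "x \<in> point1 (s, t)"
    then obtain c where c: "x = (c * s, c * t)" "c \<noteq> 0" by auto
    show "x \<in> point1 (s', t')"
    proof (cases "s' = 0")
      case True
      then have "t' \<noteq> 0" "s = 0" "t \<noteq> 0" using nz eq by auto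
      then have "x = (c * t / t' * s', c * t / t' * t')" "c * t / t' \<noteq> 0" using c True by auto
      then show ?thesis unfolding point1.simps by blast
    next
      case False
      then have t: "t = s / s' * t'" using eq by (simp add: field_simps)
      then have "s \<noteq> 0" using nz by auto
      then have "x = (c * s / s' * s', c * s / s' * t')" "c * s / s' \<noteq> 0" using c False t by auto
      then show ?thesis unfolding point1.simps by blast
    qed
  qed
  show "point1 (s, t) = point1 (s', t')"
  proof (rule antisym)
    show "point1 (s, t) \<subseteq> point1 (s', t')" by (rule sub[OF eq assms])
    show "point1 (s', t') \<subseteq> point1 (s, t)" by (rule sub[OF eq[symmetric] assms(2,1)])
  qed
qed

lemma line_points_coords:
  assumes "L \<in> line_points"
  shows "coords L \<noteq> (0, 0)" "point1 (coords L) = L"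
proof -
  obtain s t where st: "(s, t) \<noteq> (0, 0)" "L = point1 (s, t)" using assms by (auto simp: line_points_def)
  then have "(s, t) \<in> L" by (auto intro: exI[of _ 1])
  then have "coords L \<in> L" unfolding coords_def by (rule someI)
  then obtain c where c: "coords L = (c * s, c * t)" "c \<noteq> 0" using st by auto
  then show nz: "coords L \<noteq> (0, 0)" using st by auto
  show "point1 (coords L) = L"
    using c st nz point1_eq_iff[of "c * s" "c * t" s t] by simp
qed

lemma point1_in_line_points: "v \<noteq> (0, 0) \<Longrightarrow> point1 v \<in> line_points"
  unfolding line_points_def by blast

lemma coords_point2:
  obtains c where "c \<noteq> 0" "coords (point2 (x, y, z)) = (c * x, c * y, c * z)"
proof -
  have "(x, y, z) \<in> point2 (x, y, z)" by (auto intro: exI[of _ 1])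
  then have "coords (point2 (x, y, z)) \<in> point2 (x, y, z)" unfolding coords_def by (rule someI)
  then show ?thesis using that by auto
qed

lemma point2_scale:
  assumes "c \<noteq> 0"
  shows "point2 (c * x, c * y, c * z) = point2 (x, y, z)"
proof (intro equalityI subsetI)
  fix p assume "p \<in> point2 (c * x, c * y, c * z)"
  then obtain e where "e \<noteq> 0" "p = (e * (c * x), e * (c * y), e * (c * z))" by auto
  then have "e * c \<noteq> 0" "p = (e * c * x, e * c * y, e * c * z)" using assms by (auto simp: mult.assoc)
  then show "p \<in> point2 (x, y, z)" by auto
next
  fix p assume "p \<in> point2 (x, y, z)"
  then obtain e where "e \<noteq> 0" "p = (e * x, e * y, e * z)" by auto
  then have "e / c \<noteq> 0" "p = (e / c * (c * x), e / c * (c * y), e / c * (c * z))" using assms by auto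
  then show "p \<in> point2 (c * x, c * y, c * z)" unfolding point2.simps by blast
qed

section \<open>Power series\<close>

lemma comm_ring_hom_fps_nth_0: "comm_ring_hom (\<lambda>a :: complex fps. fps_nth a 0)"
  by unfold_locales auto

lemma comm_ring_hom_fps_compose:
  assumes "fps_nth \<sigma> 0 = 0"
  shows "comm_ring_hom (\<lambda>a :: complex fps. fps_compose a \<sigma>)"
  by unfold_locales (use assms in \<open>auto simp: fps_compose_add_distrib fps_compose_mult_distrib\<close>)

lemma fps_nth_0_eval2: "fps_nth (eval2 fps_const P (x, y)) 0 = eval2 id P (fps_nth x 0, fps_nth y 0)"
  unfolding hom_eval2[OF comm_ring_hom_fps_nth_0 comm_ring_hom_fps_const] by (simp add: id_def)

lemma fps_compose_eval2:
  assumes "fps_nth \<sigma> 0 = 0"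
  shows "fps_compose (eval2 fps_const P (x, y)) \<sigma> = eval2 fps_const P (fps_compose x \<sigma>, fps_compose y \<sigma>)"
  unfolding hom_eval2[OF comm_ring_hom_fps_compose[OF assms] comm_ring_hom_fps_const] by simp

lemma fps_compose_eval3:
  assumes "fps_nth \<sigma> 0 = 0"
  shows "fps_compose (eval3 fps_const P (x, y, z)) \<sigma> =
    eval3 fps_const P (fps_compose x \<sigma>, fps_compose y \<sigma>, fps_compose z \<sigma>)"
  unfolding hom_eval3[OF comm_ring_hom_fps_compose[OF assms] comm_ring_hom_fps_const] by simp

lemma eval3_reparametrize:
  assumes "homogeneous3 n P" "fps_nth \<sigma> 0 = 0"
  shows "eval3 fps_const P (reparametrize u \<sigma> \<gamma>) = u ^ n * fps_compose (eval3 fps_const P \<gamma>) \<sigma>"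
  by (cases \<gamma>) (simp add: eval3_scale[OF comm_ring_hom_fps_const assms(1)] fps_compose_eval3[OF assms(2)])

lemma fps_compose_nth_1:
  fixes a \<sigma> :: "complex fps"
  shows "fps_nth (fps_compose a \<sigma>) (Suc 0) = fps_nth a 1 * fps_nth \<sigma> 1"
  by (simp add: fps_compose_nth)

text \<open>Dividing by the lower of the two orders turns (a : b) into a pair that has a value on
  the projective line at 0.\<close>

lemma fps_pair_factor:
  fixes a b :: "complex fps"
  assumes "a \<noteq> 0 \<or> b \<noteq> 0"
  obtains k a' b' where "a = fps_X ^ k * a'" "b = fps_X ^ k * b'" "fps_nth a' 0 \<noteq> 0 \<or> fps_nth b' 0 \<noteq> 0"
proof -
  have *: "\<exists>k a' b'. a = fps_X ^ k * a' \<and> b = fps_X ^ k * b' \<and> fps_nth a' 0 \<noteq> 0"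
    if "a \<noteq> 0" "b \<noteq> 0 \<longrightarrow> subdegree a \<le> subdegree b" for a b :: "complex fps"
  proof (intro exI conjI)
    show "a = fps_X ^ subdegree a * fps_shift (subdegree a) a"
      by (subst mult.commute) (rule subdegree_decompose)
    show "b = fps_X ^ subdegree a * fps_shift (subdegree a) b"
    proof (cases "b = 0")
      case False
      then show ?thesis using that(2) by (subst mult.commute) (intro subdegree_decompose', simp)
    qed simp
    show "fps_nth (fps_shift (subdegree a) a) 0 \<noteq> 0" using that(1) by simp
  qed
  show ?thesis
  proof (cases "a \<noteq> 0 \<and> (b \<noteq> 0 \<longrightarrow> subdegree a \<le> subdegree b)")
    case True
    then show ?thesis using *[of a b] that by metis
  next
    case False
    then have "b \<noteq> 0" "a \<noteq> 0 \<longrightarrow> subdegree b \<le> subdegree a" using assms by auto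
    then show ?thesis using *[of b a] that by metis
  qed
qed

section \<open>Reparametrization\<close>

lemma reparametrize_reparametrize:
  assumes "fps_nth \<sigma> 0 = 0" "fps_nth \<tau> 0 = 0"
  shows "reparametrize w \<tau> (reparametrize u \<sigma> \<gamma>) = reparametrize (w * fps_compose u \<tau>) (fps_compose \<sigma> \<tau>) \<gamma>"
  by (cases \<gamma>) (simp add: assms fps_compose_mult_distrib fps_compose_assoc mult.assoc)

lemma reparametrize_1_X [simp]: "reparametrize 1 fps_X \<gamma> = \<gamma>"
  by (cases \<gamma>) simp

lemma in_branch_of_self: "\<gamma> \<in> branch_of \<gamma>"
  unfolding branch_of_def by (rule CollectI, rule exI[of _ 1], rule exI[of _ fps_X]) simp

text \<open>Reparametrizations can be undone: with the compositional inverse \<tau> of \<sigma>, the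
  inverse has the unit factor 1 / (u o \<tau>).\<close>

lemma branch_of_reparametrize:
  assumes u: "fps_nth u 0 \<noteq> 0" and \<sigma>: "fps_nth \<sigma> 0 = 0" "fps_nth \<sigma> 1 \<noteq> 0"
  shows "branch_of (reparametrize u \<sigma> \<gamma>) = branch_of \<gamma>"
proof -
  have sub: "branch_of (reparametrize u \<sigma> \<gamma>) \<subseteq> branch_of \<gamma>"
    if u: "fps_nth u 0 \<noteq> 0" and \<sigma>: "fps_nth \<sigma> 0 = 0" "fps_nth \<sigma> 1 \<noteq> 0" for u \<sigma> \<gamma>
  proof
    fix \<delta> assume "\<delta> \<in> branch_of (reparametrize u \<sigma> \<gamma>)"
    then obtain w \<tau> where w: "fps_nth w 0 \<noteq> 0" "fps_nth \<tau> 0 = 0" "fps_nth \<tau> 1 \<noteq> 0"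
      and \<delta>: "\<delta> = reparametrize w \<tau> (reparametrize u \<sigma> \<gamma>)" by (auto simp: branch_of_def)
    have "\<delta> = reparametrize (w * fps_compose u \<tau>) (fps_compose \<sigma> \<tau>) \<gamma>"
      unfolding \<delta> by (rule reparametrize_reparametrize) fact+
    moreover have "fps_nth (w * fps_compose u \<tau>) 0 \<noteq> 0" "fps_nth (fps_compose \<sigma> \<tau>) 0 = 0"
      "fps_nth (fps_compose \<sigma> \<tau>) 1 \<noteq> 0"
      using w u \<sigma> by (simp_all add: fps_compose_nth_1)
    ultimately show "\<delta> \<in> branch_of \<gamma>" unfolding branch_of_def by blast
  qed
  define \<tau> where "\<tau> = fps_inv \<sigma>"
  have \<tau>: "fps_nth \<tau> 0 = 0" "fps_nth \<tau> 1 \<noteq> 0" using \<sigma> by (simp_all add: \<tau>_def fps_inv_def)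
  have inv: "fps_compose \<sigma> \<tau> = fps_X" using \<sigma> unfolding \<tau>_def by (intro fps_inv_right) auto
  let ?w = "inverse (fps_compose u \<tau>)"
  have w: "fps_nth (fps_compose u \<tau>) 0 \<noteq> 0" using u by simp
  then have "?w * fps_compose u \<tau> = 1" by (rule inverse_mult_eq_1)
  then have "reparametrize ?w \<tau> (reparametrize u \<sigma> \<gamma>) = \<gamma>"
    using reparametrize_reparametrize[OF \<sigma>(1) \<tau>(1), of ?w u \<gamma>] inv by simp
  moreover have "fps_nth ?w 0 \<noteq> 0" using w by simp
  ultimately have "branch_of \<gamma> \<subseteq> branch_of (reparametrize u \<sigma> \<gamma>)"
    using sub[of ?w \<tau> "reparametrize u \<sigma> \<gamma>"] \<tau> by simp
  then show ?thesis using sub[OF assms] by blast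
qed

section \<open>Local parameters\<close>

definition local_param :: "complex \<times> complex \<Rightarrow> complex fps \<times> complex fps" where
  "local_param = (\<lambda>(s, t). if s = 0 then (fps_X, fps_const t) else (fps_const s, fps_const t + fps_X))"

lemma fps_nth_0_eval2_local_param: "fps_nth (eval2 fps_const P (local_param v)) 0 = eval2 id P v"
  by (cases v) (simp add: local_param_def fps_nth_0_eval2)

text \<open>A form can only vanish at multiples of constant vectors, whereas the coefficients of z^0
  and z^1 in the local parameter are linearly independent vectors.\<close>

lemma eval2_local_param_neq_0:
  assumes "homogeneous2 n P" "P \<noteq> 0" "v \<noteq> (0, 0)"
  shows "eval2 fps_const P (local_param v) \<noteq> 0"
proof
  assume z: "eval2 fps_const P (local_param v) = 0"
  obtain s t where v: "v = (s, t)" by (cases v)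
  obtain S T where ST: "local_param v = (S, T)" by (cases "local_param v")
  obtain a b w where ab: "(a, b) \<noteq> (0, 0)" and "S = fps_const a * w" "T = fps_const b * w"
    using homogeneous2_zero_in_domain[OF comm_ring_hom_fps_const assms(1,2) z[unfolded ST]] by blast
  then have eq: "fps_const b * S = fps_const a * T" by (simp add: mult_ac)
  have "fps_nth (fps_const b * S) k = fps_nth (fps_const a * T) k" for k by (simp add: eq)
  from this[of 0] this[of 1] show False
    using ab assms(3) ST by (auto simp: local_param_def v split: if_splits)
qed

lemma not_is_unit_lin2: "\<not> is_unit (lin2 a b)"
proof
  assume "is_unit (lin2 a b)"
  then obtain c where c: "is_unit c" "lin2 a b = [:c:]" by (auto simp: is_unit_poly_iff)
  then have "is_unit [:0, b:]" by (simp add: lin2_altdef)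
  then show False by (auto simp: is_unit_poly_iff)
qed

section \<open>Degrees of divisors of ternary forms\<close>

lemma eval3_const3_var:
  assumes "homogeneous3 n P"
  shows "eval3 const3 P (var_x, var_y, var_z) = P"
proof -
  have C: "comm_ring_hom (\<lambda>q :: form2. [:q:])" by unfold_locales (auto simp: pCons_one)
  have *: "eval2 const3 q (var_x, var_y) = [:q:]" if "homogeneous2 m q" for m q
    using hom_eval2[OF C comm_ring_hom_const2, of q var_s var_t] eval2_const2_var[OF that]
    by (simp add: const3_def[abs_def] const2_def var_x_def var_y_def var_s_def var_t_def)
  have "eval3 const3 P (var_x, var_y, var_z) = (\<Sum>k\<le>n. monom (coeff P k) k)"
    unfolding eval3_homogeneous3[OF comm_ring_hom_const3 assms]
    by (intro sum.cong refl)
      (simp add: *[OF homogeneous3_coeff(1)[OF assms]] var_z_def monom_altdef)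
  also have "\<dots> = P"
    by (rule poly_eqI) (auto simp: coeff_sum coeff_monom homogeneous3_coeff(2)[OF assms])
  finally show ?thesis .
qed

text \<open>Substituting (T x, T y, T z) turns a form P of degree m into P T^m. Hence every multiple
  of \<open>F\<close> acquires the factor T^d, with no homogeneity of the cofactor required.\<close>

lemma homogeneous3_dvd_degree:
  assumes F: "homogeneous3 d F" and G: "homogeneous3 k G" and "F dvd G" "G \<noteq> 0"
  shows "d \<le> k"
proof (rule ccontr)
  assume "\<not> d \<le> k"
  let ?h = "\<lambda>c. [:const3 c:]"
  let ?X = "([:0, 1:] * [:var_x:], [:0, 1:] * [:var_y:], [:0, 1:] * [:var_z:])"
  have h: "comm_ring_hom ?h" using comm_ring_hom_pCons[OF comm_ring_hom_const3] .
  have C: "comm_ring_hom (\<lambda>q :: form3. [:q:])" by unfold_locales (auto simp: pCons_one)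
  have *: "eval3 ?h P ?X = monom P m" if "homogeneous3 m P" for m P
  proof -
    have "eval3 ?h P ?X = [:0, 1:] ^ m * [:P:]"
      unfolding eval3_scale[OF h that] hom_eval3[OF C comm_ring_hom_const3, symmetric] eval3_const3_var[OF that] ..
    then show ?thesis by (simp add: monom_altdef)
  qed
  obtain H where "G = F * H" using assms(3) by blast
  then have "monom G k = monom F d * eval3 ?h H ?X"
    using *[OF F] *[OF G] comm_ring_homD(4)[OF comm_ring_hom_eval3[OF h]] by metis
  also have "\<dots> = monom 1 d * ([:F:] * eval3 ?h H ?X)"
    by (simp add: monom_altdef)
  finally have "coeff (monom G k) k = 0"
    using \<open>\<not> d \<le> k\<close> by (simp add: coeff_monom_mult)
  then show False using assms(4) by simp
qed

section \<open>The branches of a rational curve\<close>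

locale rational_curve =
  fixes d :: nat and F :: form3 and f0 f1 f2 :: form2 and n :: nat and A B :: form3
  assumes d: "d \<ge> 3" and irred: "Factorial_Ring.irreducible F" and hF: "homogeneous3 d F"
    and hf: "homogeneous2 d f0" "homogeneous2 d f1" "homogeneous2 d f2"
    and coprime_f: "\<And>g. g dvd f0 \<Longrightarrow> g dvd f1 \<Longrightarrow> g dvd f2 \<Longrightarrow> is_unit g"
    and F_f: "eval3 const2 F (f0, f1, f2) = 0"
    and hA: "homogeneous3 n A" and hB: "homogeneous3 n B"
    and AB_f: "eval3 const2 A (f0, f1, f2) \<noteq> 0 \<or> eval3 const2 B (f0, f1, f2) \<noteq> 0"
    and inverse_f: "var_t * eval3 const2 A (f0, f1, f2) = var_s * eval3 const2 B (f0, f1, f2)"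
begin

abbreviation "f \<equiv> (f0, f1, f2)"

lemma eval3_f:
  assumes "comm_ring_hom h"
  shows "eval3 h Q (eval_triple h f v) = eval2 h (eval3 const2 Q f) v"
  by (cases v) (simp add: hom_eval3[OF comm_ring_hom_eval2[OF assms] comm_ring_hom_const2] eval2_const2[OF assms])

text \<open>The common factor w would be a unit, hence a complex constant. Constant forms of
  positive degree are zero, and then 0 would be a common divisor of the components.\<close>

lemma f_not_constant: "\<not> (\<exists>a b c w. f0 = const2 a * w \<and> f1 = const2 b * w \<and> f2 = const2 c * w)"
proof (intro notI, elim exE conjE)
  fix a b c w
  assume w: "f0 = const2 a * w" "f1 = const2 b * w" "f2 = const2 c * w"
  then have "is_unit w" by (intro coprime_f) auto
  then obtain c where c: "w = [:c:]" "is_unit c" unfolding is_unit_poly_iff by blast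
  from c(2) obtain e' where "c = [:e':]" unfolding is_unit_poly_iff by blast
  with c(1) obtain e where e: "w = const2 e" unfolding const2_def by blast
  have zero: "const2 a * w = 0" if "homogeneous2 d (const2 a * w)" for a
  proof -
    have "const2 a * w = const2 (a * e)" by (simp add: const2_def e)
    moreover have "a * e = 0"
    proof (rule ccontr)
      assume "a * e \<noteq> 0"
      then have "coeff (coeff (const2 a * w) 0) 0 \<noteq> 0" by (simp add: const2_def e)
      then have "0 + 0 = d" using that unfolding homogeneous2_def by blast
      then show False using d by simp
    qed
    ultimately show ?thesis by (simp add: const2_def)
  qed
  then have "f0 = 0" "f1 = 0" "f2 = 0" using hf w by auto
  then have "is_unit (0 :: form2)" by (intro coprime_f) auto
  then show False by simp
qed

lemma vanishing_imp_dvd: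
  assumes "homogeneous3 k G" "eval3 const2 G f = 0"
  shows "F dvd G"
  using common_zero_constant[OF comm_ring_hom_const2 irred hF assms(1) _ F_f assms(2)] f_not_constant by blast

lemma vanishing_low_degree:
  assumes "homogeneous3 k G" "eval3 const2 G f = 0" "k < d"
  shows "G = 0"
  using homogeneous3_dvd_degree[OF hF assms(1) vanishing_imp_dvd[OF assms(1,2)]] assms(3) by force

lemma f_no_common_zero:
  assumes "v \<noteq> (0, 0)"
  shows "eval_triple id f v \<noteq> (0, 0, 0)"
proof
  obtain a b where v: "v = (a, b)" by (cases v)
  assume "eval_triple id f v = (0, 0, 0)"
  then have z: "eval2 id f0 (a, b) = 0" "eval2 id f1 (a, b) = 0" "eval2 id f2 (a, b) = 0"
    by (simp_all add: v)
  have "lin2 a b dvd P" if "homogeneous2 d P" "eval2 id P (a, b) = 0" for P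
  proof (cases "P = 0")
    case False
    then show ?thesis using homogeneous2_zero_imp_factor[OF that(1) False assms[unfolded v] that(2)]
      by (metis dvd_triv_left)
  qed simp
  then have "is_unit (lin2 a b)" using z hf by (intro coprime_f) auto
  then show False by (simp add: not_is_unit_lin2)
qed

definition local_branch :: "complex \<times> complex \<Rightarrow> complex fps triple" where
  "local_branch v = eval_triple fps_const f (local_param v)"

lemma branch_at_altdef: "branch_at f L = branch_of (local_branch (coords L))"
  by (simp add: branch_at_def local_branch_def local_param_def case_prod_unfold)

lemma initial_vector_local_branch: "initial_vector (local_branch v) = eval_triple id f v"
  by (cases v) (simp add: local_branch_def fps_nth_0_eval2_local_param)

lemma eval3_local_branch: "eval3 fps_const Q (local_branch v) = eval2 fps_const (eval3 const2 Q f) (local_param v)"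
  unfolding local_branch_def by (rule eval3_f[OF comm_ring_hom_fps_const])

lemma F_local_branch: "eval3 fps_const F (local_branch v) = 0"
  by (simp add: eval3_local_branch F_f comm_ring_homD(1)[OF comm_ring_hom_eval2[OF comm_ring_hom_fps_const]])

lemma inverse_local_branch:
  "snd (local_param v) * eval3 fps_const A (local_branch v) = fst (local_param v) * eval3 fps_const B (local_branch v)"
proof -
  obtain S T where ST: "local_param v = (S, T)" by (cases "local_param v")
  have "eval2 fps_const (var_t * eval3 const2 A f) (S, T) = eval2 fps_const (var_s * eval3 const2 B f) (S, T)"
    by (simp add: inverse_f)
  then show ?thesis
    unfolding comm_ring_homD(4)[OF comm_ring_hom_eval2[OF comm_ring_hom_fps_const]]
    by (simp add: eval3_local_branch ST eval2_var[OF comm_ring_hom_fps_const])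
qed

lemma AB_local_branch:
  assumes "v \<noteq> (0, 0)"
  shows "eval3 fps_const A (local_branch v) \<noteq> 0 \<or> eval3 fps_const B (local_branch v) \<noteq> 0"
  unfolding eval3_local_branch
  using AB_f eval2_local_param_neq_0[OF homogeneous2_eval3[OF hA hf] _ assms]
    eval2_local_param_neq_0[OF homogeneous2_eval3[OF hB hf] _ assms] by blast

text \<open>The inverse (A : B) recovers the parameter (S : T) from the branch. If the branch
  factored through a \<sigma> without linear term, so would (S : T) up to a common factor, but its
  first-order term is independent of its value at 0.\<close>

lemma irreducible_local_branch:
  assumes v: "v \<noteq> (0, 0)"
  shows "irreducible_parametrization (local_branch v)"
  unfolding irreducible_parametrization_def
proof (intro allI impI notI, elim conjE)
  fix u \<sigma> \<delta>
  assume \<sigma>: "fps_nth \<sigma> 0 = 0" "fps_nth \<sigma> 1 = 0" and \<gamma>: "local_branch v = reparametrize u \<sigma> \<delta>"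
  let ?a = "eval3 fps_const A \<delta>" and ?b = "eval3 fps_const B \<delta>"
  obtain S T where ST: "local_param v = (S, T)" by (cases "local_param v")
  have A: "eval3 fps_const A (local_branch v) = u ^ n * fps_compose ?a \<sigma>"
    and B: "eval3 fps_const B (local_branch v) = u ^ n * fps_compose ?b \<sigma>"
    unfolding \<gamma> using \<sigma>(1) hA hB by (simp_all add: eval3_reparametrize)
  have nz: "u ^ n \<noteq> 0" "fps_compose ?a \<sigma> \<noteq> 0 \<or> fps_compose ?b \<sigma> \<noteq> 0"
    using AB_local_branch[OF v] unfolding A B by auto
  then have "?a \<noteq> 0 \<or> ?b \<noteq> 0" by auto
  then obtain k a b where ab: "?a = fps_X ^ k * a" "?b = fps_X ^ k * b" "fps_nth a 0 \<noteq> 0 \<or> fps_nth b 0 \<noteq> 0"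
    by (rule fps_pair_factor)
  have comp: "fps_compose (fps_X ^ k * c) \<sigma> = \<sigma> ^ k * fps_compose c \<sigma>" for c
    using \<sigma>(1) by (simp add: fps_compose_mult_distrib fps_compose_power[symmetric])
  \<comment> \<open>This covers \<sigma> = 0 as well, where it means k = 0.\<close>
  have "\<sigma> ^ k \<noteq> 0" using nz(2) unfolding ab comp by auto
  have "u ^ n * \<sigma> ^ k * (T * fps_compose a \<sigma>) = u ^ n * \<sigma> ^ k * (S * fps_compose b \<sigma>)"
    using inverse_local_branch[of v] unfolding A B ab comp by (simp add: ST mult_ac)
  then have eq: "T * fps_compose a \<sigma> = S * fps_compose b \<sigma>"
    using nz(1) \<open>\<sigma> ^ k \<noteq> 0\<close> by (metis mult_left_cancel no_zero_divisors)
  have "fps_nth (T * fps_compose a \<sigma>) j = fps_nth (S * fps_compose b \<sigma>) j" for j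
    by (simp add: eq)
  \<comment> \<open>Since \<sigma> has no linear term, neither have the composed series. So the
    nonzero pair of constant terms of \<open>a\<close> and \<open>b\<close> satisfies two linear
    equations whose coefficients are the independent orders 0 and 1 of (S, T).\<close>
  from this[of 0] this[of 1] have "fps_nth T 0 * fps_nth a 0 = fps_nth S 0 * fps_nth b 0"
    "fps_nth T 1 * fps_nth a 0 = fps_nth S 1 * fps_nth b 0"
    using \<sigma> by (simp_all add: fps_mult_nth fps_compose_nth_1)
  then show False
    using ab(3) v ST by (cases v) (auto simp: local_param_def split: if_splits)
qed

text \<open>The rational inverse of the parametrization recovers the parameter from the branch.\<close>

lemma branch_of_local_branch_inj:
  assumes v: "v \<noteq> (0, 0)" and v': "v' \<noteq> (0, 0)"
    and eq: "branch_of (local_branch v) = branch_of (local_branch v')"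
  shows "point1 v = point1 v'"
proof -
  have "local_branch v \<in> branch_of (local_branch v')" using in_branch_of_self eq by blast
  then obtain u \<sigma> where u: "fps_nth u 0 \<noteq> 0" and \<sigma>: "fps_nth \<sigma> 0 = 0"
    and \<gamma>: "local_branch v = reparametrize u \<sigma> (local_branch v')"
    unfolding branch_of_def by blast
  let ?a = "fps_compose (eval3 fps_const A (local_branch v')) \<sigma>"
  let ?b = "fps_compose (eval3 fps_const B (local_branch v')) \<sigma>"
  obtain S T where ST: "local_param v = (S, T)" by (cases "local_param v")
  obtain S' T' where ST': "local_param v' = (S', T')" by (cases "local_param v'")
  have A: "eval3 fps_const A (local_branch v) = u ^ n * ?a"
    and B: "eval3 fps_const B (local_branch v) = u ^ n * ?b"
    unfolding \<gamma> using \<sigma> hA hB by (simp_all add: eval3_reparametrize)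
  have nz: "u ^ n \<noteq> 0" "?a \<noteq> 0 \<or> ?b \<noteq> 0"
    using AB_local_branch[OF v] unfolding A B by auto
  have "u ^ n * (T * ?a) = u ^ n * (S * ?b)"
    using inverse_local_branch[of v] unfolding A B by (simp add: ST mult_ac)
  then have 1: "T * ?a = S * ?b" using nz(1) by (metis mult_left_cancel)
  have "fps_compose (T' * eval3 fps_const A (local_branch v')) \<sigma> = fps_compose (S' * eval3 fps_const B (local_branch v')) \<sigma>"
    using inverse_local_branch[of v'] by (simp add: ST')
  then have 2: "fps_compose T' \<sigma> * ?a = fps_compose S' \<sigma> * ?b"
    using \<sigma> by (simp add: fps_compose_mult_distrib)
  \<comment> \<open>(S, T) and the composition of (S', T') with \<sigma> are both proportional to
    (\<open>?a\<close>, \<open>?b\<close>), so their determinant annihilates it and vanishes. Its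
    constant term compares the two points.\<close>
  let ?P = "fps_compose T' \<sigma>" and ?Q = "fps_compose S' \<sigma>"
  have "(S * ?P - ?Q * T) * ?a = S * (?P * ?a) - ?Q * (T * ?a)" by (simp add: algebra_simps)
  then have "(S * ?P - ?Q * T) * ?a = 0" unfolding 1 2 by (simp add: mult.left_commute)
  moreover have "(S * ?P - ?Q * T) * ?b = ?P * (S * ?b) - T * (?Q * ?b)" by (simp add: algebra_simps)
  then have "(S * ?P - ?Q * T) * ?b = 0" unfolding 1[symmetric] 2[symmetric] by (simp add: mult.left_commute)
  ultimately have "(S * ?P - ?Q * T) * ?a = 0" "(S * ?P - ?Q * T) * ?b = 0" .
  then have "S * fps_compose T' \<sigma> - fps_compose S' \<sigma> * T = 0" using nz(2) by auto
  then have "fps_nth (S * fps_compose T' \<sigma> - fps_compose S' \<sigma> * T) 0 = 0" by simp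
  then have "fps_nth S 0 * fps_nth T' 0 = fps_nth S' 0 * fps_nth T 0"
    by simp
  moreover have "(fps_nth S 0, fps_nth T 0) = v" "(fps_nth S' 0, fps_nth T' 0) = v'"
    using ST ST' by (auto simp: local_param_def split: if_splits prod.splits)
  ultimately show ?thesis using v v' point1_eq_iff by metis
qed

text \<open>The forms \<open>f\<^sub>i(A, B) x\<^sub>j - f\<^sub>j(A, B) x\<^sub>i\<close> vanish on the curve,
  hence on every formal parametrization of it.\<close>

lemma parametrization_factors:
  assumes F: "eval3 fps_const F \<gamma> = 0" and nz: "initial_vector \<gamma> \<noteq> (0, 0, 0)"
    and irr: "irreducible_parametrization \<gamma>"
  obtains a b c where "fps_nth a 0 \<noteq> 0 \<or> fps_nth b 0 \<noteq> 0" "fps_nth c 0 \<noteq> 0"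
    "\<gamma> = (c * eval2 fps_const f0 (a, b), c * eval2 fps_const f1 (a, b), c * eval2 fps_const f2 (a, b))"
proof -
  obtain x y z where \<gamma>: "\<gamma> = (x, y, z)" by (cases \<gamma>)
  note K = comm_ring_hom_fps_const
  let ?a = "eval3 fps_const A \<gamma>" and ?b = "eval3 fps_const B \<gamma>"
  \<comment> \<open>P and Q will be two components of \<open>f\<close>, and X and Y the
    corresponding coordinates of the plane.\<close>
  have vanish: "(eval2 fps_const P (?a, ?b)) * eval3 fps_const Y \<gamma> = eval2 fps_const Q (?a, ?b) * eval3 fps_const X \<gamma>"
    if P: "homogeneous2 d P" and Q: "homogeneous2 d Q" and X: "homogeneous3 1 X" "eval3 const2 X f = P"
      and Y: "homogeneous3 1 Y" "eval3 const2 Y f = Q" for P Q X Y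
  proof -
    let ?G = "eval2 const3 P (A, B) * Y - eval2 const3 Q (A, B) * X"
    have E: "comm_ring_hom (\<lambda>R. eval3 h R w)" if "comm_ring_hom h" for h :: "complex \<Rightarrow> 'b::comm_ring_1" and w
      using that by (rule comm_ring_hom_eval3)
    have comp: "eval3 h (eval2 const3 R (A, B)) w = eval2 h R (eval3 h A w, eval3 h B w)"
      if "comm_ring_hom h" for h :: "complex \<Rightarrow> 'b::comm_ring_1" and R w
      by (cases w) (simp add: hom_eval2[OF E[OF that] comm_ring_hom_const3] eval3_const3[OF that])
    have hG: "homogeneous3 (d * n + 1) ?G"
      by (intro homogeneous3_diff homogeneous3_mult homogeneous3_eval2 hA hB P Q X Y)
    let ?A = "eval3 const2 A f" and ?B = "eval3 const2 B f"
    \<comment> \<open>By \<open>inverse_f\<close> the pair s (A, B) equals A (s, t) along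
      \<open>f\<close>. Homogeneity turns this into a statement on R, at the price of a factor s^d
      that is cancelled at the end.\<close>
    have R: "var_s ^ d * eval2 const2 R (?A, ?B) = ?A ^ d * R" if "homogeneous2 d R" for R
    proof -
      have "var_s ^ d * eval2 const2 R (?A, ?B) = eval2 const2 R (var_s * ?A, var_s * ?B)"
        using eval2_scale[OF comm_ring_hom_const2 that] by simp
      also have "\<dots> = eval2 const2 R (?A * var_s, ?A * var_t)"
        using inverse_f by (simp add: mult.commute)
      also have "\<dots> = ?A ^ d * R"
        using eval2_scale[OF comm_ring_hom_const2 that] eval2_const2_var[OF that] by simp
      finally show ?thesis .
    qed
    have "eval3 const2 ?G f = eval2 const2 P (?A, ?B) * Q - eval2 const2 Q (?A, ?B) * P"
      unfolding comm_ring_homD(4,6)[OF E[OF comm_ring_hom_const2]] comp[OF comm_ring_hom_const2] X Y ..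
    then have "var_s ^ d * eval3 const2 ?G f = (var_s ^ d * eval2 const2 P (?A, ?B)) * Q - (var_s ^ d * eval2 const2 Q (?A, ?B)) * P"
      by (simp only: right_diff_distrib mult.assoc)
    also have "\<dots> = 0" unfolding R[OF P] R[OF Q] by (simp add: mult_ac)
    finally have "eval3 const2 ?G f = 0" by (simp add: var_s_def)
    then obtain H where H: "?G = F * H" using vanishing_imp_dvd[OF hG] by blast
    have "eval3 fps_const ?G \<gamma> = 0"
      unfolding H comm_ring_homD(4)[OF E[OF K]] F by simp
    then show ?thesis
      unfolding comm_ring_homD(4,6)[OF E[OF K]] comp[OF K] by simp
  qed
  \<comment> \<open>\<open>A\<close> and \<open>B\<close> do not both vanish along \<open>f\<close>,
    so \<open>F\<close> fails to divide one of them. If that one vanished on \<gamma>, elimination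
    over C[[z]] would make \<gamma> a multiple of a constant vector, that is, a reparametrization
    with \<sigma> = 0.\<close>
  have ab: "?a \<noteq> 0 \<or> ?b \<noteq> 0"
  proof (rule ccontr)
    assume "\<not> (?a \<noteq> 0 \<or> ?b \<noteq> 0)"
    moreover have "\<not> F dvd A \<or> \<not> F dvd B"
    proof (rule ccontr)
      assume "\<not> ?thesis"
      then obtain A' B' where "A = F * A'" "B = F * B'" by blast
      then have "eval3 const2 A f = 0" "eval3 const2 B f = 0"
        by (simp_all add: comm_ring_homD(4)[OF comm_ring_hom_eval3[OF comm_ring_hom_const2]] F_f)
      then show False using AB_f by simp
    qed
    ultimately obtain C where C: "homogeneous3 n C" "\<not> F dvd C" "eval3 fps_const C \<gamma> = 0"
      using hA hB by auto
    obtain p q r w where "x = fps_const p * w" "y = fps_const q * w" "z = fps_const r * w"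
      using common_zero_constant[OF K irred hF C(1,2) F[unfolded \<gamma>] C(3)[unfolded \<gamma>]] by blast
    then have "\<gamma> = reparametrize w 0 (fps_const p, fps_const q, fps_const r)"
      by (simp add: \<gamma> mult.commute)
    then have "fps_nth (0 :: complex fps) 1 \<noteq> 0"
      using irr unfolding irreducible_parametrization_def by (metis fps_zero_nth)
    then show False by simp
  qed
  obtain k a b where k: "?a = fps_X ^ k * a" "?b = fps_X ^ k * b" and ab0: "fps_nth a 0 \<noteq> 0 \<or> fps_nth b 0 \<noteq> 0"
    using fps_pair_factor[OF ab] .
  have cross: "eval2 fps_const P (a, b) * eval3 fps_const Y \<gamma> = eval2 fps_const Q (a, b) * eval3 fps_const X \<gamma>"
    if "homogeneous2 d P" "homogeneous2 d Q" "homogeneous3 1 X" "eval3 const2 X f = P"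
      "homogeneous3 1 Y" "eval3 const2 Y f = Q" for P Q X Y
  proof -
    have "eval2 fps_const R (?a, ?b) = (fps_X ^ k) ^ d * eval2 fps_const R (a, b)" if "homogeneous2 d R" for R
      unfolding k eval2_scale[OF K that] ..
    note scale = this[OF that(1)] this[OF that(2)]
    have "(fps_X ^ k) ^ d * (eval2 fps_const P (a, b) * eval3 fps_const Y \<gamma>) =
        (fps_X ^ k) ^ d * (eval2 fps_const Q (a, b) * eval3 fps_const X \<gamma>)"
      using vanish[OF that] unfolding scale by (simp only: mult.assoc)
    then show ?thesis by simp
  qed
  let ?p = "eval2 fps_const f0 (a, b)" and ?q = "eval2 fps_const f1 (a, b)" and ?r = "eval2 fps_const f2 (a, b)"
  have vars: "eval3 const2 var_x f = f0" "eval3 const2 var_y f = f1" "eval3 const2 var_z f = f2"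
    "eval3 fps_const var_x \<gamma> = x" "eval3 fps_const var_y \<gamma> = y" "eval3 fps_const var_z \<gamma> = z"
    by (simp_all add: \<gamma> eval3_var[OF comm_ring_hom_const2] eval3_var[OF K])
  have c: "?p * y = ?q * x" "?p * z = ?r * x" "?q * z = ?r * y"
    using cross[OF hf(1,2) homogeneous3_var(1) vars(1) homogeneous3_var(2) vars(2)]
      cross[OF hf(1,3) homogeneous3_var(1) vars(1) homogeneous3_var(3) vars(3)]
      cross[OF hf(2,3) homogeneous3_var(2) vars(2) homogeneous3_var(3) vars(3)]
    by (simp_all add: vars)
  have "(fps_nth a 0, fps_nth b 0) \<noteq> (0, 0)" using ab0 by auto
  from f_no_common_zero[OF this] have i: "fps_nth ?p 0 \<noteq> 0 \<or> fps_nth ?q 0 \<noteq> 0 \<or> fps_nth ?r 0 \<noteq> 0"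
    by (auto simp: fps_nth_0_eval2)
  have j: "fps_nth x 0 \<noteq> 0 \<or> fps_nth y 0 \<noteq> 0 \<or> fps_nth z 0 \<noteq> 0"
    using nz by (simp add: \<gamma>)
  \<comment> \<open>The vectors (\<open>x\<close>, \<open>y\<close>, \<open>z\<close>) and
    (\<open>?p\<close>, \<open>?q\<close>, \<open>?r\<close>) have vanishing cross product. Dividing
    by a component that is a unit gives the factor between them, which is a unit because \<gamma>
    does not vanish at 0.\<close>
  have quot: "y' = (x' * inverse p') * q'" if "fps_nth p' 0 \<noteq> 0" "p' * y' = q' * x'" for p' q' x' y' :: "complex fps"
  proof -
    have "(x' * inverse p') * q' = inverse p' * (q' * x')" by (simp only: mult_ac)
    also have "\<dots> = (p' * inverse p') * y'" unfolding that(2)[symmetric] by (simp only: mult_ac)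
    finally show ?thesis using inverse_mult_eq_1'[OF that(1)] by simp
  qed
  have "\<exists>e. fps_nth e 0 \<noteq> 0 \<and> x = e * ?p \<and> y = e * ?q \<and> z = e * ?r"
  proof -
    consider "fps_nth ?p 0 \<noteq> 0" | "fps_nth ?q 0 \<noteq> 0" | "fps_nth ?r 0 \<noteq> 0" using i by blast
    then obtain e where e: "x = e * ?p" "y = e * ?q" "z = e * ?r"
    proof cases
      case 1
      have "x = (x * inverse ?p) * ?p" "y = (x * inverse ?p) * ?q" "z = (x * inverse ?p) * ?r"
        by (rule quot[OF 1 refl], rule quot[OF 1 c(1)], rule quot[OF 1 c(2)])
      then show ?thesis using that by blast
    next
      case 2
      have "x = (y * inverse ?q) * ?p" "y = (y * inverse ?q) * ?q" "z = (y * inverse ?q) * ?r"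
        by (rule quot[OF 2 c(1)[symmetric]], rule quot[OF 2 refl], rule quot[OF 2 c(3)])
      then show ?thesis using that by blast
    next
      case 3
      have "x = (z * inverse ?r) * ?p" "y = (z * inverse ?r) * ?q" "z = (z * inverse ?r) * ?r"
        by (rule quot[OF 3 c(2)[symmetric]], rule quot[OF 3 c(3)[symmetric]], rule quot[OF 3 refl])
      then show ?thesis using that by blast
    qed
    moreover have "fps_nth e 0 \<noteq> 0" using j e by auto
    ultimately show ?thesis by blast
  qed
  then show ?thesis using that ab0 \<gamma> by blast
qed

text \<open>The pair (a, b) is a moving point of the projective line whose value at 0 is the
  parameter L. Normalizing it to the chart at L reads off \<sigma>, and irreducibility of \<gamma>
  forces a nonzero linear term of \<sigma>.\<close>

lemma branch_eq_branch_at: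
  assumes F: "eval3 fps_const F \<gamma> = 0" and nz: "initial_vector \<gamma> \<noteq> (0, 0, 0)"
    and irr: "irreducible_parametrization \<gamma>"
  shows "\<exists>L \<in> line_points. image_point f L = point2 (initial_vector \<gamma>) \<and> branch_of \<gamma> = branch_at f L"
proof -
  obtain a b c where ab: "fps_nth a 0 \<noteq> 0 \<or> fps_nth b 0 \<noteq> 0" and c: "fps_nth c 0 \<noteq> 0"
    and \<gamma>: "\<gamma> = (c * eval2 fps_const f0 (a, b), c * eval2 fps_const f1 (a, b), c * eval2 fps_const f2 (a, b))"
    using parametrization_factors[OF assms] .
  define L where "L = point1 (fps_nth a 0, fps_nth b 0)"
  have L: "L \<in> line_points" unfolding L_def using ab by (intro point1_in_line_points) auto
  obtain s t where st: "coords L = (s, t)" by (cases "coords L")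
  then have nz': "(s, t) \<noteq> (0, 0)" and "point1 (s, t) = L" using line_points_coords[OF L] by auto
  then have st_eq: "s * fps_nth b 0 = fps_nth a 0 * t"
    using ab point1_eq_iff[of s t "fps_nth a 0" "fps_nth b 0"] by (auto simp: L_def)
  \<comment> \<open>One coordinate of the local parameter is a nonzero constant. The unit w scales
    the matching coordinate of (a, b) to that constant, and the other coordinate then defines
    \<sigma>.\<close>
  have "\<exists>w \<sigma>. fps_nth w 0 \<noteq> 0 \<and> fps_nth \<sigma> 0 = 0 \<and>
      a = w * fps_compose (fst (local_param (s, t))) \<sigma> \<and> b = w * fps_compose (snd (local_param (s, t))) \<sigma>"
  proof (cases "s = 0")
    case True
    then have t: "t \<noteq> 0" and a0: "fps_nth a 0 = 0" and b0: "fps_nth b 0 \<noteq> 0" using nz' st_eq ab by auto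
    let ?w = "b * fps_const (1 / t)" and ?\<sigma> = "fps_const t * a * inverse b"
    have "?w * ?\<sigma> = (fps_const (1 / t) * fps_const t) * (a * (b * inverse b))" by (simp only: mult_ac)
    also have "\<dots> = a" using t inverse_mult_eq_1'[OF b0] by simp
    finally have "a = ?w * fps_compose fps_X ?\<sigma>" using a0 by simp
    moreover have "b = ?w * fps_compose (fps_const t) ?\<sigma>" using t by (simp add: mult.assoc)
    ultimately show ?thesis using True a0 b0 t
      by (intro exI[of _ ?w] exI[of _ ?\<sigma>]) (simp add: local_param_def)
  next
    case False
    then have a0: "fps_nth a 0 \<noteq> 0" using st_eq ab by auto
    let ?w = "a * fps_const (1 / s)" and ?\<sigma> = "fps_const s * b * inverse a - fps_const t"
    have "?w * (fps_const t + ?\<sigma>) = (fps_const (1 / s) * fps_const s) * (b * (a * inverse a))"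
      by (simp add: mult_ac)
    also have "\<dots> = b" using False inverse_mult_eq_1'[OF a0] by simp
    finally have b: "?w * (fps_const t + ?\<sigma>) = b" .
    have \<sigma>0: "fps_nth ?\<sigma> 0 = 0" using a0 st_eq by (simp add: field_simps)
    then have "b = ?w * fps_compose (fps_const t + fps_X) ?\<sigma>"
      using b by (simp add: fps_compose_add_distrib)
    moreover have "a = ?w * fps_compose (fps_const s) ?\<sigma>" using False by (simp add: mult.assoc)
    ultimately show ?thesis using False a0 \<sigma>0
      by (intro exI[of _ ?w] exI[of _ ?\<sigma>]) (simp add: local_param_def)
  qed
  then obtain w \<sigma> where w: "fps_nth w 0 \<noteq> 0" and \<sigma>: "fps_nth \<sigma> 0 = 0"
    and a: "a = w * fps_compose (fst (local_param (s, t))) \<sigma>"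
    and b: "b = w * fps_compose (snd (local_param (s, t))) \<sigma>" by blast
  have ev: "eval2 fps_const P (a, b) = w ^ d * fps_compose (eval2 fps_const P (local_param (s, t))) \<sigma>"
    if "homogeneous2 d P" for P
    unfolding a b eval2_scale[OF comm_ring_hom_fps_const that]
    by (cases "local_param (s, t)") (simp add: fps_compose_eval2[OF \<sigma>])
  have \<gamma>': "\<gamma> = reparametrize (c * w ^ d) \<sigma> (local_branch (s, t))"
    unfolding \<gamma> local_branch_def by (simp add: ev hf mult.assoc)
  then have \<sigma>1: "fps_nth \<sigma> 1 \<noteq> 0"
    using irr \<sigma> unfolding irreducible_parametrization_def by blast
  have u: "fps_nth (c * w ^ d) 0 \<noteq> 0" using c w by (simp add: fps_power_zeroth)
  have "branch_of \<gamma> = branch_at f L"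
    unfolding \<gamma>' branch_of_reparametrize[OF u \<sigma> \<sigma>1] branch_at_altdef st ..
  moreover have "initial_vector \<gamma> = (let c = fps_nth (c * w ^ d) 0 in
      (c * eval2 id f0 (s, t), c * eval2 id f1 (s, t), c * eval2 id f2 (s, t)))"
    unfolding \<gamma>' local_branch_def by (simp add: Let_def fps_nth_0_eval2_local_param)
  then have "point2 (initial_vector \<gamma>) = image_point f L"
    using point2_scale[OF u] by (simp add: image_point_def st Let_def)
  ultimately show ?thesis using L by metis
qed

lemma branches_eq: "branches F p = branch_at f ` {L \<in> line_points. image_point f L = p}"
proof (intro equalityI subsetI)
  fix \<beta> assume "\<beta> \<in> branches F p"
  then show "\<beta> \<in> branch_at f ` {L \<in> line_points. image_point f L = p}"
    unfolding branches_def using branch_eq_branch_at by fastforce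
next
  fix \<beta> assume "\<beta> \<in> branch_at f ` {L \<in> line_points. image_point f L = p}"
  then obtain L where L: "L \<in> line_points" "image_point f L = p" "\<beta> = branch_at f L" by blast
  note v = line_points_coords(1)[OF L(1)]
  have "point2 (initial_vector (local_branch (coords L))) = p"
    using L(2) by (simp add: initial_vector_local_branch image_point_def)
  moreover have "initial_vector (local_branch (coords L)) \<noteq> (0, 0, 0)"
    unfolding initial_vector_local_branch by (rule f_no_common_zero[OF v])
  ultimately show "\<beta> \<in> branches F p"
    unfolding branches_def L(3) branch_at_altdef
    using F_local_branch irreducible_local_branch[OF v] by blast
qed

lemma inj_on_branch_at: "inj_on (branch_at f) line_points"
proof (rule inj_onI)
  fix L M assume LM: "L \<in> line_points" "M \<in> line_points" "branch_at f L = branch_at f M"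
  then have "point1 (coords L) = point1 (coords M)"
    using branch_of_local_branch_inj line_points_coords(1) unfolding branch_at_altdef by blast
  then show "L = M" using LM line_points_coords(2) by simp
qed

end

section \<open>Determinants\<close>

lemma det_mat_scale:
  fixes M :: "nat \<Rightarrow> nat \<Rightarrow> 'a::comm_ring_1"
  shows "Determinant.det (Matrix.mat n n (\<lambda>(i, j). a i * b j * M i j)) =
    (\<Prod>i<n. a i) * (\<Prod>j<n. b j) * Determinant.det (Matrix.mat n n (\<lambda>(i, j). M i j))"
proof -
  have "signof p * (\<Prod>i = 0..<n. a i * b (p i) * M i (p i)) =
      (\<Prod>i<n. a i) * (\<Prod>j<n. b j) * (signof p * (\<Prod>i = 0..<n. M i (p i)))"
    if "p permutes {0..<n}" for p
  proof -
    have "(\<Prod>i = 0..<n. b (p i)) = (\<Prod>j = 0..<n. b j)"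
      using prod.permute[OF that, of b] by (simp add: o_def)
    then show ?thesis by (simp add: prod.distrib lessThan_atLeast0 mult_ac)
  qed
  moreover have "Matrix.mat n n (\<lambda>(i, j). u i j) $$ (i, p i) = u i (p i)"
    if "p permutes {0..<n}" "i \<in> {0..<n}" for p i and u :: "nat \<Rightarrow> nat \<Rightarrow> 'a"
    using that permutes_in_image[OF that(1), of i] by simp
  ultimately show ?thesis
    by (simp add: Determinant.det_def sum_distrib_left)
qed

lemma hom_det_mat:
  assumes "comm_ring_hom \<phi>"
  shows "\<phi> (Determinant.det (Matrix.mat n n u)) = Determinant.det (Matrix.mat n n (\<lambda>x. \<phi> (u x)))"
proof -
  interpret comm_ring_hom \<phi> by fact
  have "map_mat \<phi> (Matrix.mat n n u) = Matrix.mat n n (\<lambda>x. \<phi> (u x))" by (rule eq_matI) auto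
  then show ?thesis using hom_det[of "Matrix.mat n n u"] by simp
qed

lemma det_mat_mult:
  fixes u v :: "nat \<Rightarrow> nat \<Rightarrow> 'a::comm_ring_1"
  shows "Determinant.det (Matrix.mat n n (\<lambda>(i, j). \<Sum>k<n. u i k * v k j)) =
    Determinant.det (Matrix.mat n n (\<lambda>(i, j). u i j)) * Determinant.det (Matrix.mat n n (\<lambda>(i, j). v i j))"
proof -
  have "Matrix.mat n n (\<lambda>(i, j). \<Sum>k<n. u i k * v k j) =
      Matrix.mat n n (\<lambda>(i, j). u i j) * Matrix.mat n n (\<lambda>(i, j). v i j)"
    by (rule eq_matI) (auto simp: scalar_prod_def lessThan_atLeast0)
  then show ?thesis using det_mult[of "Matrix.mat n n (\<lambda>(i, j). u i j)" n] by simp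
qed

text \<open>The falling factorial x (x - 1) ... (x - i + 1), the factor that appears in the i-th
  derivative of z^x.\<close>

definition falling :: "nat \<Rightarrow> complex poly" where
  "falling i = (\<Prod>r<i. [:- of_nat r, 1:])"

lemma falling_Suc: "falling (Suc i) = falling i * [:- of_nat i, 1:]"
  by (simp add: falling_def mult.commute)

lemma degree_falling: "degree (falling i) = i" and lead_coeff_falling: "coeff (falling i) i = 1"
proof -
  have "degree (falling i) = i \<and> lead_coeff (falling i) = 1"
  proof (induction i)
    case (Suc i)
    then have "falling i \<noteq> 0" by auto
    then have "degree (falling (Suc i)) = Suc i" unfolding falling_Suc using Suc by (subst degree_mult_eq) auto
    moreover have "lead_coeff (falling i) = 1" using Suc by blast
    then have "lead_coeff (falling (Suc i)) = 1" unfolding falling_Suc lead_coeff_mult by simp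
    ultimately show ?case by blast
  qed (simp add: falling_def)
  then have deg: "degree (falling i) = i" and lead: "lead_coeff (falling i) = 1" by blast+
  show "degree (falling i) = i" by (rule deg)
  show "coeff (falling i) i = 1" using lead unfolding deg .
qed

text \<open>A linear relation between the rows would be a nonzero polynomial of degree less than \<open>n\<close>
  with \<open>n\<close> roots.\<close>

lemma det_falling_neq_0:
  assumes inj: "inj_on k {..<n}"
  shows "Determinant.det (Matrix.mat n n (\<lambda>(i, j). poly (falling i) (of_nat (k j :: nat)))) \<noteq> 0"
proof
  let ?A = "Matrix.mat n n (\<lambda>(i, j). poly (falling j) (of_nat (k i :: nat)))"
  assume "Determinant.det (Matrix.mat n n (\<lambda>(i, j). poly (falling i) (of_nat (k j :: nat)))) = 0"
  moreover have "transpose_mat ?A = Matrix.mat n n (\<lambda>(i, j). poly (falling i) (of_nat (k j :: nat)))"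
    by (rule eq_matI) auto
  ultimately have "Determinant.det ?A = 0"
    using det_transpose[of ?A n] by simp
  then obtain v where v: "v \<in> carrier_vec n" "v \<noteq> 0\<^sub>v n" "?A *\<^sub>v v = 0\<^sub>v n"
    using det_0_iff_vec_prod_zero_field[of ?A n] by auto
  define q where "q = (\<Sum>i<n. Polynomial.smult (v $ i) (falling i))"
  have root: "poly q (of_nat (k j)) = 0" if "j < n" for j
  proof -
    have "poly q (of_nat (k j)) = (?A *\<^sub>v v) $ j"
      using that v(1) by (simp add: q_def poly_sum scalar_prod_def lessThan_atLeast0 mult.commute)
    then show ?thesis using v(3) that by simp
  qed
  have "\<exists>i<n. v $ i \<noteq> 0"
  proof (rule ccontr)
    assume "\<not> ?thesis"
    then have "v = 0\<^sub>v n" using v(1) by (intro eq_vecI) auto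
    then show False using v(2) by simp
  qed
  then have "{i. i < n \<and> v $ i \<noteq> 0} \<noteq> {}" by auto
  \<comment> \<open>The falling factorials are monic of different degrees, so the top index with
    nonzero entry determines the coefficient of \<open>q\<close> in degree m, and \<open>q\<close>
    is nonzero.\<close>
  define m where "m = Max {i. i < n \<and> v $ i \<noteq> 0}"
  have "m \<in> {i. i < n \<and> v $ i \<noteq> 0}" unfolding m_def by (rule Max_in) (use \<open>_ \<noteq> {}\<close> in auto)
  then have m: "m < n" "v $ m \<noteq> 0" by auto
  have above: "v $ i = 0" if "i < n" "m < i" for i
  proof (rule ccontr)
    assume "v $ i \<noteq> 0"
    then have "i \<le> m" unfolding m_def using that(1) by (intro Max_ge) auto
    then show False using that(2) by simp
  qed
  have "coeff q m = (\<Sum>i<n. if i = m then v $ m else 0)"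
    unfolding q_def coeff_sum
  proof (intro sum.cong refl)
    fix i assume i: "i \<in> {..<n}"
    consider "i < m" | "i = m" | "m < i" by linarith
    then show "coeff (Polynomial.smult (v $ i) (falling i)) m = (if i = m then v $ m else 0)"
      using i above by cases (auto simp: coeff_eq_0 degree_falling lead_coeff_falling)
  qed
  then have "coeff q m = v $ m" using m by simp
  then have "q \<noteq> 0" using m by auto
  have "of_nat ` k ` {..<n} \<subseteq> {x. poly q x = 0}" using root by auto
  moreover have "card (of_nat ` k ` {..<n} :: complex set) = n"
    using inj by (simp add: card_image inj_on_def)
  ultimately have "n \<le> card {x. poly q x = 0}" using poly_roots_finite[OF \<open>q \<noteq> 0\<close>] card_mono by metis
  also have "\<dots> \<le> degree q" by (rule poly_roots_degree) fact
  also have "degree q \<le> n - 1"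
    unfolding q_def by (rule degree_sum_le) (auto intro: order.trans[OF degree_smult_le] simp: degree_falling)
  finally show False using m by simp
qed

section \<open>Wronskians of power series\<close>

definition fps_wronskian :: "nat \<Rightarrow> (nat \<Rightarrow> complex fps) \<Rightarrow> complex fps" where
  "fps_wronskian N g = Determinant.det (Matrix.mat N N (\<lambda>(i, j). (fps_deriv ^^ i) (g j)))"

definition fps_span :: "nat \<Rightarrow> (nat \<Rightarrow> complex fps) \<Rightarrow> complex fps set" where
  "fps_span N g = {\<Sum>m<N. fps_const (c m) * g m | c. True}"

definition fps_orders :: "nat \<Rightarrow> (nat \<Rightarrow> complex fps) \<Rightarrow> nat set" where
  "fps_orders N g = subdegree ` (fps_span N g - {0})"

lemma fps_deriv_pow_lincomb:
  "(fps_deriv ^^ i) (\<Sum>m<N. fps_const (c m) * g m) = (\<Sum>m<N. fps_const (c m) * (fps_deriv ^^ i) (g m :: complex fps))"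
  by (induction i) (auto simp: fps_deriv_sum)

lemma fps_wronskian_lincomb:
  assumes "\<And>j. j < N \<Longrightarrow> e j = (\<Sum>m<N. fps_const (c m j) * g m)"
  shows "fps_wronskian N e = fps_wronskian N g * fps_const (Determinant.det (Matrix.mat N N (\<lambda>(i, j). c i j)))"
proof -
  have "(fps_deriv ^^ i) (e j) = (\<Sum>m<N. (fps_deriv ^^ i) (g m) * fps_const (c m j))" if "j < N" for i j
    unfolding assms[OF that] fps_deriv_pow_lincomb by (simp add: mult.commute)
  then have "Matrix.mat N N (\<lambda>(i, j). (fps_deriv ^^ i) (e j)) =
      Matrix.mat N N (\<lambda>(i, j). \<Sum>m<N. (fps_deriv ^^ i) (g m) * fps_const (c m j))"
    by (intro eq_matI) auto
  then have "fps_wronskian N e = fps_wronskian N g * Determinant.det (Matrix.mat N N (\<lambda>(i, j). fps_const (c i j)))"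
    unfolding fps_wronskian_def by (simp only: det_mat_mult)
  then show ?thesis
    by (simp add: hom_det_mat[OF comm_ring_hom_fps_const] case_prod_unfold)
qed

text \<open>The leading term of the i-th derivative. The extra factor z^i avoids the exponent k - i,
  which would be truncated for i > k; there the falling factorial vanishes.\<close>

lemma fps_deriv_pow_X_power:
  "\<exists>u'. fps_X ^ i * (fps_deriv ^^ i) (fps_X ^ k * u) = fps_X ^ k * u' \<and>
    fps_nth u' 0 = poly (falling i) (of_nat k) * fps_nth (u :: complex fps) 0"
proof (induction i)
  case 0
  show ?case by (rule exI[of _ u]) (simp add: falling_def)
next
  case (Suc i)
  let ?D = "(fps_deriv ^^ i) (fps_X ^ k * u)"
  have X: "fps_X * fps_deriv (fps_X ^ n) = of_nat n * (fps_X ^ n :: complex fps)" for n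
  proof (cases n)
    case (Suc m)
    have "fps_deriv (fps_X ^ Suc m :: complex fps) = of_nat (Suc m) * fps_X ^ m"
      unfolding fps_deriv_power' by simp
    then show ?thesis unfolding Suc by (simp only: power_Suc mult_ac)
  qed simp
  from Suc obtain w where w: "fps_X ^ i * ?D = fps_X ^ k * w"
    and w0: "fps_nth w 0 = poly (falling i) (of_nat k) * fps_nth u 0" by blast
  \<comment> \<open>The operator z d/dz is applied to both sides of the induction hypothesis; it
    multiplies z^n by n.\<close>
  have "fps_X * fps_deriv (fps_X ^ i * ?D) = (fps_X * fps_deriv (fps_X ^ i)) * ?D + fps_X ^ Suc i * fps_deriv ?D"
    by (simp add: algebra_simps)
  then have 1: "fps_X * fps_deriv (fps_X ^ i * ?D) = of_nat i * (fps_X ^ i * ?D) + fps_X ^ Suc i * fps_deriv ?D"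
    unfolding X by (simp only: mult.assoc)
  have "fps_X * fps_deriv (fps_X ^ k * w) = (fps_X * fps_deriv (fps_X ^ k)) * w + fps_X ^ k * (fps_X * fps_deriv w)"
    by (simp add: algebra_simps)
  then have 2: "fps_X * fps_deriv (fps_X ^ k * w) = of_nat k * (fps_X ^ k * w) + fps_X ^ k * (fps_X * fps_deriv w)"
    unfolding X by (simp only: mult.assoc)
  have "fps_X ^ Suc i * fps_deriv ?D = of_nat k * (fps_X ^ k * w) + fps_X ^ k * (fps_X * fps_deriv w) - of_nat i * (fps_X ^ k * w)"
    using 1 2 unfolding w by (simp add: algebra_simps)
  also have "\<dots> = fps_X ^ k * ((of_nat k - of_nat i) * w + fps_X * fps_deriv w)"
    by (simp add: algebra_simps)
  finally show ?case
    using w0 by (intro exI[of _ "(of_nat k - of_nat i) * w + fps_X * fps_deriv w"])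
      (simp add: falling_Suc algebra_simps fps_of_nat[symmetric])
qed

text \<open>Multiplying row i by z^i lets the power z^(k_j) be taken out of column j. The constant
  term of what remains is the determinant of falling factorials times the leading coefficients, and
  distinct orders make it nonzero.\<close>

lemma subdegree_wronskian_distinct:
  assumes nz: "\<And>j. j < N \<Longrightarrow> e j \<noteq> 0" and inj: "inj_on (\<lambda>j. subdegree (e j)) {..<N}"
  shows "fps_wronskian N e \<noteq> 0 \<and> subdegree (fps_wronskian N e) + (\<Sum>i<N. i) = (\<Sum>j<N. subdegree (e j))"
proof -
  let ?k = "\<lambda>j. subdegree (e j)"
  define u where "u j = fps_shift (?k j) (e j)" for j
  have e: "e j = fps_X ^ ?k j * u j" for j
    unfolding u_def by (subst mult.commute) (rule subdegree_decompose)
  have u0: "fps_nth (u j) 0 \<noteq> 0" if "j < N" for j using nz[OF that] by (simp add: u_def)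
  have "\<exists>w. \<forall>i j. fps_X ^ i * (fps_deriv ^^ i) (e j) = fps_X ^ ?k j * w i j \<and>
      fps_nth (w i j) 0 = poly (falling i) (of_nat (?k j)) * fps_nth (u j) 0"
  proof -
    have "\<forall>i j. \<exists>w. fps_X ^ i * (fps_deriv ^^ i) (e j) = fps_X ^ ?k j * w \<and>
        fps_nth w 0 = poly (falling i) (of_nat (?k j)) * fps_nth (u j) 0"
    proof (intro allI)
      fix i j
      show "\<exists>w. fps_X ^ i * (fps_deriv ^^ i) (e j) = fps_X ^ ?k j * w \<and>
          fps_nth w 0 = poly (falling i) (of_nat (?k j)) * fps_nth (u j) 0"
        using fps_deriv_pow_X_power[of i "?k j" "u j"] unfolding e[symmetric] .
    qed
    then show ?thesis by metis
  qed
  then obtain w where w: "fps_X ^ i * (fps_deriv ^^ i) (e j) = fps_X ^ ?k j * w i j"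
      and w0: "fps_nth (w i j) 0 = poly (falling i) (of_nat (?k j)) * fps_nth (u j) 0" for i j by blast
  let ?W = "Determinant.det (Matrix.mat N N (\<lambda>(i, j). w i j))"
  have "fps_X ^ (\<Sum>i<N. i) * fps_wronskian N e =
      Determinant.det (Matrix.mat N N (\<lambda>(i, j). fps_X ^ i * 1 * (fps_deriv ^^ i) (e j)))"
    unfolding fps_wronskian_def det_mat_scale by (simp add: power_sum)
  also have "\<dots> = Determinant.det (Matrix.mat N N (\<lambda>(i, j). 1 * fps_X ^ ?k j * w i j))"
    by (simp add: w)
  also have "\<dots> = fps_X ^ (\<Sum>j<N. ?k j) * ?W"
    unfolding det_mat_scale by (simp add: power_sum)
  finally have eq: "fps_X ^ (\<Sum>i<N. i) * fps_wronskian N e = fps_X ^ (\<Sum>j<N. ?k j) * ?W" .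
  have "fps_nth ?W 0 = Determinant.det (Matrix.mat N N (\<lambda>(i, j). 1 * fps_nth (u j) 0 * poly (falling i) (of_nat (?k j))))"
    unfolding hom_det_mat[OF comm_ring_hom_fps_nth_0] by (simp add: case_prod_unfold w0 mult.commute)
  also have "\<dots> \<noteq> 0"
    unfolding det_mat_scale using det_falling_neq_0[OF inj] u0 by simp
  finally have W: "fps_nth ?W 0 \<noteq> 0" .
  then have W': "?W \<noteq> 0" "subdegree ?W = 0" by (auto simp: subdegree_eq_0_iff)
  then have "fps_wronskian N e \<noteq> 0" using eq by auto
  moreover from this have "(\<Sum>i<N. i) + subdegree (fps_wronskian N e) = (\<Sum>j<N. ?k j) + subdegree ?W"
    using arg_cong[OF eq, of subdegree] W' by simp
  ultimately show ?thesis using W' by simp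
qed

section \<open>Orders attained in a finite-dimensional space of power series\<close>

definition scale_fps :: "complex \<Rightarrow> complex fps \<Rightarrow> complex fps" where
  "scale_fps c v = fps_const c * v"

lemma vector_space_scale_fps: "Vector_Spaces.vector_space scale_fps"
proof
  show "scale_fps a (x + y) = scale_fps a x + scale_fps a y" for a x y
    unfolding scale_fps_def by (rule distrib_left)
  show "scale_fps (a + b) x = scale_fps a x + scale_fps b x" for a b x
    by (simp only: scale_fps_def fps_const_add[symmetric] distrib_right)
  show "scale_fps a (scale_fps b x) = scale_fps (a * b) x" for a b x
    by (simp only: scale_fps_def fps_const_mult[symmetric] mult.assoc)
  show "scale_fps 1 x = x" for x
    by (simp add: scale_fps_def)
qed

interpretation fps_vs: Vector_Spaces.vector_space scale_fps
  by (rule vector_space_scale_fps)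

locale independent_fps =
  fixes N :: nat and g :: "nat \<Rightarrow> complex fps"
  assumes indep: "\<And>c. (\<Sum>m<N. fps_const (c m) * g m) = 0 \<Longrightarrow> (\<forall>m<N. c m = 0)"
begin

lemma span_eq: "fps_vs.span (g ` {..<N}) = fps_span N g"
proof (intro equalityI subsetI)
  fix v assume "v \<in> fps_vs.span (g ` {..<N})"
  then show "v \<in> fps_span N g"
  proof (induction rule: fps_vs.span_induct_alt)
    case base
    show ?case unfolding fps_span_def by (rule CollectI, rule exI[of _ "\<lambda>_. 0"]) simp
  next
    case (step a x y)
    then obtain i c where i: "i < N" "x = g i" and y: "y = (\<Sum>m<N. fps_const (c m) * g m)"
      unfolding fps_span_def by auto
    have "fps_const a * x = (\<Sum>m<N. fps_const (if m = i then a else 0) * g m)"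
      using i by (simp add: if_distrib[of fps_const] if_distrib[of "\<lambda>x. x * _"] cong: if_cong)
    then have "scale_fps a x + y = (\<Sum>m<N. fps_const ((if m = i then a else 0) + c m) * g m)"
      unfolding y scale_fps_def by (simp add: sum.distrib[symmetric] algebra_simps flip: fps_const_add)
    then show ?case unfolding fps_span_def by (intro CollectI exI[of _ "\<lambda>m. (if m = i then a else 0) + c m"]) simp
  qed
next
  fix v assume "v \<in> fps_span N g"
  then obtain c where v: "v = (\<Sum>m<N. fps_const (c m) * g m)" unfolding fps_span_def by blast
  show "v \<in> fps_vs.span (g ` {..<N})"
    unfolding v scale_fps_def[symmetric] by (intro fps_vs.span_sum fps_vs.span_scale fps_vs.span_base) auto
qed

lemma inj_g: "inj_on g {..<N}"
proof (rule inj_onI)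
  fix i j assume ij: "i \<in> {..<N}" "j \<in> {..<N}" "g i = g j"
  show "i = j"
  proof (rule ccontr)
    assume "i \<noteq> j"
    let ?c = "\<lambda>m. if m = i then 1 else if m = j then -1 else 0 :: complex"
    have "(\<Sum>m<N. fps_const (?c m) * g m) = (\<Sum>m\<in>{i, j}. fps_const (?c m) * g m)"
      using ij by (intro sum.mono_neutral_right) auto
    also have "\<dots> = 0" using \<open>i \<noteq> j\<close> ij(3) by (simp flip: fps_const_neg)
    finally show False using indep[of ?c] ij(1) by auto
  qed
qed

lemma independent_g: "fps_vs.independent (g ` {..<N})"
  unfolding fps_vs.dependent_finite[OF finite_imageI[OF finite_lessThan]]
proof (intro notI, elim exE conjE bexE)
  fix u v assume v: "v \<in> g ` {..<N}" "u v \<noteq> 0" and z: "(\<Sum>v\<in>g ` {..<N}. scale_fps (u v) v) = 0"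
  have "(\<Sum>m<N. fps_const (u (g m)) * g m) = 0"
    using z unfolding sum.reindex[OF inj_g] by (simp add: scale_fps_def)
  then show False using indep[of "\<lambda>m. u (g m)"] v by auto
qed

text \<open>In a linear relation, the term of least order among those with nonzero coefficient has
  nothing to cancel against.\<close>

lemma independent_distinct_subdegrees:
  assumes "finite E" "0 \<notin> E" "inj_on subdegree E"
  shows "fps_vs.independent E"
  unfolding fps_vs.dependent_finite[OF assms(1)]
proof (intro notI, elim exE conjE bexE)
  fix u v assume v: "v \<in> E" "u v \<noteq> 0" and z: "(\<Sum>v\<in>E. scale_fps (u v) v) = 0"
  define E' where "E' = {v \<in> E. u v \<noteq> 0}"
  have fin: "finite E'" "E' \<noteq> {}" using assms(1) v by (auto simp: E'_def)
  then obtain w where w: "w \<in> E'" and least: "\<And>x. x \<in> E' \<Longrightarrow> subdegree w \<le> subdegree x"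
    using ex_min_if_finite[of "subdegree ` E'"] by (metis (no_types, lifting) arg_min_if_finite(1) arg_min_least)
  have "fps_nth (fps_const (u x) * x) (subdegree w) = 0" if "x \<in> E - {w}" for x
  proof (cases "x \<in> E'")
    case True
    then have "subdegree w \<noteq> subdegree x" using assms(3) that w by (auto simp: E'_def inj_on_def)
    then have "subdegree w < subdegree x" using least[OF True] by simp
    then have "fps_nth x (subdegree w) = 0" by (rule nth_less_subdegree_zero)
    then show ?thesis by simp
  qed (use that in \<open>simp add: E'_def\<close>)
  then have "(\<Sum>v\<in>E - {w}. fps_nth (fps_const (u v) * v) (subdegree w)) = 0" by (rule sum.neutral[OF ballI])
  then have "fps_nth (\<Sum>v\<in>E. fps_const (u v) * v) (subdegree w) = fps_nth (fps_const (u w) * w) (subdegree w)"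
    unfolding fps_sum_nth using w assms(1) by (subst sum.remove[of _ w]) (auto simp: E'_def)
  moreover have "w \<noteq> 0" using w assms(2) by (auto simp: E'_def)
  ultimately show False using z w by (simp add: E'_def scale_fps_def)
qed

lemma orders_basis:
  assumes "H \<subseteq> fps_orders N g"
  shows "\<exists>e. \<forall>h \<in> H. e h \<in> fps_span N g \<and> e h \<noteq> 0 \<and> subdegree (e h) = h"
proof -
  have "\<forall>h \<in> H. \<exists>v. v \<in> fps_span N g \<and> v \<noteq> 0 \<and> subdegree v = h"
    using assms unfolding fps_orders_def by force
  then show ?thesis by (rule bchoice)
qed

text \<open>Series chosen one for each order are independent in a space spanned by N series. Stated
  for finite subsets, so that finiteness of the set of orders can be deduced from it.\<close>

lemma card_orders_le:
  assumes "H \<subseteq> fps_orders N g" "finite H"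
  shows "card H \<le> N"
proof -
  obtain e where "\<forall>h \<in> H. e h \<in> fps_span N g \<and> e h \<noteq> 0 \<and> subdegree (e h) = h"
    using orders_basis[OF assms(1)] by blast
  then have e: "\<And>h. h \<in> H \<Longrightarrow> e h \<in> fps_span N g" "\<And>h. h \<in> H \<Longrightarrow> e h \<noteq> 0"
    "\<And>h. h \<in> H \<Longrightarrow> subdegree (e h) = h" by auto
  have inj: "inj_on e H" using e(3) by (metis inj_onI)
  have "fps_vs.independent (e ` H)"
    using assms(2) e by (intro independent_distinct_subdegrees) (auto simp: inj_on_def)
  moreover have "e ` H \<subseteq> fps_vs.span (g ` {..<N})" using e(1) by (auto simp: span_eq)
  ultimately have "card (e ` H) \<le> card (g ` {..<N})" using fps_vs.independent_span_bound by blast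
  then show ?thesis by (simp add: card_image[OF inj] card_image[OF inj_g])
qed

lemma finite_orders: "finite (fps_orders N g)"
proof (rule ccontr)
  assume "infinite (fps_orders N g)"
  then obtain H where "H \<subseteq> fps_orders N g" "finite H" "card H = Suc N"
    using infinite_arbitrarily_large by blast
  then show False using card_orders_le[of H] by simp
qed

text \<open>Series chosen one for each order also span: subtracting the right multiple of the one
  with the same order as v raises the order of v or kills it, and only finitely many orders are
  available.\<close>

lemma card_orders: "card (fps_orders N g) = N"
proof (rule antisym)
  let ?H = "fps_orders N g"
  show "card ?H \<le> N" using card_orders_le finite_orders by blast
  obtain e where "\<forall>h \<in> ?H. e h \<in> fps_span N g \<and> e h \<noteq> 0 \<and> subdegree (e h) = h"
    using orders_basis[OF order.refl] by blast
  then have e: "\<And>h. h \<in> ?H \<Longrightarrow> e h \<in> fps_span N g" "\<And>h. h \<in> ?H \<Longrightarrow> e h \<noteq> 0"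
    "\<And>h. h \<in> ?H \<Longrightarrow> subdegree (e h) = h" by auto
  have "v \<in> fps_vs.span (e ` ?H)" if "v \<in> fps_span N g" for v :: "complex fps"
    using that
  \<comment> \<open>The measure counts the attained orders not below that of v.\<close>
  proof (induction "card {h \<in> ?H. subdegree v \<le> h}" arbitrary: v rule: less_induct)
    case less
    show ?case
    proof (cases "v = 0")
      case False
      let ?h = "subdegree v"
      have h: "?h \<in> ?H" using less.prems False by (auto simp: fps_orders_def)
      let ?a = "fps_nth v ?h / fps_nth (e ?h) ?h"
      let ?v = "v - fps_const ?a * e ?h"
      have v': "?v \<in> fps_span N g"
        using less.prems e(1)[OF h] unfolding span_eq[symmetric] scale_fps_def[symmetric]
        by (intro fps_vs.span_diff fps_vs.span_scale)
      have "?v \<in> fps_vs.span (e ` ?H)"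
      proof (cases "?v = 0")
        case nz: False
        have "fps_nth (e ?h) ?h \<noteq> 0" using e(2,3)[OF h] by (metis nth_subdegree_nonzero)
        then have low: "fps_nth ?v i = 0" if "i \<le> ?h" for i
        proof (cases "i = ?h")
          case False
          then have "i < subdegree v" "i < subdegree (e ?h)" using that e(3)[OF h] by simp_all
          then have "fps_nth v i = 0" "fps_nth (e ?h) i = 0" by (blast intro: nth_less_subdegree_zero)+
          then show ?thesis by simp
        qed simp
        have lt: "?h < subdegree ?v" using nz low by (rule subdegree_greaterI)
        have "?h \<in> {h \<in> ?H. ?h \<le> h}" "?h \<notin> {h \<in> ?H. subdegree ?v \<le> h}" using lt h by auto
        moreover have "{h \<in> ?H. subdegree ?v \<le> h} \<subseteq> {h \<in> ?H. ?h \<le> h}" using lt by auto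
        ultimately have "{h \<in> ?H. subdegree ?v \<le> h} \<subset> {h \<in> ?H. ?h \<le> h}" by blast
        then have "card {h \<in> ?H. subdegree ?v \<le> h} < card {h \<in> ?H. ?h \<le> h}"
          using finite_orders by (intro psubset_card_mono) auto
        then show ?thesis using less.hyps v' by blast
      qed (simp add: fps_vs.span_zero)
      moreover have "scale_fps ?a (e ?h) \<in> fps_vs.span (e ` ?H)"
        using h by (intro fps_vs.span_scale fps_vs.span_base) auto
      ultimately have "?v + scale_fps ?a (e ?h) \<in> fps_vs.span (e ` ?H)" by (rule fps_vs.span_add)
      then show ?thesis by (simp add: scale_fps_def)
    qed (simp add: fps_vs.span_zero)
  qed
  then have "g ` {..<N} \<subseteq> fps_vs.span (e ` ?H)"
    using fps_vs.span_base[of _ "g ` {..<N}"] span_eq by blast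
  then have "card (g ` {..<N}) \<le> card (e ` ?H)"
    using fps_vs.independent_span_bound[OF _ independent_g] finite_orders by blast
  also have "\<dots> \<le> card ?H" using finite_orders by (rule card_image_le)
  finally show "N \<le> card ?H" by (simp add: card_image[OF inj_g])
qed

text \<open>Passing from \<open>g\<close> to series with the distinct orders multiplies the
  Wronskian by a constant determinant. Since the new Wronskian is nonzero, that determinant and the
  Wronskian of \<open>g\<close> are nonzero too.\<close>

lemma subdegree_wronskian:
  "fps_wronskian N g \<noteq> 0 \<and> subdegree (fps_wronskian N g) + (\<Sum>i<N. i) = (\<Sum>h\<in>fps_orders N g. h)"
proof -
  let ?H = "fps_orders N g"
  obtain e where "\<forall>h \<in> ?H. e h \<in> fps_span N g \<and> e h \<noteq> 0 \<and> subdegree (e h) = h"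
    using orders_basis[OF order.refl] by blast
  then have e: "\<And>h. h \<in> ?H \<Longrightarrow> e h \<in> fps_span N g" "\<And>h. h \<in> ?H \<Longrightarrow> e h \<noteq> 0"
    "\<And>h. h \<in> ?H \<Longrightarrow> subdegree (e h) = h" by auto
  obtain k where k: "bij_betw k {..<N} ?H"
    using ex_bij_betw_nat_finite[OF finite_orders] card_orders by (auto simp: lessThan_atLeast0)
  then have kH: "k j \<in> ?H" if "j < N" for j using that by (auto simp: bij_betw_def)
  have "\<exists>c. \<forall>j<N. e (k j) = (\<Sum>m<N. fps_const (c m j) * g m)"
  proof -
    have "\<forall>j. \<exists>c. j < N \<longrightarrow> e (k j) = (\<Sum>m<N. fps_const (c m) * g m)"
      using e(1) kH unfolding fps_span_def by blast
    then obtain c where "\<forall>j. j < N \<longrightarrow> e (k j) = (\<Sum>m<N. fps_const (c j m) * g m)" by metis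
    then show ?thesis by (intro exI[of _ "\<lambda>m j. c j m"]) simp
  qed
  then obtain c where c: "\<And>j. j < N \<Longrightarrow> e (k j) = (\<Sum>m<N. fps_const (c m j) * g m)" by blast
  let ?d = "Determinant.det (Matrix.mat N N (\<lambda>(i, j). c i j))"
  have W: "fps_wronskian N (\<lambda>j. e (k j)) = fps_wronskian N g * fps_const ?d"
    using fps_wronskian_lincomb[OF c] .
  have "inj_on (\<lambda>j. subdegree (e (k j))) {..<N}"
    using k kH e(3) by (auto simp: inj_on_def bij_betw_def)
  then have S: "fps_wronskian N (\<lambda>j. e (k j)) \<noteq> 0"
    "subdegree (fps_wronskian N (\<lambda>j. e (k j))) + (\<Sum>i<N. i) = (\<Sum>j<N. subdegree (e (k j)))"
    using subdegree_wronskian_distinct[of N "\<lambda>j. e (k j)"] e(2) kH by auto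
  have "(\<Sum>j<N. subdegree (e (k j))) = (\<Sum>j<N. k j)" using e(3) kH by simp
  also have "\<dots> = (\<Sum>h\<in>?H. h)" by (rule sum.reindex_bij_betw[OF k])
  finally show ?thesis using S unfolding W by (auto simp: subdegree_mult)
qed

end

section \<open>Euler's relation and the Wronski determinant\<close>

text \<open>The coefficient of \<open>D 0 (b + m)\<close> in the reduction of \<open>s ^ k * D k b\<close> by Euler's relation.\<close>

fun euler_coeff :: "'a::comm_ring_1 \<Rightarrow> nat \<Rightarrow> nat \<Rightarrow> nat \<Rightarrow> nat \<Rightarrow> 'a" where
  "euler_coeff t n 0 b m = (if m = 0 then 1 else 0)"
| "euler_coeff t n (Suc k) b m = of_nat (n - (k + b)) * euler_coeff t n k b m -
     (case m of 0 \<Rightarrow> 0 | Suc m' \<Rightarrow> t * euler_coeff t n k (Suc b) m')"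

lemma euler_coeff_eq_0: "m > k \<Longrightarrow> euler_coeff t n k b m = 0"
  by (induction k arbitrary: b m) (auto split: nat.splits)

lemma euler_coeff_0: "euler_coeff t n k b 0 = of_nat (\<Prod>r<k. n - (r + b))"
  by (induction k) (simp_all add: mult.commute)

text \<open>\<open>D a b\<close> stands for the derivative taken a times by s and b times by t.
  Euler's relation trades s times one more s-derivative for a derivative of lower order and t times
  one more t-derivative, until no s-derivatives are left.\<close>

lemma euler_reduction:
  fixes D :: "nat \<Rightarrow> nat \<Rightarrow> 'a::comm_ring_1"
  assumes "\<And>a b. a + b < p \<Longrightarrow> s * D (Suc a) b + t * D a (Suc b) = of_nat (n - (a + b)) * D a b"
    and "k + b \<le> p"
  shows "s ^ k * D k b = (\<Sum>m\<le>k. euler_coeff t n k b m * D 0 (b + m))"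
  using assms(2)
proof (induction k arbitrary: b)
  case (Suc k)
  let ?c = "euler_coeff t n"
  have step: "s * D (Suc k) b = of_nat (n - (k + b)) * D k b - t * D k (Suc b)"
    using assms(1)[of k b] Suc.prems by (simp add: algebra_simps)
  have "s ^ Suc k * D (Suc k) b = s ^ k * (s * D (Suc k) b)"
    by (simp only: power_Suc mult_ac)
  also have "\<dots> = of_nat (n - (k + b)) * (s ^ k * D k b) - t * (s ^ k * D k (Suc b))"
    unfolding step by (simp only: right_diff_distrib mult.left_commute)
  also have "\<dots> = of_nat (n - (k + b)) * (\<Sum>m\<le>k. ?c k b m * D 0 (b + m)) -
      t * (\<Sum>m\<le>k. ?c k (Suc b) m * D 0 (Suc b + m))"
    using Suc.IH[of b] Suc.IH[of "Suc b"] Suc.prems by simp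
  also have "(\<Sum>m\<le>k. ?c k b m * D 0 (b + m)) = (\<Sum>m\<le>Suc k. ?c k b m * D 0 (b + m))"
    by (simp add: euler_coeff_eq_0)
  also have "t * (\<Sum>m\<le>k. ?c k (Suc b) m * D 0 (Suc b + m)) =
      (\<Sum>m\<le>Suc k. (case m of 0 \<Rightarrow> 0 | Suc m' \<Rightarrow> t * ?c k (Suc b) m') * D 0 (b + m))"
    by (subst sum.atMost_Suc_shift) (simp add: sum_distrib_left mult.assoc)
  also have "of_nat (n - (k + b)) * (\<Sum>m\<le>Suc k. ?c k b m * D 0 (b + m)) -
      (\<Sum>m\<le>Suc k. (case m of 0 \<Rightarrow> 0 | Suc m' \<Rightarrow> t * ?c k (Suc b) m') * D 0 (b + m)) =
      (\<Sum>m\<le>Suc k. ?c (Suc k) b m * D 0 (b + m))"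
    by (simp only: euler_coeff.simps left_diff_distrib sum_subtractf sum_distrib_left mult.assoc)
  finally show ?case .
qed simp

text \<open>After scaling by s^(p - i), row i becomes a combination of the pure t-derivatives of
  orders i to p. The transition matrix \<open>U\<close> is upper triangular, and its diagonal
  entries are integers free of s and t.\<close>

lemma det_euler:
  fixes D :: "nat \<Rightarrow> nat \<Rightarrow> nat \<Rightarrow> 'a::comm_ring_1"
  assumes "\<And>a b j. a + b < p \<Longrightarrow> s * D (Suc a) b j + t * D a (Suc b) j = of_nat (n - (a + b)) * D a b j"
  shows "(\<Prod>i<Suc p. s ^ (p - i)) * Determinant.det (Matrix.mat (Suc p) (Suc p) (\<lambda>(i, j). D (p - i) i j)) =
    of_nat (\<Prod>i<Suc p. \<Prod>r<p - i. n - (r + i)) * Determinant.det (Matrix.mat (Suc p) (Suc p) (\<lambda>(i, j). D 0 i j))"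
proof -
  define U where "U i l = (if i \<le> l then euler_coeff t n (p - i) i (l - i) else 0)" for i l
  have row: "s ^ (p - i) * 1 * D (p - i) i j = (\<Sum>l<Suc p. U i l * D 0 l j)" if "i < Suc p" for i j
  proof -
    have "s ^ (p - i) * D (p - i) i j = (\<Sum>m\<le>p - i. euler_coeff t n (p - i) i m * D 0 (i + m) j)"
      by (rule euler_reduction[where p = p]) (use assms that in auto)
    also have "\<dots> = (\<Sum>l\<in>{i..<Suc p}. euler_coeff t n (p - i) i (l - i) * D 0 l j)"
      using that by (intro sum.reindex_bij_witness[of _ "\<lambda>l. l - i" "\<lambda>m. m + i"]) (auto simp: add.commute)
    also have "\<dots> = (\<Sum>l<Suc p. U i l * D 0 l j)"
      by (rule sum.mono_neutral_cong_left) (auto simp: U_def)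
    finally show ?thesis by simp
  qed
  have "Matrix.mat (Suc p) (Suc p) (\<lambda>(i, j). s ^ (p - i) * 1 * D (p - i) i j) =
      Matrix.mat (Suc p) (Suc p) (\<lambda>(i, j). \<Sum>l<Suc p. U i l * D 0 l j)"
    by (rule eq_matI) (simp_all only: row dim_row_mat dim_col_mat index_mat prod.case)
  then have "(\<Prod>i<Suc p. s ^ (p - i)) * Determinant.det (Matrix.mat (Suc p) (Suc p) (\<lambda>(i, j). D (p - i) i j)) =
      Determinant.det (Matrix.mat (Suc p) (Suc p) (\<lambda>(i, l). U i l)) *
      Determinant.det (Matrix.mat (Suc p) (Suc p) (\<lambda>(i, j). D 0 i j))"
    unfolding det_mat_mult[symmetric]
    using det_mat_scale[of "Suc p" "\<lambda>i. s ^ (p - i)" "\<lambda>_. 1" "\<lambda>i j. D (p - i) i j"] by (simp only: prod.neutral_const mult_1_right)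
  also have "Determinant.det (Matrix.mat (Suc p) (Suc p) (\<lambda>(i, l). U i l)) = (\<Prod>i<Suc p. U i i)"
    by (subst det_upper_triangular[of _ "Suc p"])
      (auto simp: U_def upper_triangular_def prod_list_diag_prod lessThan_atLeast0)
  also have "(\<Prod>i<Suc p. U i i) = of_nat (\<Prod>i<Suc p. \<Prod>r<p - i. n - (r + i))"
    unfolding of_nat_prod by (intro prod.cong refl) (simp add: U_def euler_coeff_0 of_nat_prod)
  finally show ?thesis .
qed

text \<open>Exchanging s and t reverses the rows of the Wronski matrix, which costs only a
  sign.\<close>

lemma det_mat_reverse_rows:
  fixes M :: "nat \<Rightarrow> nat \<Rightarrow> 'a::comm_ring_1"
  shows "\<exists>e. (e = 1 \<or> e = -1) \<and> Determinant.det (Matrix.mat (Suc p) (Suc p) (\<lambda>(i, j). M (p - i) j)) =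
    e * Determinant.det (Matrix.mat (Suc p) (Suc p) (\<lambda>(i, j). M i j))"
proof -
  let ?A = "Matrix.mat (Suc p) (Suc p) (\<lambda>(i, j). M i j)"
  let ?\<pi> = "\<lambda>i. if i < Suc p then p - i else i"
  have perm: "?\<pi> permutes {0..<Suc p}"
    by (rule bij_imp_permutes, rule bij_betw_byWitness[of _ ?\<pi>]) auto
  have "Matrix.mat (Suc p) (Suc p) (\<lambda>(i, j). M (p - i) j) = Matrix.mat (Suc p) (Suc p) (\<lambda>(i, j). ?A $$ (?\<pi> i, j))"
    by (rule eq_matI) auto
  then have "Determinant.det (Matrix.mat (Suc p) (Suc p) (\<lambda>(i, j). M (p - i) j)) = signof ?\<pi> * Determinant.det ?A"
    using det_permute_rows[OF _ perm, of ?A] by simp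
  then show ?thesis by (auto simp: sign_def)
qed

section \<open>Partial derivatives\<close>

lemma coeff_deriv_s: "coeff (coeff (deriv_s P) j) i = of_nat (Suc i) * coeff (coeff P j) (Suc i)"
  by (simp add: deriv_s_def coeff_map_poly coeff_pderiv)

lemma coeff_deriv_t: "coeff (coeff (deriv_t P) j) i = of_nat (Suc j) * coeff (coeff P (Suc j)) i"
  by (simp add: deriv_t_def coeff_pderiv of_nat_poly)

lemma form2_eqI: "(\<And>i j. coeff (coeff P j) i = coeff (coeff Q j) i) \<Longrightarrow> P = (Q :: form2)"
  by (simp add: poly_eq_iff)

lemma deriv_s_deriv_t: "deriv_s (deriv_t P) = deriv_t (deriv_s P)"
  by (rule form2_eqI) (simp only: coeff_deriv_s coeff_deriv_t mult.left_commute)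

lemma deriv_t_deriv_s_pow: "deriv_t ((deriv_s ^^ a) P) = (deriv_s ^^ a) (deriv_t P)"
  by (induction a) (simp_all add: deriv_s_deriv_t[symmetric])

lemma homogeneous2_deriv:
  assumes "homogeneous2 n P"
  shows "homogeneous2 (n - 1) (deriv_s P)" "homogeneous2 (n - 1) (deriv_t P)"
proof -
  have "i + j = n - 1" if "coeff (coeff (deriv_s P) j) i \<noteq> 0" for i j
  proof -
    have "coeff (coeff P j) (Suc i) \<noteq> 0" using that unfolding coeff_deriv_s by simp
    then have "Suc i + j = n" using assms unfolding homogeneous2_def by blast
    then show ?thesis by simp
  qed
  then show "homogeneous2 (n - 1) (deriv_s P)" unfolding homogeneous2_def by blast
  have "i + j = n - 1" if "coeff (coeff (deriv_t P) j) i \<noteq> 0" for i j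
  proof -
    have "coeff (coeff P (Suc j)) i \<noteq> 0" using that unfolding coeff_deriv_t by simp
    then have "i + Suc j = n" using assms unfolding homogeneous2_def by blast
    then show ?thesis by simp
  qed
  then show "homogeneous2 (n - 1) (deriv_t P)" unfolding homogeneous2_def by blast
qed

lemma homogeneous2_deriv_pow:
  assumes "homogeneous2 n P"
  shows "homogeneous2 (n - (a + b)) ((deriv_s ^^ a) ((deriv_t ^^ b) P))"
proof -
  have t: "homogeneous2 (n - b) ((deriv_t ^^ b) P)"
  proof (induction b)
    case (Suc b)
    then show ?case using homogeneous2_deriv(2) by fastforce
  qed (use assms in simp)
  have "homogeneous2 (m - a) ((deriv_s ^^ a) Q)" if "homogeneous2 m Q" for m Q
  proof (induction a)
    case (Suc a)
    then show ?case using homogeneous2_deriv(1) by fastforce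
  qed (use that in simp)
  from this[OF t] show ?thesis by (simp add: add.commute)
qed

lemma euler_relation:
  assumes "homogeneous2 n P"
  shows "var_s * deriv_s P + var_t * deriv_t P = of_nat n * P"
proof (rule form2_eqI)
  fix i j
  have s: "coeff (coeff (var_s * deriv_s P) j) i = of_nat i * coeff (coeff P j) i"
    by (cases i) (simp_all add: var_s_def coeff_deriv_s del: of_nat_Suc)
  have t: "coeff (coeff (var_t * deriv_t P) j) i = of_nat j * coeff (coeff P j) i"
    by (cases j) (simp_all add: var_t_def coeff_deriv_t del: of_nat_Suc)
  have n: "coeff (coeff (of_nat n * P) j) i = of_nat n * coeff (coeff P j) i"
    by (simp add: of_nat_poly)
  show "coeff (coeff (var_s * deriv_s P + var_t * deriv_t P) j) i = coeff (coeff (of_nat n * P) j) i"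
  proof (cases "coeff (coeff P j) i = 0")
    case False
    then have "i + j = n" using assms by (auto simp: homogeneous2_def)
    then have "(of_nat n :: complex) = of_nat i + of_nat j" by auto
    then show ?thesis unfolding n coeff_add s t by (simp add: distrib_right)
  qed (simp only: n coeff_add s t, simp)
qed

text \<open>In this chart the derivative by z is the partial derivative by t;
  \<open>fps_deriv_eval2_s\<close> treats the other chart. So Wronskians in z are determinants of
  pure partial derivatives.\<close>

lemma fps_deriv_eval2_t:
  "fps_deriv (eval2 fps_const P (fps_const s, fps_const t + fps_X)) =
    eval2 fps_const (deriv_t P) (fps_const s, fps_const t + fps_X)"
proof -
  have c: "poly (map_poly fps_const p) (fps_const s) = fps_const (poly p s)" for p
    by (induction p) (simp_all add: Polynomial.map_poly_pCons)
  have D: "comm_ring_hom (\<lambda>P. poly (map_poly (\<lambda>p. fps_const (poly p s)) P) (fps_const t + fps_X))"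
    using comm_ring_hom_eval2[OF comm_ring_hom_fps_const, of "(fps_const s, fps_const t + fps_X)"]
    by (simp add: eval2.simps c)
  show ?thesis
    unfolding eval2.simps c deriv_t_def
  proof (induction P)
    case (pCons a P)
    show ?case
      unfolding pderiv_pCons comm_ring_homD(3)[OF D]
      using pCons.IH by (simp add: Polynomial.map_poly_pCons)
  qed simp
qed

lemma fps_deriv_eval2_s:
  "fps_deriv (eval2 fps_const P (fps_X, fps_const t)) = eval2 fps_const (deriv_s P) (fps_X, fps_const t)"
proof -
  have c: "fps_deriv (poly (map_poly fps_const p) fps_X) = poly (map_poly fps_const (pderiv p)) fps_X"
    for p :: "complex poly"
  proof (induction p)
    case (pCons a p)
    show ?case
      unfolding pderiv_pCons comm_ring_homD(3)[OF comm_ring_hom_poly_map_poly[OF comm_ring_hom_fps_const]]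
      using pCons.IH by (simp add: Polynomial.map_poly_pCons)
  qed simp
  show ?thesis
    unfolding eval2.simps deriv_s_def
    by (induction P) (simp_all add: Polynomial.map_poly_pCons c)
qed

lemma fps_deriv_pow_eval2_t:
  "(fps_deriv ^^ i) (eval2 fps_const P (fps_const s, fps_const t + fps_X)) =
    eval2 fps_const ((deriv_t ^^ i) P) (fps_const s, fps_const t + fps_X)"
  by (induction i) (simp_all add: fps_deriv_eval2_t)

lemma fps_deriv_pow_eval2_s:
  "(fps_deriv ^^ i) (eval2 fps_const P (fps_X, fps_const t)) = eval2 fps_const ((deriv_s ^^ i) P) (fps_X, fps_const t)"
  by (induction i) (simp_all add: fps_deriv_eval2_s)

section \<open>Zeros of binary forms\<close>

lemma zero_order_eq: "zero_order P L = multiplicity (lin2 (fst (coords L)) (snd (coords L))) P"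
  by (simp add: zero_order_def lin2_def case_prod_unfold)

text \<open>In the local parameter the linear form of the point becomes a nonzero constant times z,
  namely t z for s = 0 and - s z otherwise, while the remaining factor does not vanish at z =
  0.\<close>

lemma subdegree_eval2_local_param:
  assumes "homogeneous2 n P" "P \<noteq> 0" "v \<noteq> (0, 0)"
  shows "subdegree (eval2 fps_const P (local_param v)) = multiplicity (lin2 (fst v) (snd v)) P"
proof -
  obtain s t where v: "v = (s, t)" by (cases v)
  let ?m = "multiplicity (lin2 s t) P"
  obtain Q where Q: "P = lin2 s t ^ ?m * Q" "eval2 id Q (s, t) \<noteq> 0"
    using homogeneous2_order_factor[OF assms(1,2)] assms(3) unfolding v by blast
  have "\<exists>c. c \<noteq> 0 \<and> eval2 fps_const (lin2 s t) (local_param (s, t)) = fps_const c * fps_X"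
  proof (cases "s = 0")
    case True
    then show ?thesis using assms(3)
      by (intro exI[of _ t]) (simp add: local_param_def eval2_lin2[OF comm_ring_hom_fps_const] v)
  next
    case False
    then show ?thesis
      by (intro exI[of _ "- s"])
        (simp add: local_param_def eval2_lin2[OF comm_ring_hom_fps_const] algebra_simps flip: fps_const_neg)
  qed
  then obtain c where c: "c \<noteq> 0" "eval2 fps_const (lin2 s t) (local_param (s, t)) = fps_const c * fps_X" by blast
  have q: "fps_nth (eval2 fps_const Q (local_param v)) 0 \<noteq> 0"
    using Q(2) by (simp add: fps_nth_0_eval2_local_param v)
  then have q': "eval2 fps_const Q (local_param v) \<noteq> 0" "subdegree (eval2 fps_const Q (local_param v)) = 0"
    by (auto simp: subdegree_eq_0_iff)
  have "eval2 fps_const P (local_param v) = (fps_const c * fps_X) ^ ?m * eval2 fps_const Q (local_param v)"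
    using arg_cong[OF Q(1), of "\<lambda>P. eval2 fps_const P (local_param v)"] c(2)
    unfolding comm_ring_homD(4,7)[OF comm_ring_hom_eval2[OF comm_ring_hom_fps_const]] by (simp add: v)
  also have "subdegree \<dots> = ?m" using c(1) q' by (simp add: subdegree_mult)
  finally show ?thesis by (simp add: v)
qed

lemma form_zeros_iff:
  assumes "homogeneous2 n P"
  shows "L \<in> form_zeros P \<longleftrightarrow> L \<in> line_points \<and> eval2 id P (coords L) = 0"
proof
  assume "L \<in> form_zeros P"
  then obtain s t where st: "(s, t) \<noteq> (0, 0)" "eval2 id P (s, t) = 0" "L = point1 (s, t)"
    unfolding form_zeros_def by auto
  then have L: "L \<in> line_points" unfolding line_points_def by blast
  obtain s' t' where c: "coords L = (s', t')" by (cases "coords L")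
  have "(s', t') \<in> point1 (s', t')" by (auto intro: exI[of _ 1])
  moreover have "point1 (s', t') = L" using line_points_coords(2)[OF L] unfolding c .
  then have "point1 (s', t') = point1 (s, t)" unfolding st(3) .
  ultimately have "(s', t') \<in> point1 (s, t)" by (simp only:)
  then obtain e where "s' = e * s" "t' = e * t" by auto
  then show "L \<in> line_points \<and> eval2 id P (coords L) = 0"
    using L st(2) eval2_scale[OF comm_ring_hom_id_complex assms, of e s t] c by simp
next
  assume L: "L \<in> line_points \<and> eval2 id P (coords L) = 0"
  then have "L = point1 (coords L)" "coords L \<noteq> (0, 0)" using line_points_coords by simp_all
  then show "L \<in> form_zeros P" using L unfolding form_zeros_def by blast
qed

text \<open>The zeros with nonzero s are roots of the dehomogenization. The point (0 : 1) is a zero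
  only if the degree drops below n, which leaves room for it in the count.\<close>

lemma form_zeros_finite_card:
  assumes P: "homogeneous2 n P" "P \<noteq> 0"
  shows "finite (form_zeros P)" "card (form_zeros P) \<le> n"
proof -
  let ?p = "dehom P"
  let ?R = "(\<lambda>t. point1 (1, t)) ` {t. poly ?p t = 0}"
  let ?I = "if coeff ?p n = 0 then {point1 (0, 1)} else {}"
  have p0: "?p \<noteq> 0" using homog_dehom[OF P(1)] P(2) by (auto simp: homog_def)
  have sub: "form_zeros P \<subseteq> ?R \<union> ?I"
  proof
    fix L assume L: "L \<in> form_zeros P"
    then obtain s t where st: "(s, t) \<noteq> (0, 0)" "eval2 id P (s, t) = 0" "L = point1 (s, t)"
      unfolding form_zeros_def by auto
    show "L \<in> ?R \<union> ?I"
    proof (cases "s = 0")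
      case True
      then have t: "t \<noteq> 0" using st(1) by simp
      have "t ^ n * eval2 id P (0, 1) = 0"
        using eval2_scale[OF comm_ring_hom_id_complex P(1), of t 0 1] st(2) True by simp
      moreover have "eval2 id P (0, 1) = coeff ?p n"
        unfolding eval2_homogeneous2[OF comm_ring_hom_id_complex P(1)]
        by (subst sum.remove[of _ n]) (auto intro!: sum.neutral simp: power_0_left)
      ultimately have "coeff ?p n = 0" using t by simp
      moreover have "L = point1 (0, 1)" using st(3) True t point1_eq_iff[of 0 t 0 1] by simp
      ultimately show ?thesis by simp
    next
      case False
      have "s ^ n * eval2 id P (1, t / s) = 0"
        using eval2_scale[OF comm_ring_hom_id_complex P(1), of s 1 "t / s"] st(2) False by simp
      then have "poly ?p (t / s) = 0"
        using False poly_eq_sum_atMost[OF degree_dehom_le[OF P(1)], of "t / s"]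
        by (simp add: eval2_homogeneous2[OF comm_ring_hom_id_complex P(1)])
      moreover have "L = point1 (1, t / s)" using st(3) False point1_eq_iff[of s t 1 "t / s"] by simp
      ultimately show ?thesis by blast
    qed
  qed
  have fin: "finite {t. poly ?p t = 0}" by (rule poly_roots_finite) fact
  then show "finite (form_zeros P)" using sub by (rule_tac finite_subset) auto
  have "card (form_zeros P) \<le> card (?R \<union> ?I)" using sub fin by (intro card_mono) auto
  also have "\<dots> \<le> card ?R + card ?I" by (rule card_Un_le)
  also have "card ?R \<le> card {t. poly ?p t = 0}" using fin by (rule card_image_le)
  also have "card {t. poly ?p t = 0} \<le> degree ?p" by (rule poly_roots_degree) fact
  also have "degree ?p + card ?I \<le> n"
  proof (cases "coeff ?p n = 0")
    case True
    then have "degree ?p \<noteq> n" using p0 by auto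
    then show ?thesis using True degree_dehom_le[OF P(1)] by simp
  qed (use degree_dehom_le[OF P(1)] in simp)
  finally show "card (form_zeros P) \<le> n" by simp
qed

section \<open>Conics\<close>

text \<open>The numbering of the coefficients follows \<open>conic_monomials\<close>: x^2, y^2, z^2,
  yz, xz, xy.\<close>

definition conic_form :: "(nat \<Rightarrow> complex) \<Rightarrow> form3" where
  "conic_form c = [:[:[:0, 0, c 0:], [:0, c 5:], [:c 1:]:], [:[:0, c 4:], [:c 3:]:], [:[:c 2:]:]:]"

lemma less_6_cases: "(m :: nat) < 6 \<Longrightarrow> m = 0 \<or> m = 1 \<or> m = 2 \<or> m = 3 \<or> m = 4 \<or> m = 5"
  by arith

lemma sum_lessThan_6:
  fixes u :: "nat \<Rightarrow> 'a::comm_monoid_add"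
  shows "(\<Sum>m<6. u m) = u 0 + u 1 + u 2 + u 3 + u 4 + u 5"
proof -
  have *: "{..<6 :: nat} = {0, 1, 2, 3, 4, 5}" by auto
  show ?thesis unfolding * by (simp add: add.assoc)
qed

lemma homogeneous3_conic_form: "homogeneous3 2 (conic_form c)"
  by (auto simp: homogeneous3_def conic_form_def coeff_pCons split: nat.splits)

lemma conic_form_eq_0_iff: "conic_form c = 0 \<longleftrightarrow> (\<forall>m<6. c m = 0)"
  using less_6_cases by (fastforce simp: conic_form_def)

lemma homogeneous3_2_imp_conic_form:
  assumes "homogeneous3 2 Q"
  obtains c where "Q = conic_form c"
proof -
  let ?q = "\<lambda>i j k. coeff (coeff (coeff Q k) j) i"
  define c where "c = (\<lambda>m. [?q 2 0 0, ?q 0 2 0, ?q 0 0 2, ?q 0 1 1, ?q 1 0 1, ?q 1 1 0] ! m)"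
  have "?q i j k = coeff (coeff (coeff (conic_form c) k) j) i" for i j k
  proof (cases "i + j + k = 2")
    case True
    then have "i = 2 \<and> j = 0 \<and> k = 0 \<or> i = 0 \<and> j = 2 \<and> k = 0 \<or> i = 0 \<and> j = 0 \<and> k = 2 \<or>
        i = 0 \<and> j = 1 \<and> k = 1 \<or> i = 1 \<and> j = 0 \<and> k = 1 \<or> i = 1 \<and> j = 1 \<and> k = 0"
      by presburger
    then show ?thesis
      by (elim disjE conjE) (simp_all add: conic_form_def c_def eval_nat_numeral)
  next
    case False
    then have "?q i j k = 0" "coeff (coeff (coeff (conic_form c) k) j) i = 0"
      using assms homogeneous3_conic_form[of c] unfolding homogeneous3_def by blast+
    then show ?thesis by simp
  qed
  then have "Q = conic_form c" by (simp add: poly_eq_iff)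
  then show ?thesis by (rule that)
qed

lemma eval3_conic_form:
  assumes "comm_ring_hom h"
  shows "eval3 h (conic_form c) (x, y, z) =
    h (c 0) * x ^ 2 + h (c 1) * y ^ 2 + h (c 2) * z ^ 2 + h (c 3) * (y * z) + h (c 4) * (x * z) + h (c 5) * (x * y)"
  using comm_ring_homD(1)[OF assms]
  by (simp add: conic_form_def eval3.simps Polynomial.map_poly_pCons power2_eq_square algebra_simps)

text \<open>\<open>branch_mult\<close> uses an arbitrary representative of the branch. A unit factor
  and a \<sigma> of order 1 leave the order of the series unchanged, so any representative may be
  used.\<close>

lemma branch_mult_branch_of:
  assumes Q: "homogeneous3 n Q"
  shows "branch_mult (branch_of \<gamma>) Q =
    (if eval3 fps_const Q \<gamma> = 0 then \<infinity> else enat (subdegree (eval3 fps_const Q \<gamma>)))"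
proof -
  have "coords (branch_of \<gamma>) \<in> branch_of \<gamma>"
    unfolding coords_def using in_branch_of_self by (rule someI)
  then obtain u \<sigma> where u: "fps_nth u 0 \<noteq> 0" and \<sigma>: "fps_nth \<sigma> 0 = 0" "fps_nth \<sigma> 1 \<noteq> 0"
    and c: "coords (branch_of \<gamma>) = reparametrize u \<sigma> \<gamma>" unfolding branch_of_def by blast
  let ?q = "eval3 fps_const Q \<gamma>"
  have q': "eval3 fps_const Q (coords (branch_of \<gamma>)) = u ^ n * fps_compose ?q \<sigma>"
    unfolding c using Q \<sigma>(1) by (rule eval3_reparametrize)
  show ?thesis
  proof (cases "?q = 0")
    case True
    then show ?thesis unfolding branch_mult_def q' by simp
  next
    case False
    let ?k = "subdegree ?q" and ?w = "fps_shift (subdegree ?q) ?q"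
    have "?q = fps_X ^ ?k * ?w" by (subst mult.commute) (rule subdegree_decompose)
    then have "fps_compose ?q \<sigma> = fps_compose (fps_X ^ ?k * ?w) \<sigma>" by simp
    also have "\<dots> = \<sigma> ^ ?k * fps_compose ?w \<sigma>"
      using \<sigma>(1) by (simp add: fps_compose_mult_distrib fps_compose_power[symmetric])
    finally have comp: "fps_compose ?q \<sigma> = \<sigma> ^ ?k * fps_compose ?w \<sigma>" .
    have "fps_nth (fps_compose ?w \<sigma>) 0 \<noteq> 0" using False by simp
    then have w: "fps_compose ?w \<sigma> \<noteq> 0" "subdegree (fps_compose ?w \<sigma>) = 0"
      using fps_zero_nth subdegree_eq_0_iff by metis+
    have s: "\<sigma> \<noteq> 0" "subdegree \<sigma> = 1" using \<sigma> by (auto intro!: subdegreeI simp: less_Suc0)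
    have u': "u \<noteq> 0" "subdegree u = 0" using u by (auto simp: subdegree_eq_0_iff)
    have "u ^ n * fps_compose ?q \<sigma> \<noteq> 0" "subdegree (u ^ n * fps_compose ?q \<sigma>) = ?k"
      unfolding comp using w s u' by (simp_all add: subdegree_mult)
    then show ?thesis using False unfolding branch_mult_def q' by simp
  qed
qed

section \<open>Conics along the branches of the curve\<close>

context rational_curve
begin

definition local_monomial :: "complex \<times> complex \<Rightarrow> nat \<Rightarrow> complex fps" where
  "local_monomial v j = eval2 fps_const (conic_monomials f ! j) (local_param v)"

lemma eval3_conic_form_local_branch:
  "eval3 fps_const (conic_form c) (local_branch v) = (\<Sum>m<6. fps_const (c m) * local_monomial v m)"
proof -
  let ?E = "\<lambda>P. eval2 fps_const P (local_param v)"
  note E = comm_ring_homD[OF comm_ring_hom_eval2[OF comm_ring_hom_fps_const]]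
  have "local_branch v = (?E f0, ?E f1, ?E f2)"
    unfolding local_branch_def by (cases "local_param v") simp
  then show ?thesis
    unfolding sum_lessThan_6 local_monomial_def
    by (simp add: eval3_conic_form[OF comm_ring_hom_fps_const] E(4,7))
qed

text \<open>A relation along one branch is the vanishing of a binary form at a local parameter,
  hence identically; the corresponding conic would vanish along \<open>f\<close> and be divisible by
  \<open>F\<close>.\<close>

lemma independent_local_monomials:
  assumes v: "v \<noteq> (0, 0)"
  shows "independent_fps 6 (local_monomial v)"
proof
  fix c assume "(\<Sum>m<6. fps_const (c m) * local_monomial v m) = 0"
  then have "eval2 fps_const (eval3 const2 (conic_form c) f) (local_param v) = 0"
    unfolding eval3_conic_form_local_branch[symmetric] eval3_local_branch .
  then have "eval3 const2 (conic_form c) f = 0"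
    using eval2_local_param_neq_0[OF homogeneous2_eval3[OF homogeneous3_conic_form hf] _ v] by blast
  then have "conic_form c = 0" using vanishing_low_degree[OF homogeneous3_conic_form] d by simp
  then show "\<forall>m<6. c m = 0" by (simp only: conic_form_eq_0_iff)
qed

lemma branch_mults_eq: "branch_mults (branch_at f L) = fps_orders 6 (local_monomial (coords L))"
proof (intro equalityI subsetI)
  fix h assume "h \<in> branch_mults (branch_at f L)"
  then obtain Q where Q: "conic Q" "branch_mult (branch_at f L) Q = enat h" unfolding branch_mults_def by blast
  then have hQ: "homogeneous3 2 Q" by (simp add: conic_def)
  obtain c where c: "Q = conic_form c" using homogeneous3_2_imp_conic_form[OF hQ] .
  let ?q = "eval3 fps_const Q (local_branch (coords L))"
  have "?q \<noteq> 0" "h = subdegree ?q"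
    using Q(2) unfolding branch_at_altdef branch_mult_branch_of[OF hQ] by (auto split: if_splits)
  moreover have "?q \<in> fps_span 6 (local_monomial (coords L))"
    unfolding c eval3_conic_form_local_branch fps_span_def by blast
  ultimately show "h \<in> fps_orders 6 (local_monomial (coords L))" unfolding fps_orders_def by blast
next
  fix h assume "h \<in> fps_orders 6 (local_monomial (coords L))"
  then obtain c where h: "h = subdegree (eval3 fps_const (conic_form c) (local_branch (coords L)))"
    and nz: "eval3 fps_const (conic_form c) (local_branch (coords L)) \<noteq> 0"
    unfolding fps_orders_def fps_span_def eval3_conic_form_local_branch by blast
  have "conic_form c \<noteq> 0"
    using nz comm_ring_homD(1)[OF comm_ring_hom_eval3[OF comm_ring_hom_fps_const]] by metis
  then have "conic (conic_form c)" by (simp add: conic_def homogeneous3_conic_form)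
  moreover have "branch_mult (branch_at f L) (conic_form c) = enat h"
    unfolding branch_at_altdef branch_mult_branch_of[OF homogeneous3_conic_form] using h nz by simp
  ultimately show "h \<in> branch_mults (branch_at f L)" unfolding branch_mults_def by blast
qed

text \<open>The weight subtracts 0 + 1 + ... + 5 = 15 from the sum of the six orders, and the
  Wronskian loses the same 15 by differentiation.\<close>

lemma branch_weight_eq_subdegree_wronskian:
  assumes "L \<in> line_points"
  shows "fps_wronskian 6 (local_monomial (coords L)) \<noteq> 0"
    and "branch_weight (branch_at f L) = int (subdegree (fps_wronskian 6 (local_monomial (coords L))))"
    and "finite (branch_mults (branch_at f L))"
    and "(\<Sum>h\<in>branch_mults (branch_at f L). h) = subdegree (fps_wronskian 6 (local_monomial (coords L))) + 15"
proof -
  interpret g: independent_fps 6 "local_monomial (coords L)"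
    by (rule independent_local_monomials) (rule line_points_coords(1)[OF assms])
  let ?W = "fps_wronskian 6 (local_monomial (coords L))"
  let ?H = "branch_mults (branch_at f L)"
  have H: "finite ?H" "card ?H = 6" "?W \<noteq> 0" "subdegree ?W + 15 = (\<Sum>h\<in>?H. h)"
    unfolding branch_mults_eq using g.finite_orders g.card_orders g.subdegree_wronskian
    by (simp_all add: eval_nat_numeral)
  show "?W \<noteq> 0" "finite ?H" "(\<Sum>h\<in>?H. h) = subdegree ?W + 15" using H by simp_all
  let ?l = "sorted_list_of_set ?H"
  have len: "length ?l = 6" using H by simp
  have "(\<Sum>i<6. ?l ! i) = sum_list ?l" using len by (simp add: sum_list_sum_nth lessThan_atLeast0)
  also have "\<dots> = (\<Sum>h\<in>?H. h)" using H(1) sum_list_distinct_conv_sum_set[of ?l "\<lambda>h. h"] by simp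
  finally have "(\<Sum>i<6. int (?l ! i)) = int (subdegree ?W + 15)" unfolding H(4) by (simp only: int_sum[symmetric])
  moreover have "(\<Sum>i<6. int i) = 15" by (simp add: eval_nat_numeral)
  ultimately show "branch_weight (branch_at f L) = int (subdegree ?W)"
    unfolding branch_weight_def sum_subtractf by simp
qed

section \<open>The Wronski determinant in a local parameter\<close>

definition partial :: "nat \<Rightarrow> nat \<Rightarrow> nat \<Rightarrow> form2" where
  "partial a b j = (deriv_s ^^ a) ((deriv_t ^^ b) (conic_monomials f ! j))"

lemma homogeneous2_conic_monomials: "j < 6 \<Longrightarrow> homogeneous2 (2 * d) (conic_monomials f ! j)"
proof -
  assume j: "j < 6"
  have "homogeneous2 (d + d) (P * Q)" if "homogeneous2 d P" "homogeneous2 d Q" for P Q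
    using homogeneous2_mult[OF that] .
  then show ?thesis using hf less_6_cases[OF j] by (auto simp: power2_eq_square mult_2)
qed

lemma homogeneous2_partial: "j < 6 \<Longrightarrow> homogeneous2 (2 * d - (a + b)) (partial a b j)"
  unfolding partial_def by (intro homogeneous2_deriv_pow homogeneous2_conic_monomials)

lemma euler_partial:
  assumes "j < 6"
  shows "var_s * partial (Suc a) b j + var_t * partial a (Suc b) j = of_nat (2 * d - (a + b)) * partial a b j"
proof -
  have "partial (Suc a) b j = deriv_s (partial a b j)" "partial a (Suc b) j = deriv_t (partial a b j)"
    by (simp_all add: partial_def deriv_t_deriv_s_pow)
  then show ?thesis using euler_relation[OF homogeneous2_partial[OF assms]] by simp
qed

lemma wronski_altdef: "wronski f = Determinant.det (Matrix.mat (Suc 5) (Suc 5) (\<lambda>(i, j). partial (5 - i) i j))"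
  by (simp add: wronski_def partial_def)

text \<open>The diagonal product from \<open>det_euler\<close> for p = 5 and forms of degree 2 d.
  Its factors are positive because r + i < 5 < 2 d.\<close>

definition euler_factor :: nat where
  "euler_factor = (\<Prod>i<Suc 5. \<Prod>r<5 - i. 2 * d - (r + i))"

lemma euler_factor_neq_0: "euler_factor \<noteq> 0"
  using d by (auto simp: euler_factor_def)

text \<open>Every entry is a derivative of total order 5, whatever its row, so each term of the
  Leibniz expansion has the same degree.\<close>

lemma homogeneous2_wronski: "homogeneous2 (6 * (2 * d - 5)) (wronski f)"
proof -
  have "homogeneous2 (6 * (2 * d - 5)) (signof \<pi> * (\<Prod>i = 0..<6. partial (5 - i) i (\<pi> i)))"
    if "\<pi> permutes {0..<6}" for \<pi> :: "nat \<Rightarrow> nat"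
  proof -
    have "homogeneous2 (\<Sum>i = 0..<6 :: nat. 2 * d - 5) (\<Prod>i = 0..<6. partial (5 - i) i (\<pi> i))"
    proof (rule homogeneous2_prod)
      fix i :: nat assume i: "i \<in> {0..<6}"
      then have "\<pi> i < 6" using permutes_in_image[OF that, of i] by simp
      then have "homogeneous2 (2 * d - ((5 - i) + i)) (partial (5 - i) i (\<pi> i))" by (rule homogeneous2_partial)
      then show "homogeneous2 (2 * d - 5) (partial (5 - i) i (\<pi> i))" using i by simp
    qed simp
    then show ?thesis by (auto simp: sign_def intro: homogeneous2_uminus)
  qed
  moreover have "wronski f = (\<Sum>\<pi> | \<pi> permutes {0..<6}. signof \<pi> * (\<Prod>i = 0..<6. partial (5 - i) i (\<pi> i)))"
  proof -
    have "Matrix.mat 6 6 (\<lambda>(i, j). partial (5 - i) i j) $$ (i, \<pi> i) = partial (5 - i) i (\<pi> i)"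
      if "\<pi> permutes {0..<6}" "i \<in> {0..<6}" for \<pi> i
      using that permutes_in_image[OF that(1), of i] by simp
    then show ?thesis unfolding wronski_altdef by (simp add: Determinant.det_def)
  qed
  ultimately show ?thesis by (auto intro: homogeneous2_sum)
qed

lemma mat_cong_6:
  assumes "\<And>i j. i < Suc 5 \<Longrightarrow> j < 6 \<Longrightarrow> u i j = v i j"
  shows "Determinant.det (Matrix.mat (Suc 5) (Suc 5) (\<lambda>(i, j). u i j)) =
    Determinant.det (Matrix.mat (Suc 5) (Suc 5) (\<lambda>(i, j). v i j))"
  by (rule arg_cong[where f = Determinant.det], rule eq_matI) (simp_all add: assms)

text \<open>Euler's relation removes the derivatives transversal to the chart: those by s when s is
  nonzero, those by t when s = 0. The coordinate used as scaling factor is a nonzero constant in the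
  respective chart.\<close>

lemma wronski_local_param:
  assumes v: "v \<noteq> (0, 0)"
  shows "\<exists>c c'. c \<noteq> 0 \<and> c' \<noteq> 0 \<and>
    fps_const c * eval2 fps_const (wronski f) (local_param v) = fps_const c' * fps_wronskian 6 (local_monomial v)"
proof -
  obtain s t where st: "v = (s, t)" by (cases v)
  let ?E = "\<lambda>P. eval2 fps_const P (local_param v)"
  have hE: "comm_ring_hom ?E" by (rule comm_ring_hom_eval2[OF comm_ring_hom_fps_const])
  \<comment> \<open>The value 0 for j >= 6 makes Euler's relation hold for all j, as
    \<open>det_euler\<close> requires.\<close>
  define D where "D a b j = (if j < 6 then ?E (partial a b j) else 0)" for a b j
  have E: "?E var_s * D (Suc a) b j + ?E var_t * D a (Suc b) j = of_nat (2 * d - (a + b)) * D a b j" for a b j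
    unfolding D_def
    using arg_cong[OF euler_partial, of j ?E a b] unfolding comm_ring_homD(3,4,10)[OF hE] by simp
  have W: "?E (wronski f) = Determinant.det (Matrix.mat (Suc 5) (Suc 5) (\<lambda>(i, j). D (5 - i) i j))"
    unfolding wronski_altdef hom_det_mat[OF hE]
    by (rule arg_cong[where f = Determinant.det], rule eq_matI) (simp_all add: D_def)
  have of_nat: "(of_nat euler_factor :: complex fps) = fps_const (of_nat euler_factor)" by (simp add: fps_of_nat)
  show ?thesis
  proof (cases "s = 0")
    case False
    then have l: "local_param v = (fps_const s, fps_const t + fps_X)" by (simp add: st local_param_def)
    have "Determinant.det (Matrix.mat (Suc 5) (Suc 5) (\<lambda>(i, j). D 0 i j)) = fps_wronskian 6 (local_monomial v)"
      unfolding fps_wronskian_def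
      by (rule arg_cong[where f = Determinant.det], rule eq_matI)
        (simp_all add: D_def partial_def local_monomial_def l fps_deriv_pow_eval2_t)
    then have "(\<Prod>i<Suc 5. ?E var_s ^ (5 - i)) * ?E (wronski f) = of_nat euler_factor * fps_wronskian 6 (local_monomial v)"
      using det_euler[of 5 "?E var_s" D "?E var_t" "2 * d", OF E] unfolding W euler_factor_def by simp
    moreover have "(\<Prod>i<Suc 5. ?E var_s ^ (5 - i)) = fps_const (\<Prod>i<Suc 5. s ^ (5 - i))"
      unfolding l eval2_var[OF comm_ring_hom_fps_const] comm_ring_homD(7,9)[OF comm_ring_hom_fps_const] ..
    moreover have "(\<Prod>i<Suc 5. s ^ (5 - i)) \<noteq> 0" using False by simp
    ultimately show ?thesis using euler_factor_neq_0 unfolding of_nat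
      by (metis of_nat_eq_0_iff)
  next
    case True
    then have t: "t \<noteq> 0" and l: "local_param v = (fps_X, fps_const t)" using v by (simp_all add: st local_param_def)
    have W': "Determinant.det (Matrix.mat (Suc 5) (Suc 5) (\<lambda>(i, j). D i 0 j)) = fps_wronskian 6 (local_monomial v)"
      unfolding fps_wronskian_def
      by (rule arg_cong[where f = Determinant.det], rule eq_matI)
        (simp_all add: D_def partial_def local_monomial_def l fps_deriv_pow_eval2_s)
    \<comment> \<open>Euler's relation with the roles of s and t exchanged.\<close>
    have E': "?E var_t * D b (Suc a) j + ?E var_s * D (Suc b) a j = of_nat (2 * d - (a + b)) * D b a j" for a b j
      using E[of b a j] by (simp add: add.commute)
    have 1: "(\<Prod>i<Suc 5. ?E var_t ^ (5 - i)) * Determinant.det (Matrix.mat (Suc 5) (Suc 5) (\<lambda>(i, j). D i (5 - i) j)) =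
        of_nat euler_factor * fps_wronskian 6 (local_monomial v)"
      using det_euler[of 5 "?E var_t" "\<lambda>a b j. D b a j" "?E var_s" "2 * d", OF E'] unfolding W' euler_factor_def by simp
    obtain e where e: "e = 1 \<or> e = -1"
      "Determinant.det (Matrix.mat (Suc 5) (Suc 5) (\<lambda>(i, j). D (5 - (5 - i)) (5 - i) j)) = e * ?E (wronski f)"
      using det_mat_reverse_rows[of 5 "\<lambda>i j. D (5 - i) i j"] unfolding W by blast
    have "Determinant.det (Matrix.mat (Suc 5) (Suc 5) (\<lambda>(i, j). D i (5 - i) j)) = e * ?E (wronski f)"
      unfolding e(2)[symmetric] by (rule mat_cong_6) simp
    then have "(\<Prod>i<Suc 5. ?E var_t ^ (5 - i)) * (e * ?E (wronski f)) = of_nat euler_factor * fps_wronskian 6 (local_monomial v)"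
      using 1 by simp
    moreover have "(\<Prod>i<Suc 5. ?E var_t ^ (5 - i)) = fps_const (\<Prod>i<Suc 5. t ^ (5 - i))"
      unfolding l eval2_var[OF comm_ring_hom_fps_const] comm_ring_homD(7,9)[OF comm_ring_hom_fps_const] ..
    moreover obtain e' where "e = fps_const e'" "e' \<noteq> 0"
      using e(1) by (metis fps_const_1_eq_1 fps_const_neg neg_equal_0_iff_equal zero_neq_one)
    ultimately have "fps_const ((\<Prod>i<Suc 5. t ^ (5 - i)) * e') * ?E (wronski f) =
        fps_const (of_nat euler_factor) * fps_wronskian 6 (local_monomial v)"
      unfolding of_nat by (simp only: fps_const_mult[symmetric] mult.assoc)
    moreover have "(\<Prod>i<Suc 5. t ^ (5 - i)) * e' \<noteq> 0" using t \<open>e' \<noteq> 0\<close> by simp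
    ultimately show ?thesis using euler_factor_neq_0 by (metis of_nat_eq_0_iff)
  qed
qed

lemma subdegree_wronski_local_param:
  assumes L: "L \<in> line_points"
  shows "wronski f \<noteq> 0"
    and "subdegree (fps_wronskian 6 (local_monomial (coords L))) = zero_order (wronski f) L"
proof -
  note v = line_points_coords(1)[OF L]
  obtain c c' where c: "c \<noteq> 0" "c' \<noteq> 0" and
    eq: "fps_const c * eval2 fps_const (wronski f) (local_param (coords L)) =
      fps_const c' * fps_wronskian 6 (local_monomial (coords L))"
    using wronski_local_param[OF v] by blast
  have W: "fps_wronskian 6 (local_monomial (coords L)) \<noteq> 0" by (rule branch_weight_eq_subdegree_wronskian(1)[OF L])
  then have E: "eval2 fps_const (wronski f) (local_param (coords L)) \<noteq> 0" using eq c by auto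
  then show "wronski f \<noteq> 0" using comm_ring_homD(1)[OF comm_ring_hom_eval2[OF comm_ring_hom_fps_const]] by metis
  then have "zero_order (wronski f) L = subdegree (eval2 fps_const (wronski f) (local_param (coords L)))"
    unfolding zero_order_eq using subdegree_eval2_local_param[OF homogeneous2_wronski _ v] by simp
  then show "subdegree (fps_wronskian 6 (local_monomial (coords L))) = zero_order (wronski f) L"
    using arg_cong[OF eq, of subdegree] c E W by (simp add: subdegree_mult)
qed

lemma wronski_neq_0: "wronski f \<noteq> 0"
  by (rule subdegree_wronski_local_param(1)[OF point1_in_line_points[of "(1, 0)"]]) simp

lemma branch_weight_branch_at:
  assumes "L \<in> line_points"
  shows "branch_weight (branch_at f L) = int (zero_order (wronski f) L)"
  using branch_weight_eq_subdegree_wronskian(2)[OF assms] subdegree_wronski_local_param(2)[OF assms] by simp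

lemma zero_order_pos_iff:
  assumes "L \<in> line_points"
  shows "zero_order (wronski f) L > 0 \<longleftrightarrow> L \<in> form_zeros (wronski f)"
proof -
  let ?w = "eval2 fps_const (wronski f) (local_param (coords L))"
  have "?w \<noteq> 0" using eval2_local_param_neq_0[OF homogeneous2_wronski wronski_neq_0 line_points_coords(1)[OF assms]] .
  then have "subdegree ?w > 0 \<longleftrightarrow> fps_nth ?w 0 = 0" by (metis neq0_conv subdegree_eq_0_iff)
  then show ?thesis
    using subdegree_eval2_local_param[OF homogeneous2_wronski wronski_neq_0 line_points_coords(1)[OF assms]] assms
    by (simp add: zero_order_eq fps_nth_0_eval2_local_param form_zeros_iff[OF homogeneous2_wronski])
qed

text \<open>A line through the point pulls back to a binary form, which is nonzero because a line
  cannot contain a curve of degree d >= 3; the fibre lies among its finitely many zeros.\<close>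

lemma finite_fibre: "finite {L \<in> line_points. image_point f L = p}"
proof (cases "{L \<in> line_points. image_point f L = p} = {}")
  case True
  then show ?thesis by (simp only: finite.emptyI)
next
  case False
  then obtain L where L: "L \<in> line_points" "image_point f L = p" by blast
  obtain x y z where xyz: "eval_triple id f (coords L) = (x, y, z)" by (cases "eval_triple id f (coords L)")
  have nz: "(x, y, z) \<noteq> (0, 0, 0)" using f_no_common_zero[OF line_points_coords(1)[OF L(1)]] xyz by simp
  \<comment> \<open>The line joining the point to (0 : 0 : 1), or the line x = 0 if the point is (0
    : 0 : 1) itself.\<close>
  define \<Lambda> where "\<Lambda> = (if x = 0 \<and> y = 0 then var_x else const3 y * var_x - const3 x * var_y)"
  have \<Lambda>: "homogeneous3 1 \<Lambda>"
    unfolding \<Lambda>_def by (auto intro!: homogeneous3_diff homogeneous3_cmult homogeneous3_var simp del: One_nat_def)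
  have "\<Lambda> \<noteq> 0" by (auto simp: \<Lambda>_def var_x_def var_y_def const3_def)
  then have nz': "eval3 const2 \<Lambda> f \<noteq> 0" using vanishing_low_degree[OF \<Lambda>] d by auto
  have h: "homogeneous2 (1 * d) (eval3 const2 \<Lambda> f)" by (rule homogeneous2_eval3[OF \<Lambda> hf])
  note K = comm_ring_hom_id_complex
  have ev: "eval3 id \<Lambda> (x, y, z) = 0"
    by (simp add: \<Lambda>_def eval3_var[OF K] eval3_const3[OF K] comm_ring_homD(4,6)[OF comm_ring_hom_eval3[OF K]])
  have "M \<in> form_zeros (eval3 const2 \<Lambda> f)" if M: "M \<in> line_points" "image_point f M = p" for M
  proof -
    obtain x' y' z' where M': "eval_triple id f (coords M) = (x', y', z')" by (cases "eval_triple id f (coords M)")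
    have "(x', y', z') \<in> point2 (x', y', z')" by (auto intro: exI[of _ 1])
    then have "(x', y', z') \<in> point2 (x, y, z)" using M(2) L(2) M' xyz by (simp add: image_point_def del: point2.simps)
    then obtain e where "x' = e * x" "y' = e * y" "z' = e * z" by auto
    then have "eval3 id \<Lambda> (eval_triple id f (coords M)) = 0"
      unfolding M' using eval3_scale[OF K \<Lambda>, of e x y z] ev by simp
    then show ?thesis using M(1) form_zeros_iff[OF h] eval3_f[OF K] by simp
  qed
  then have "{M \<in> line_points. image_point f M = p} \<subseteq> form_zeros (eval3 const2 \<Lambda> f)" by blast
  then show ?thesis using form_zeros_finite_card(1)[OF h nz'] finite_subset by blast
qed

lemma finite_branches: "finite (branches F p)"
  unfolding branches_eq using finite_fibre by (rule finite_imageI)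

text \<open>The branches at p correspond bijectively to the parameters mapped to p, and those that
  are not zeros of the Wronskian contribute 0.\<close>

lemma weight2_eq:
  "weight2 F p = (\<Sum>M \<in> {M \<in> form_zeros (wronski f). image_point f M = p}. int (zero_order (wronski f) M))"
proof -
  let ?A = "{M \<in> line_points. image_point f M = p}"
  have "weight2 F p = (\<Sum>M\<in>?A. branch_weight (branch_at f M))"
    unfolding weight2_def branches_eq
    by (rule sum.reindex_cong[of "branch_at f" ?A]) (auto intro: inj_on_subset[OF inj_on_branch_at])
  also have "\<dots> = (\<Sum>M\<in>?A. int (zero_order (wronski f) M))"
    using branch_weight_branch_at by simp
  also have "\<dots> = (\<Sum>M \<in> {M \<in> form_zeros (wronski f). image_point f M = p}. int (zero_order (wronski f) M))"
    using finite_fibre zero_order_pos_iff form_zeros_iff[OF homogeneous2_wronski]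
    by (intro sum.mono_neutral_right) auto
  finally show ?thesis .
qed

lemma on_curve_image_point: "on_curve F (image_point f L)"
proof -
  obtain x y z where xyz: "eval_triple id f (coords L) = (x, y, z)" by (cases "eval_triple id f (coords L)")
  obtain c where c: "coords (point2 (x, y, z)) = (c * x, c * y, c * z)" by (rule coords_point2)
  note K = comm_ring_hom_id_complex
  have "eval3 id F (x, y, z) = 0"
    unfolding xyz[symmetric] eval3_f[OF K] F_f by (rule comm_ring_homD(1)[OF comm_ring_hom_eval2[OF K]])
  then show ?thesis
    unfolding on_curve_def image_point_def xyz c eval3_scale[OF K hF] by simp
qed

text \<open>Six distinct orders with sum greater than \<open>0 + 1 + 2 + 3 + 4 + 5\<close> include one greater than 5.\<close>

lemma weierstrass2_point_zero:
  assumes L: "L \<in> form_zeros (wronski f)"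
  shows "weierstrass2_point F (image_point f L)"
proof -
  have L': "L \<in> line_points" using L form_zeros_iff[OF homogeneous2_wronski] by blast
  let ?H = "branch_mults (branch_at f L)"
  have "(\<Sum>h\<in>?H. h) > 15"
    using branch_weight_eq_subdegree_wronskian(4)[OF L'] subdegree_wronski_local_param(2)[OF L']
      zero_order_pos_iff[OF L'] L by simp
  moreover have "(\<Sum>h\<in>?H. h) \<le> 15" if "?H \<subseteq> {..5}"
  proof -
    have "(\<Sum>h\<in>?H. h) \<le> (\<Sum>h\<in>{..5}. h)" using that by (intro sum_mono2) auto
    also have "\<dots> = 15" by (simp add: eval_nat_numeral)
    finally show ?thesis .
  qed
  ultimately obtain h where h: "h \<in> ?H" "h > 5" by force
  then obtain Q where Q: "conic Q" "branch_mult (branch_at f L) Q = enat h" unfolding branch_mults_def by blast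
  have "branch_at f L \<in> branches F (image_point f L)" using L' by (auto simp: branches_eq)
  \<comment> \<open>The other branches at the point can only add to the multiplicity; finiteness is
    essential, since \<open>sum\<close> over an infinite set is 0.\<close>
  then have "branch_mult (branch_at f L) Q \<le> curve_mult F Q (image_point f L)"
    unfolding curve_mult_def using finite_branches by (intro member_le_sum) auto
  moreover have "(5 :: enat) < enat h" using h(2) by (metis enat_ord_simps(2) enat_numeral)
  ultimately have "curve_mult F Q (image_point f L) > 5" unfolding Q(2) by (rule order.strict_trans2[rotated])
  then show ?thesis unfolding weierstrass2_point_def using on_curve_image_point Q(1) by blast
qed

end

text \<open>Several zeros may lie over one point with several branches. Hence the order of a single
  zero is compared with the weight of its own branch, and with that of the point in the unibranched
  case, while in general the orders of all zeros over the point are added.\<close>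

theorem theorem4p4:
  fixes d :: nat and F :: form3 and f :: "form2 triple"
  assumes "d \<ge> 3"
    and "irreducible_plane_curve d F"
    and "rational_parametrization d F f"
  shows "finite (form_zeros (wronski f)) \<and>
    card (form_zeros (wronski f)) \<le> 6 * (2 * d - 5) \<and>
    (\<forall>L \<in> form_zeros (wronski f).
       weierstrass2_point F (image_point f L) \<and>
       branch_at f L \<in> branches F (image_point f L) \<and>
       branch_weight (branch_at f L) = int (zero_order (wronski f) L) \<and>
       (unibranched F (image_point f L) \<longrightarrow>
          weight2 F (image_point f L) = int (zero_order (wronski f) L)) \<and>
       weight2 F (image_point f L) =
         (\<Sum>M \<in> {M \<in> form_zeros (wronski f). image_point f M = image_point f L}.
            int (zero_order (wronski f) M)))"
proof -
  obtain f0 f1 f2 where f: "f = (f0, f1, f2)" by (cases f)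
  obtain n A B where "homogeneous3 n A" "homogeneous3 n B"
    "eval3 const2 A (f0, f1, f2) \<noteq> 0 \<or> eval3 const2 B (f0, f1, f2) \<noteq> 0"
    "var_t * eval3 const2 A (f0, f1, f2) = var_s * eval3 const2 B (f0, f1, f2)"
    using assms(3) unfolding f rational_parametrization.simps by blast
  then interpret rational_curve d F f0 f1 f2 n A B
    using assms unfolding f rational_parametrization.simps irreducible_plane_curve_def by unfold_locales blast+
  note Z = form_zeros_finite_card[OF homogeneous2_wronski wronski_neq_0]
  show ?thesis
    unfolding f
  proof (intro conjI ballI impI)
    fix L assume L: "L \<in> form_zeros (wronski (f0, f1, f2))"
    then have L': "L \<in> line_points" using form_zeros_iff[OF homogeneous2_wronski] by blast
    let ?p = "image_point (f0, f1, f2) L"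
    show "weierstrass2_point F ?p" by (rule weierstrass2_point_zero[OF L])
    show br: "branch_at (f0, f1, f2) L \<in> branches F ?p" using L' by (auto simp: branches_eq)
    show w: "branch_weight (branch_at (f0, f1, f2) L) = int (zero_order (wronski (f0, f1, f2)) L)"
      by (rule branch_weight_branch_at[OF L'])
    show "weight2 F ?p = int (zero_order (wronski (f0, f1, f2)) L)" if "unibranched F ?p"
    proof -
      have "branches F ?p = {branch_at (f0, f1, f2) L}"
        using that br unfolding unibranched_def by (metis card_1_singletonE singletonD)
      then show ?thesis using w by (simp add: weight2_def)
    qed
    show "weight2 F ?p = (\<Sum>M \<in> {M \<in> form_zeros (wronski (f0, f1, f2)). image_point (f0, f1, f2) M = ?p}.
        int (zero_order (wronski (f0, f1, f2)) M))" by (rule weight2_eq)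
  qed (rule Z)+
qed

end
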